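(* Let $G$ be a locally compact, second countable topological group of the form $G=\bigcup_{n=1}^\infty K_n$, where $K_1<K_2<\cdots$ is a strictly increasing sequence of compact open subgroups of $G$ (so $G$ is not compactly generated). Let $\rho$, $w$ and the operators $S_g$ on $H=L_2(G,w)$ be as defined in the context. For every ergodic probability measure preserving free $G$-action $\mathbf{X}=(X,\mathcal{B},\mu,\{T_g\}_{g\in G})$ on a standard Lebesgue probability space, there exists an $\{S_g\}_{g\in G}$-invariant probability measure $\nu$ on $H=L_2(G,w)$ which is positive on every nonempty open subset of $H$ and such that the $G$-actions $\mathbf{X}$ and $(H,\mathrm{Borel}(H),\nu,\{S_g\}_{g\in G})$ are isomorphic.
   Context: Let $p_1,p_2,\dots$ be positive real numbers with $\sum_{n=1}^\infty p_n=1$ such that for some $C>0$ one has $p_n/p_{n+1}\le C$ for every $n$. Let $\lambda_n$ be the normalized Haar measure of the compact subgroup $K_n$, viewed as a probability measure on $G$, and let $\rho=\sum_{n=1}^\infty p_n\lambda_n$. Put $w=\sum_{n=1}^\infty p_n\rho^{*n}$, where $\rho^{*n}$ is the $n$-th convolution power of $\rho$. Let $H=L_2(G,w)$ be the Hilbert space of real-valued functions that are square integrable with respect to $w$. For $g\in G$ the operator $S_g$ is given by $(S_g\xi)(h)=\xi(hg)$, $h\in G$; these are bounded operators on $H$ and $g\mapsto S_g$ is a representation of $G$. Actions of $G$ are (jointly) measurable. An action is free if $\mu$-almost every point has trivial stabilizer. Isomorphism of $G$-actions is meant in the measure-theoretic sense: a measure preserving bijection between subsets of full measure which intertwines, for every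 $g\in G$, the actions of $g$ almost everywhere. *)

theory Defs
  imports "HOL-Probability.Probability"
begin

text \<open>
  Groups are written additively, since the library's class of (not necessarily commutative)
  topological groups is \<^class>\<open>topological_group_add\<close>: \<open>g + h\<close> is the product \<open>gh\<close>, and \<open>0\<close>
  is the identity.  Commutativity is never assumed.
\<close>

section \<open>Measures on the group\<close>

definition add_subgroup :: "'g::group_add set \<Rightarrow> bool" where
  "add_subgroup K \<longleftrightarrow> 0 \<in> K \<and> (\<forall>x\<in>K. \<forall>y\<in>K. x + y \<in> K) \<and> (\<forall>x\<in>K. - x \<in> K)"

text \<open>The normalized Haar measure of \<open>K\<close>, as a probability measure on the whole group that is
  concentrated on \<open>K\<close>.  Left invariance determines it, and implies right invariance, because \<open>K\<close>
  is compact.\<close>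

definition normalized_haar :: "'g::topological_group_add set \<Rightarrow> 'g measure \<Rightarrow> bool" where
  "normalized_haar K \<mu> \<longleftrightarrow>
     sets \<mu> = sets borel \<and> prob_space \<mu> \<and> emeasure \<mu> K = 1 \<and>
     (\<forall>k\<in>K. distr \<mu> borel (\<lambda>x. k + x) = \<mu>)"

text \<open>\<open>\<Sum>\<^sub>n p\<^sub>n \<mu>\<^sub>n\<close>.  Sequences indexed by \<open>1, 2, \<dots>\<close> in the mathematics are shifted to start at
  \<open>0\<close>; hence \<open>\<Sum>\<^sub>n p\<^sub>n \<rho>\<^sup>*\<^sup>n\<close> becomes \<open>mixture p (\<lambda>n. conv_power \<rho> (Suc n))\<close>.\<close>

definition mixture :: "(nat \<Rightarrow> real) \<Rightarrow> (nat \<Rightarrow> 'g::topological_space measure) \<Rightarrow> 'g measure" where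
  "mixture p \<mu> = measure_of UNIV (sets borel) (\<lambda>A. \<Sum>n. ennreal (p n) * emeasure (\<mu> n) A)"

lemma sets_mixture [simp]: "sets (mixture p \<mu>) = sets borel"
  unfolding mixture_def by (metis sets.sets_measure_of_eq space_borel)

lemma space_mixture [simp]: "space (mixture p \<mu>) = UNIV"
  using sets_eq_imp_space_eq[OF sets_mixture] by simp

lemma emeasure_mixture:
  assumes \<mu>: "\<And>n. sets (\<mu> n) = sets borel" and A: "A \<in> sets borel"
  shows "emeasure (mixture p \<mu>) A = (\<Sum>n. ennreal (p n) * emeasure (\<mu> n) A)"
proof (rule emeasure_measure_of[OF mixture_def])
  show "countably_additive (sets (mixture p \<mu>)) (\<lambda>A. \<Sum>n. ennreal (p n) * emeasure (\<mu> n) A)"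
  proof (rule countably_additiveI)
    fix B :: "nat \<Rightarrow> 'a set"
    assume B: "range B \<subseteq> sets (mixture p \<mu>)" "disjoint_family B"
    have "(\<Sum>i. \<Sum>n. ennreal (p n) * emeasure (\<mu> n) (B i)) =
          (\<Sum>n. \<Sum>i. ennreal (p n) * emeasure (\<mu> n) (B i))"
      unfolding nn_integral_count_space_nat[symmetric]
      by (rule pair_sigma_finite.Fubini')
         (auto intro!: pair_sigma_finite.intro sigma_finite_measure_count_space)
    also have "\<dots> = (\<Sum>n. ennreal (p n) * emeasure (\<mu> n) (\<Union>i. B i))"
      using B by (simp add: suminf_emeasure \<mu>)
    finally show "(\<Sum>i. \<Sum>n. ennreal (p n) * emeasure (\<mu> n) (B i)) =
        (\<Sum>n. ennreal (p n) * emeasure (\<mu> n) (\<Union>i. B i))" .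
  qed
qed (use A in \<open>auto simp: positive_def\<close>)

text \<open>The library's convolution is restricted to Euclidean spaces.\<close>

definition conv :: "'g::topological_monoid_add measure \<Rightarrow> 'g measure \<Rightarrow> 'g measure" where
  "conv \<mu> \<nu> = distr (\<mu> \<Otimes>\<^sub>M \<nu>) borel (\<lambda>(x, y). x + y)"

primrec conv_power :: "'g::topological_monoid_add measure \<Rightarrow> nat \<Rightarrow> 'g measure" where
  "conv_power \<mu> 0 = return borel 0"
| "conv_power \<mu> (Suc n) = conv \<mu> (conv_power \<mu> n)"

section \<open>The space of square integrable functions modulo null sets\<close>

definition L2_fun :: "'a measure \<Rightarrow> ('a \<Rightarrow> real) set" where
  "L2_fun w = {f \<in> borel_measurable w. integrable w (\<lambda>x. (f x)\<^sup>2)}"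

definition L2_rel :: "'a measure \<Rightarrow> (('a \<Rightarrow> real) \<times> ('a \<Rightarrow> real)) set" where
  "L2_rel w = {(f, g). f \<in> L2_fun w \<and> g \<in> L2_fun w \<and> (AE x in w. f x = g x)}"

definition L2 :: "'a measure \<Rightarrow> ('a \<Rightarrow> real) set set" where
  "L2 w = L2_fun w // L2_rel w"

text \<open>The metric of the norm; it does not depend on the representatives
  (\<open>L2_dist_class\<close> below).\<close>

definition L2_dist :: "'a measure \<Rightarrow> ('a \<Rightarrow> real) set \<Rightarrow> ('a \<Rightarrow> real) set \<Rightarrow> real" where
  "L2_dist w a b = sqrt (\<integral>x. ((SOME f. f \<in> a) x - (SOME g. g \<in> b) x)\<^sup>2 \<partial>w)"

definition L2_topology :: "'a measure \<Rightarrow> ('a \<Rightarrow> real) set topology" where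
  "L2_topology w = Metric_space.mtopology (L2 w) (L2_dist w)"

text \<open>The operator \<open>S\<^sub>g\<close>, with \<open>(S\<^sub>g \<xi>)(h) = \<xi>(hg)\<close>, on equivalence classes.\<close>

definition L2_translate ::
  "'g::group_add measure \<Rightarrow> 'g \<Rightarrow> ('g \<Rightarrow> real) set \<Rightarrow> ('g \<Rightarrow> real) set" where
  "L2_translate w g a = (\<Union>f\<in>a. L2_rel w `` {\<lambda>h. f (h + g)})"

lemma equiv_L2_rel: "equiv (L2_fun w) (L2_rel w)"
proof (rule equivI)
  show "L2_rel w \<subseteq> L2_fun w \<times> L2_fun w" by (auto simp: L2_rel_def)
  show "refl_on (L2_fun w) (L2_rel w)" by (auto simp: refl_on_def L2_rel_def)
  show "sym (L2_rel w)" by (auto simp: sym_def L2_rel_def)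
  show "trans (L2_rel w)" by (auto simp: trans_def L2_rel_def)
qed

lemma L2_dist_class:
  assumes "a \<in> L2 w" "b \<in> L2 w" "f \<in> a" "g \<in> b"
  shows "L2_dist w a b = sqrt (\<integral>x. (f x - g x)\<^sup>2 \<partial>w)"
proof -
  define f' g' where "f' = (SOME f. f \<in> a)" and "g' = (SOME g. g \<in> b)"
  have "f' \<in> a" "g' \<in> b" using assms unfolding f'_def g'_def by (metis someI)+
  then have "(f, f') \<in> L2_rel w" "(g, g') \<in> L2_rel w"
    using assms quotient_eq_iff[OF equiv_L2_rel] unfolding L2_def by blast+
  then have *: "f \<in> borel_measurable w" "f' \<in> borel_measurable w" "g \<in> borel_measurable w"
      "g' \<in> borel_measurable w" "AE x in w. f x = f' x" "AE x in w. g x = g' x"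
    by (auto simp: L2_rel_def L2_fun_def)
  have "(\<integral>x. (f' x - g' x)\<^sup>2 \<partial>w) = (\<integral>x. (f x - g x)\<^sup>2 \<partial>w)"
    by (rule integral_cong_AE) (use * in auto)
  then show ?thesis unfolding L2_dist_def f'_def g'_def by simp
qed

lemma L2_fun_mult: "integrable w (\<lambda>x. u x * v x)" if "u \<in> L2_fun w" "v \<in> L2_fun w"
proof (rule Bochner_Integration.integrable_bound[where f="\<lambda>x. (u x)\<^sup>2 + (v x)\<^sup>2"])
  have "\<bar>a * b\<bar> \<le> a\<^sup>2 + b\<^sup>2" for a b :: real
  proof -
    have "0 \<le> (\<bar>a\<bar> - \<bar>b\<bar>)\<^sup>2" by simp
    then have "2 * (\<bar>a\<bar> * \<bar>b\<bar>) \<le> a\<^sup>2 + b\<^sup>2" by (simp add: power2_diff)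
    moreover have "0 \<le> \<bar>a\<bar> * \<bar>b\<bar>" by simp
    ultimately show ?thesis unfolding abs_mult by linarith
  qed
  then show "AE x in w. norm (u x * v x) \<le> norm ((u x)\<^sup>2 + (v x)\<^sup>2)" by simp
qed (use that in \<open>auto simp: L2_fun_def\<close>)

lemma L2_fun_diff: "(\<lambda>x. u x - v x) \<in> L2_fun w" if "u \<in> L2_fun w" "v \<in> L2_fun w"
  using that L2_fun_mult[OF that] by (auto simp: L2_fun_def power2_diff mult.assoc)

lemma L2_fun_minkowski:
  assumes u: "u \<in> L2_fun w" and v: "v \<in> L2_fun w"
  shows "sqrt (\<integral>x. (u x + v x)\<^sup>2 \<partial>w) \<le> sqrt (\<integral>x. (u x)\<^sup>2 \<partial>w) + sqrt (\<integral>x. (v x)\<^sup>2 \<partial>w)"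
proof -
  define A B D where "A = (\<integral>x. (u x)\<^sup>2 \<partial>w)" and "B = (\<integral>x. (v x)\<^sup>2 \<partial>w)" and "D = (\<integral>x. u x * v x \<partial>w)"
  note iu = u[unfolded L2_fun_def] and iv = v[unfolded L2_fun_def]
  have exp: "(\<integral>x. (s * u x + t * v x)\<^sup>2 \<partial>w) = s\<^sup>2 * A + t\<^sup>2 * B + 2 * s * t * D" for s t :: real
  proof -
    have "(\<integral>x. (s * u x + t * v x)\<^sup>2 \<partial>w) =
        (\<integral>x. s\<^sup>2 * (u x)\<^sup>2 + t\<^sup>2 * (v x)\<^sup>2 + 2 * s * t * (u x * v x) \<partial>w)"
      by (intro Bochner_Integration.integral_cong) (auto simp: algebra_simps power2_eq_square)
    also have "\<dots> = s\<^sup>2 * A + t\<^sup>2 * B + 2 * s * t * D"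
      unfolding A_def B_def D_def using iu iv L2_fun_mult[OF u v] by simp
    finally show ?thesis .
  qed
  have A: "A \<ge> 0" and B: "B \<ge> 0" by (auto simp: A_def B_def)
  have q: "0 \<le> s\<^sup>2 * A + t\<^sup>2 * B + 2 * s * t * D" for s t
    unfolding exp[symmetric] by simp
  have D: "D \<le> sqrt A * sqrt B"
  proof (cases "A = 0 \<or> B = 0")
    case True
    have "D \<le> 0"
    proof (rule ccontr)
      assume "\<not> D \<le> 0"
      then show False using True q[of 1 "- (A + 1) / D"] q[of "- (B + 1) / D" 1] A B by auto
    qed
    then show ?thesis using A B True by auto
  next
    case False
    then have p: "sqrt A > 0" "sqrt B > 0" using A B by auto
    have "0 \<le> (sqrt B)\<^sup>2 * A + (- sqrt A)\<^sup>2 * B + 2 * sqrt B * (- sqrt A) * D" by (rule q)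
    also have "\<dots> = 2 * (sqrt A * sqrt B) * (sqrt A * sqrt B - D)"
      using A B by (simp add: algebra_simps power2_eq_square)
    finally have "0 \<le> 2 * (sqrt A * sqrt B) * (sqrt A * sqrt B - D)" .
    moreover have "0 < 2 * (sqrt A * sqrt B)" using p by simp
    ultimately have "0 \<le> sqrt A * sqrt B - D" using zero_le_mult_iff not_less by blast
    then show ?thesis by simp
  qed
  have "(\<integral>x. (u x + v x)\<^sup>2 \<partial>w) = A + B + 2 * D" using exp[of 1 1] by simp
  also have "\<dots> \<le> (sqrt A + sqrt B)\<^sup>2" using D A B by (simp add: power2_sum)
  finally show ?thesis using A B
    unfolding A_def[symmetric] B_def[symmetric] by (intro real_le_lsqrt) auto
qed

lemma Metric_space_L2: "Metric_space (L2 w) (L2_dist w)"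
proof
  show "0 \<le> L2_dist w a b" for a b by (simp add: L2_dist_def)
  show "L2_dist w a b = L2_dist w b a" for a b by (simp add: L2_dist_def power2_commute)
next
  have rep: "\<exists>f. f \<in> a \<and> f \<in> L2_fun w" if "a \<in> L2 w" for a
    using that equiv_class_self[OF equiv_L2_rel] unfolding L2_def by (auto elim!: quotientE)
  fix a b assume ab: "a \<in> L2 w" "b \<in> L2 w"
  obtain f g where f: "f \<in> a" "f \<in> L2_fun w" and g: "g \<in> b" "g \<in> L2_fun w"
    using rep ab by blast
  have "L2_dist w a b = 0 \<longleftrightarrow> (\<integral>x. (f x - g x)\<^sup>2 \<partial>w) = 0"
    using L2_dist_class[OF ab f(1) g(1)] by simp
  also have "\<dots> \<longleftrightarrow> (AE x in w. (f x - g x)\<^sup>2 = 0)"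
    using L2_fun_diff[OF f(2) g(2)]
    by (intro integral_nonneg_eq_0_iff_AE) (auto simp: L2_fun_def)
  also have "\<dots> \<longleftrightarrow> (f, g) \<in> L2_rel w" using f g by (simp add: L2_rel_def)
  also have "\<dots> \<longleftrightarrow> a = b"
    using quotient_eq_iff[OF equiv_L2_rel, of a w b f g] ab f g by (auto simp: L2_def)
  finally show "L2_dist w a b = 0 \<longleftrightarrow> a = b" .
  fix c assume c: "c \<in> L2 w"
  obtain h where h: "h \<in> c" "h \<in> L2_fun w" using rep c by blast
  show "L2_dist w a c \<le> L2_dist w a b + L2_dist w b c"
    using L2_fun_minkowski[OF L2_fun_diff[OF f(2) g(2)] L2_fun_diff[OF g(2) h(2)]]
      L2_dist_class[OF ab f(1) g(1)] L2_dist_class[OF ab(2) c g(1) h(1)]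
      L2_dist_class[OF ab(1) c f(1) h(1)] by simp
qed

lemma topspace_L2_topology: "topspace (L2_topology w) = L2 w"
  unfolding L2_topology_def by (rule Metric_space.topspace_mtopology[OF Metric_space_L2])

text \<open>\<open>L2_translate\<close> is the translation operator as soon as translation preserves null sets
  and square integrability.\<close>

lemma L2_translate_class:
  assumes w: "sets w = sets (borel :: 'g::topological_group_add measure)"
    and null: "\<And>N. N \<in> null_sets w \<Longrightarrow> (\<lambda>h. h + g) -` N \<in> null_sets w"
    and L2: "\<And>f. f \<in> L2_fun w \<Longrightarrow> (\<lambda>h. f (h + g)) \<in> L2_fun w"
    and f: "f \<in> L2_fun w"
  shows "L2_translate w g (L2_rel w `` {f}) = L2_rel w `` {\<lambda>h. f (h + g)}"
proof -
  have "((\<lambda>h. f (h + g)), (\<lambda>h. f' (h + g))) \<in> L2_rel w" if "f' \<in> L2_rel w `` {f}" for f'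
  proof -
    have f': "f' \<in> L2_fun w" "AE x in w. f x = f' x" using that by (auto simp: L2_rel_def)
    then obtain N where N: "N \<in> null_sets w" "{x\<in>space w. f x \<noteq> f' x} \<subseteq> N"
      by (auto elim!: AE_E3 simp: eventually_ae_filter)
    have "space w = UNIV" using sets_eq_imp_space_eq[OF w] by simp
    then have "AE h in w. f (h + g) = f' (h + g)"
      using N(2) by (intro AE_I'[OF null[OF N(1)]]) auto
    then show ?thesis using L2 f f' by (auto simp: L2_rel_def)
  qed
  moreover have "f \<in> L2_rel w `` {f}" using f by (rule equiv_class_self[OF equiv_L2_rel])
  ultimately show ?thesis
    unfolding L2_translate_def using equiv_class_eq[OF equiv_L2_rel] by blast
qed


section \<open>Measure preserving actions\<close>

definition borel_sigma :: "'a topology \<Rightarrow> 'a measure" where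
  "borel_sigma X = sigma (topspace X) {U. openin X U}"

text \<open>A Polish space with its Borel sets and a Borel probability measure (not completed).\<close>

definition standard_prob_space :: "'x measure \<Rightarrow> bool" where
  "standard_prob_space M \<longleftrightarrow> prob_space M \<and>
     (\<exists>X. completely_metrizable_space X \<and> second_countable X \<and>
          topspace X = space M \<and> sets M = sets (borel_sigma X))"

definition pmp_action :: "'x measure \<Rightarrow> ('g::topological_group_add \<Rightarrow> 'x \<Rightarrow> 'x) \<Rightarrow> bool" where
  "pmp_action M T \<longleftrightarrow> prob_space M \<and>
     (\<lambda>(g, x). T g x) \<in> borel \<Otimes>\<^sub>M M \<rightarrow>\<^sub>M M \<and>
     (\<forall>x\<in>space M. T 0 x = x) \<and>
     (\<forall>g h. \<forall>x\<in>space M. T (g + h) x = T g (T h x)) \<and>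
     (\<forall>g. distr M M (T g) = M)"

text \<open>Invariance of a set is understood modulo null sets, for each group element separately.\<close>

definition ergodic_action :: "'x measure \<Rightarrow> ('g \<Rightarrow> 'x \<Rightarrow> 'x) \<Rightarrow> bool" where
  "ergodic_action M T \<longleftrightarrow>
     (\<forall>A\<in>sets M. (\<forall>g. AE x in M. T g x \<in> A \<longleftrightarrow> x \<in> A) \<longrightarrow> measure M A = 0 \<or> measure M A = 1)"

definition free_action :: "'x measure \<Rightarrow> ('g::zero \<Rightarrow> 'x \<Rightarrow> 'x) \<Rightarrow> bool" where
  "free_action M T \<longleftrightarrow> (AE x in M. \<forall>g. T g x = x \<longrightarrow> g = 0)"

text \<open>The exceptional null set in the intertwining relation may depend on \<open>g\<close>.\<close>

definition isomorphic_actions ::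
  "'x measure \<Rightarrow> ('g \<Rightarrow> 'x \<Rightarrow> 'x) \<Rightarrow> 'y measure \<Rightarrow> ('g \<Rightarrow> 'y \<Rightarrow> 'y) \<Rightarrow> bool" where
  "isomorphic_actions M T N S \<longleftrightarrow>
     (\<exists>X0\<in>sets M. \<exists>Y0\<in>sets N. \<exists>\<phi>.
        emeasure M (space M - X0) = 0 \<and> emeasure N (space N - Y0) = 0 \<and>
        bij_betw \<phi> X0 Y0 \<and>
        \<phi> \<in> restrict_space M X0 \<rightarrow>\<^sub>M restrict_space N Y0 \<and>
        the_inv_into X0 \<phi> \<in> restrict_space N Y0 \<rightarrow>\<^sub>M restrict_space M X0 \<and>
        distr (restrict_space M X0) (restrict_space N Y0) \<phi> = restrict_space N Y0 \<and>
        (\<forall>g. AE x in M. x \<in> X0 \<and> T g x \<in> X0 \<and> \<phi> (T g x) = S g (\<phi> x)))"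

end

theory Submission
  imports Defs
begin

text \<open>
  For a square integrable function \<open>f\<close> on \<open>X\<close> let \<open>\<Phi>(x)\<close> be the class of \<open>h \<mapsto> f(T\<^sub>h x)\<close> in
  \<open>L\<^sub>2(G,w)\<close>.  Then \<open>\<Phi>(T\<^sub>g x) = S\<^sub>g \<Phi>(x)\<close>, so the image measure of \<open>\<mu>\<close> under \<open>\<Phi>\<close> is invariant, and one needs
  an \<open>f\<close> for which \<open>\<Phi>\<close> is injective up to a null set and visits every ball of \<open>L\<^sub>2(G,w)\<close> with
  positive probability.

  Injectivity is cheap.  If \<open>\<Phi>(x) = \<Phi>(y)\<close>, then \<open>f(T\<^sub>h x) = f(T\<^sub>h y)\<close> for almost every \<open>h\<close>, and one
  such \<open>h\<close> at which \<open>f\<close> determines the point gives \<open>x = y\<close>.  So let \<open>f\<close> be an injective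
  real code with almost surely irrational values off a set \<open>D\<close> of measure at most \<open>1/2\<close>, and
  rational on \<open>D\<close>; by ergodicity almost every orbit spends positive time at irrational values
  (\<open>orbit_map_inj\<close>, \<open>AE_orbit_visits\<close>).  The values on \<open>D\<close> remain free, apart from being rational,
  and serve to obtain full support.

  The main tool is a density statement (\<open>rational_step_dense\<close>).  If the stabilizer of \<open>x\<close> is
  trivial, then \<open>h \<mapsto> T\<^sub>h x\<close> is injective, and by Lusin's theorem the pullbacks of one
  countable family of rational step functions \<open>F\<close> on \<open>X\<close> are dense in \<open>L\<^sub>2(G,w)\<close>.  As the family
  is countable, for every target \<open>\<xi>\<close> a single \<open>F\<close> satisfies \<open>F(T\<^sub>h x) \<approx> \<xi>(h)\<close> for all \<open>x\<close> in a set of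
  positive measure.  The same density yields, for every \<open>n\<close>, arbitrarily small \<open>K\<^sub>n\<close>-invariant
  sets \<open>B\<close> that meet a given set of positive measure (\<open>small_invariant_set\<close>); here it matters that
  \<open>K\<^sub>n\<close> has arbitrarily large index in later groups of the tower.  Redefining a
  bounded function to be \<open>F\<close> on such a set \<open>B\<close> changes it very little, but for the good
  points \<open>x \<in> B\<close> it produces an orbit function that equals \<open>F(T\<^sub>h x)\<close> for all \<open>h \<in> K\<^sub>n\<close>, and
  outside \<open>K\<^sub>n\<close> the measure \<open>w\<close> has small mass.  Doing this successively for
  countably many targets, with summable changes, gives \<open>f\<close> (\<open>generic_function_exists\<close>).

  Two facts make the image of \<open>\<mu>\<close> a model.  Translations distort \<open>w\<close> by bounded factors
  (\<open>w_translate_le\<close>), so that the operators \<open>S\<^sub>g\<close> are defined on classes and Lipschitz, and the action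
  on \<open>L\<^sub>2(G,w)\<close> is jointly measurable.  And the inverse of \<open>\<Phi>\<close> is measurable after removal of a
  null set, again by Lusin's theorem (\<open>injective_image_measurable_mod_null\<close>).
\<close>

section \<open>Compact inner regularity and a theorem of Lusin\<close>

definition compact_inner_regular :: "'a topology \<Rightarrow> 'a measure \<Rightarrow> bool" where
  "compact_inner_regular X \<mu> \<longleftrightarrow>
     (\<forall>E\<in>sets \<mu>. \<forall>e>0. \<exists>C. compactin X C \<and> C \<subseteq> E \<and> measure \<mu> (E - C) < e)"

lemma sets_borel_sigma: "sets (borel_sigma X) = sigma_sets (topspace X) {U. openin X U}"
  unfolding borel_sigma_def by (rule sets_measure_of) (auto dest: openin_subset)

lemma space_borel_sigma [simp]: "space (borel_sigma X) = topspace X"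
  unfolding borel_sigma_def by (rule space_measure_of) (auto dest: openin_subset)

lemma borel_sigma_open: "openin X U \<Longrightarrow> U \<in> sets (borel_sigma X)"
  unfolding sets_borel_sigma by auto

lemma borel_sigma_closed: "closedin X C \<Longrightarrow> C \<in> sets (borel_sigma X)"
  by (metis borel_sigma_open closedin_def double_diff order_refl sets.compl_sets space_borel_sigma)

lemma sets_borel_sigma_euclidean: "sets (borel_sigma (euclidean :: 'a::topological_space topology)) = sets borel"
  unfolding sets_borel_sigma by (simp add: borel_def)

text \<open>The error budget for countably many compact approximations: the bounds sum to \<open>e/2\<close>, which
  keeps the final inequality strict.\<close>

lemma (in finite_measure) measure_Union_geometric:
  assumes "\<And>i::nat. B i \<in> sets M" "\<And>i. measure M (B i) < e * (1/2)^(i+2)" "e > 0"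
  shows "measure M (\<Union>i. B i) < e"
proof -
  have s: "(\<lambda>i. e * (1/2)^(i+2)) sums (e/2)"
    using sums_mult[OF geometric_sums[of "1/2::real"], of "e/4"] by (simp add: field_simps)
  have sm: "summable (\<lambda>i. measure M (B i))"
    by (rule summable_comparison_test'[OF sums_summable[OF s], of 0]) (use assms less_imp_le in auto)
  have "measure M (\<Union>i. B i) \<le> (\<Sum>i. measure M (B i))"
    by (rule finite_measure_subadditive_countably) (use assms sm in auto)
  also have "\<dots> \<le> (\<Sum>i. e * (1/2)^(i+2))"
    by (rule suminf_le) (use assms sm s less_imp_le sums_summable in auto)
  also have "\<dots> = e/2" using s sums_unique by metis
  finally show ?thesis using assms by simp
qed

text \<open>The sets that can be approximated from within together with their complements form a
  sigma-algebra: for the complement of a union one intersects compact subsets of the complements,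
  and such an intersection is again compact.  Hence open and closed sets are enough.\<close>

lemma compact_inner_regularI:
  assumes fin: "finite_measure \<mu>" and sets: "sets \<mu> = sets (borel_sigma X)" and H: "Hausdorff_space X"
    and op: "\<And>U e. openin X U \<Longrightarrow> (e::real) > 0 \<Longrightarrow> \<exists>C. compactin X C \<and> C \<subseteq> U \<and> measure \<mu> (U - C) < e"
    and cl: "\<And>U e. closedin X U \<Longrightarrow> (e::real) > 0 \<Longrightarrow> \<exists>C. compactin X C \<and> C \<subseteq> U \<and> measure \<mu> (U - C) < e"
  shows "compact_inner_regular X \<mu>"
proof -
  interpret finite_measure \<mu> by fact
  define A where "A E \<longleftrightarrow> E \<in> sets \<mu> \<and> (\<forall>e>0. \<exists>C. compactin X C \<and> C \<subseteq> E \<and> measure \<mu> (E - C) < e)" for E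
  have cs: "C \<in> sets \<mu>" if "compactin X C" for C
    using compactin_imp_closedin[OF H that] by (simp add: sets borel_sigma_closed)
  have "A E \<and> A (topspace X - E)" if "E \<in> sigma_sets (topspace X) {U. openin X U}" for E
    using that
  proof induction
    case (Basic U)
    then have "openin X U" "closedin X (topspace X - U)" by auto
    then show ?case unfolding A_def using op cl by (auto simp: sets borel_sigma_open borel_sigma_closed)
  next
    case Empty
    show ?case unfolding A_def
      using op[of "topspace X"] by (auto simp: sets borel_sigma_open intro!: exI[of _ "{}"])
  next
    case (Compl a)
    have "a \<subseteq> topspace X" using Compl(1) sigma_sets_into_sp[of "{U. openin X U}" "topspace X"]
      by (auto dest: openin_subset)
    then show ?case using Compl.IH by (simp add: double_diff)
  next
    case (Union a)
    have meas: "a i \<in> sets \<mu>" "topspace X - a i \<in> sets \<mu>" for i using Union.IH A_def by auto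
    have 1: "\<exists>C. compactin X C \<and> C \<subseteq> (\<Union>i. a i) \<and> measure \<mu> ((\<Union>i. a i) - C) < e" if "e > 0" for e
    proof -
      have pos: "0 < e * (1/2)^(i+2)" for i :: nat using that by simp
      have "\<forall>i. \<exists>C. compactin X C \<and> C \<subseteq> a i \<and> measure \<mu> (a i - C) < e * (1/2)^(i+2)"
        using Union.IH pos unfolding A_def by blast
      then obtain C where C: "\<And>i. compactin X (C i)" "\<And>i. C i \<subseteq> a i"
        "\<And>i. measure \<mu> (a i - C i) < e * (1/2)^(i+2)" by metis
      define D where "D n = (\<Union>i. a i) - (\<Union>i<n. C i)" for n::nat
      have Dm: "range D \<subseteq> sets \<mu>" using meas cs[OF C(1)] by (auto simp: D_def)
      have dec: "decseq D" by (auto simp: decseq_def D_def)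
      have "(\<Inter>n. D n) \<subseteq> (\<Union>i. a i - C i)"
      proof
        fix x assume x: "x \<in> (\<Inter>n. D n)"
        then obtain i where "x \<in> a i" unfolding D_def by blast
        moreover have "x \<in> D (Suc i)" using x by blast
        ultimately show "x \<in> (\<Union>i. a i - C i)" unfolding D_def by blast
      qed
      then have "measure \<mu> (\<Inter>n. D n) \<le> measure \<mu> (\<Union>i. a i - C i)"
        by (rule finite_measure_mono) (use meas cs[OF C(1)] in auto)
      also have "\<dots> < e" by (rule measure_Union_geometric) (use meas cs[OF C(1)] C that in auto)
      finally have "\<forall>\<^sub>F n in sequentially. measure \<mu> (D n) < e"
        using finite_Lim_measure_decseq[OF Dm dec] by (simp add: order_tendstoD)
      then obtain n where n: "measure \<mu> (D n) < e" using eventually_happens'[OF sequentially_bot] by blast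
      have "compactin X (\<Union>i<n. C i)" using C by (intro compactin_Union) auto
      then show ?thesis using n C(2) unfolding D_def by (intro exI[of _ "\<Union>i<n. C i"]) auto
    qed
    have 2: "\<exists>C. compactin X C \<and> C \<subseteq> topspace X - (\<Union>i. a i) \<and> measure \<mu> ((topspace X - (\<Union>i. a i)) - C) < e" if "e > 0" for e
    proof -
      have pos: "0 < e * (1/2)^(i+2)" for i :: nat using that by simp
      have "\<forall>i. \<exists>C. compactin X C \<and> C \<subseteq> topspace X - a i \<and> measure \<mu> ((topspace X - a i) - C) < e * (1/2)^(i+2)"
        using Union.IH pos unfolding A_def by blast
      then obtain C where C: "\<And>i. compactin X (C i)" "\<And>i. C i \<subseteq> topspace X - a i"
        "\<And>i. measure \<mu> ((topspace X - a i) - C i) < e * (1/2)^(i+2)" by metis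
      have "closedin X (\<Inter>i. C i)"
      proof (rule closedin_Inter)
        show "closedin X S" if "S \<in> range C" for S using that compactin_imp_closedin[OF H C(1)] by auto
      qed simp
      then have "compactin X (\<Inter>i. C i)" by (rule closed_compactin[OF C(1)[of 0], rotated]) auto
      moreover have "measure \<mu> ((topspace X - (\<Union>i. a i)) - (\<Inter>i. C i)) \<le> measure \<mu> (\<Union>i. (topspace X - a i) - C i)"
      proof (rule finite_measure_mono)
        show "(topspace X - (\<Union>i. a i)) - (\<Inter>i. C i) \<subseteq> (\<Union>i. (topspace X - a i) - C i)" by blast
        show "(\<Union>i. (topspace X - a i) - C i) \<in> sets \<mu>" using sets.Diff[OF meas(2) cs[OF C(1)]] by blast
      qed
      moreover have "\<dots> < e" by (rule measure_Union_geometric) (use meas cs[OF C(1)] C that in auto)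
      ultimately show ?thesis using C(2) by (intro exI[of _ "\<Inter>i. C i"]) auto
    qed
    have "(\<Union>i. a i) \<in> sets \<mu>" "topspace X - (\<Union>i. a i) \<in> sets \<mu>"
      using meas sets.compl_sets[of "\<Union>i. a i" \<mu>] sets_eq_imp_space_eq[OF sets] by (auto simp: sets.countable_UN)
    then show ?case using 1 2 unfolding A_def by blast
  qed
  then show ?thesis unfolding compact_inner_regular_def using A_def sets sets_borel_sigma by metis
qed

text \<open>Tightness carries the argument: finitely many balls of each radius \<open>1/(n+1)\<close> cover all but a
  small part of the space, and the intersection of these finite unions is closed and totally
  bounded, hence compact in a complete metric.\<close>

lemma compact_inner_regular_Polish:
  assumes fin: "finite_measure \<mu>" and sets: "sets \<mu> = sets (borel_sigma X)"
    and X: "completely_metrizable_space X" "second_countable X"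
  shows "compact_inner_regular X \<mu>"
proof -
  interpret finite_measure \<mu> by fact
  obtain M d where Md: "Metric_space M d" "Metric_space.mcomplete M d" "X = Metric_space.mtopology M d"
    using X(1) completely_metrizable_space_def by blast
  interpret Metric_space M d by fact
  have ts: "topspace X = M" by (simp add: Md)
  have H: "Hausdorff_space X" by (simp add: Md Hausdorff_space_mtopology)
  obtain S where S: "countable S" "S \<subseteq> M" "X closure_of S = M"
    using second_countable_imp_separable_space[OF X(2)] unfolding separable_space_def ts by blast
  have sp: "space \<mu> = M" using sets_eq_imp_space_eq[OF sets] ts by simp
  have tight: "\<exists>K. compactin X K \<and> measure \<mu> (M - K) < e" if e: "e > 0" for e
  proof (cases "M = {}")
    case True
    then show ?thesis using e by (intro exI[of _ "{}"]) auto
  next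
    case False
    then have "S \<noteq> {}" using S(3) by auto
    define x where "x = from_nat_into S"
    have xS: "x i \<in> M" for i using from_nat_into[OF \<open>S \<noteq> {}\<close>, of i] S(2) unfolding x_def by auto
    have cover: "\<exists>i. y \<in> mcball (x i) r" if yr: "y \<in> M" "r > 0" for y r
    proof -
      have "y \<in> mtopology closure_of S" using yr S Md by auto
      then obtain s where "s \<in> S" "s \<in> mball y r" using yr(2) unfolding metric_closure_of by blast
      moreover obtain i where "s = x i" using \<open>s \<in> S\<close> S(1) unfolding x_def by (metis from_nat_into_surj)
      ultimately have "y \<in> mcball (x i) r" using yr commute[of y s] by auto
      then show ?thesis by blast
    qed
    have "\<exists>k. measure \<mu> (M - (\<Union>i<k. mcball (x i) (1/Suc n))) < e * (1/2)^(n+2)" for n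
    proof -
      define D where "D k = M - (\<Union>i<k. mcball (x i) (1/Suc n))" for k::nat
      have "range D \<subseteq> sets \<mu>"
      proof safe
        fix j
        have "mcball (x i) (1/Suc n) \<in> sets \<mu>" for i
          unfolding sets Md(3) by (rule borel_sigma_closed) auto
        then have "(\<Union>i<j. mcball (x i) (1/Suc n)) \<in> sets \<mu>" by auto
        then show "D j \<in> sets \<mu>" unfolding D_def sp[symmetric] by (rule sets.compl_sets)
      qed
      moreover have "decseq D" by (auto simp: decseq_def D_def)
      moreover have "(\<Inter>k. D k) = {}"
      proof -
        have False if y: "y \<in> (\<Inter>k. D k)" for y
        proof -
          have "y \<in> D 0" using y by blast
          then obtain i where "y \<in> mcball (x i) (1/Suc n)" using cover[of y "1/Suc n"] unfolding D_def by auto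
          moreover have "y \<in> D (Suc i)" using y by blast
          ultimately show False unfolding D_def by blast
        qed
        then show ?thesis by blast
      qed
      ultimately have "(\<lambda>k. measure \<mu> (D k)) \<longlonglongrightarrow> 0" using finite_Lim_measure_decseq[of D] by simp
      then have "\<forall>\<^sub>F k in sequentially. measure \<mu> (D k) < e * (1/2)^(n+2)"
        using e by (intro order_tendstoD) auto
      then show ?thesis unfolding D_def using eventually_happens'[OF sequentially_bot] by blast
    qed
    then obtain k where k: "\<And>n. measure \<mu> (M - (\<Union>i<k n. mcball (x i) (1/Suc n))) < e * (1/2)^(n+2)" by metis
    define K where "K = (\<Inter>n. \<Union>i<k n. mcball (x i) (1/Suc n))"
    have clf: "closedin X (\<Union>i<k n. mcball (x i) (1/Suc n))" for n
      unfolding Md(3) by (intro closedin_Union) auto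
    have clK: "closedin X K" unfolding K_def by (intro closedin_Inter) (use clf in auto)
    have "mtotally_bounded K" unfolding mtotally_bounded_def
    proof (intro allI impI)
      fix r :: real assume r: "r > 0"
      obtain n where n: "1/Suc n < r/2" using nat_approx_posE[of "r/2"] r by auto
      define J where "J = {i. i < k n \<and> K \<inter> mcball (x i) (1/Suc n) \<noteq> {}}"
      have "\<forall>i\<in>J. \<exists>z. z \<in> K \<inter> mcball (x i) (1/Suc n)" unfolding J_def by blast
      then obtain z where z: "\<And>i. i \<in> J \<Longrightarrow> z i \<in> K \<inter> mcball (x i) (1/Suc n)" by metis
      have "K \<subseteq> (\<Union>u\<in>z ` J. mball u r)"
      proof
        fix y assume y: "y \<in> K"
        then obtain i where i: "i < k n" "y \<in> mcball (x i) (1/Suc n)" unfolding K_def by blast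
        then have iJ: "i \<in> J" unfolding J_def using y by blast
        have zi: "d (x i) (z i) \<le> 1/Suc n" "z i \<in> M" using z[OF iJ] by auto
        have "d (z i) y \<le> d (z i) (x i) + d (x i) y" by (rule triangle) (use i zi in auto)
        also have "\<dots> < r" using zi i n commute[of "z i" "x i"] by auto
        finally show "y \<in> (\<Union>u\<in>z ` J. mball u r)" using iJ zi i by auto
      qed
      moreover have "finite (z ` J)" unfolding J_def by auto
      ultimately show "\<exists>F. finite F \<and> F \<subseteq> K \<and> K \<subseteq> (\<Union>u\<in>F. mball u r)" using z by blast
    qed
    then have "compactin mtopology (mtopology closure_of K)"
      using mtotally_bounded_eq_compact_closure_of[OF Md(2)] by blast
    then have "compactin X K" using clK Md(3) closure_of_closedin by metis
    moreover have "measure \<mu> (M - K) < e"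
    proof -
      have m: "M - (\<Union>i<k n. mcball (x i) (1/Suc n)) \<in> sets \<mu>" for n
        using sets.compl_sets[of _ \<mu>] clf[of n] by (metis borel_sigma_closed sets sp)
      have "measure \<mu> (M - K) \<le> measure \<mu> (\<Union>n. M - (\<Union>i<k n. mcball (x i) (1/Suc n)))"

      proof (rule finite_measure_mono)
        show "M - K \<subseteq> (\<Union>n. M - (\<Union>i<k n. mcball (x i) (1/Suc n)))" unfolding K_def by blast
        show "(\<Union>n. M - (\<Union>i<k n. mcball (x i) (1/Suc n))) \<in> sets \<mu>" using m by blast
      qed
      also have "\<dots> < e" by (rule measure_Union_geometric[OF m k e])
      finally show ?thesis .
    qed
    ultimately show ?thesis by blast
  qed
  have cs: "C \<in> sets \<mu>" if "compactin X C" for C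
    using compactin_imp_closedin[OF H that] by (simp add: sets borel_sigma_closed)
  have cl: "\<exists>C. compactin X C \<and> C \<subseteq> U \<and> measure \<mu> (U - C) < e" if U: "closedin X U" and e: "e > 0" for U e
  proof -
    obtain K where K: "compactin X K" "measure \<mu> (M - K) < e" using tight[OF e] by blast
    have "measure \<mu> (U - U \<inter> K) \<le> measure \<mu> (M - K)"
      by (rule finite_measure_mono) (use sets.compl_sets[OF cs[OF K(1)]] closedin_subset[OF U] ts sp in auto)
    then show ?thesis using K closed_Int_compactin[OF U K(1)] by (intro exI[of _ "U \<inter> K"]) auto
  qed
  show ?thesis
  proof (rule compact_inner_regularI[OF fin sets H _ cl])
    fix U and e :: real assume U: "openin X U" and e: "e > 0"
    have "fsigma_in X U" using open_imp_fsigma_in U X(1) completely_metrizable_imp_metrizable_space by blast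
    then obtain C where C: "\<And>n::nat. closedin X (C n)" "\<And>n. C n \<subseteq> C (Suc n)" "(\<Union>n. C n) = U"
      unfolding fsigma_in_ascending by blast
    have m: "range C \<subseteq> sets \<mu>" using borel_sigma_closed[OF C(1)] unfolding sets by blast
    have "(\<lambda>n. measure \<mu> (C n)) \<longlonglongrightarrow> measure \<mu> U"
      using finite_Lim_measure_incseq[OF m] incseq_SucI[of C, OF C(2)] C(3) by simp
    then have "\<forall>\<^sub>F n in sequentially. measure \<mu> (C n) > measure \<mu> U - e/2"
      using e by (intro order_tendstoD) auto
    then obtain n where n: "measure \<mu> (C n) > measure \<mu> U - e/2" using eventually_happens'[OF sequentially_bot] by blast
    obtain D where D: "compactin X D" "D \<subseteq> C n" "measure \<mu> (C n - D) < e/2" using cl[OF C(1)[of n], of "e/2"] e by auto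
    have Us: "U \<in> sets \<mu>" using U by (simp add: sets borel_sigma_open)
    have sub: "C n \<subseteq> U" using C(3) by blast
    have Cn: "C n \<in> sets \<mu>" using m by blast
    have "measure \<mu> (U - D) = measure \<mu> U - measure \<mu> D" "measure \<mu> (C n - D) = measure \<mu> (C n) - measure \<mu> D"
      using finite_measure_Diff[OF Us cs[OF D(1)]] finite_measure_Diff[OF Cn cs[OF D(1)]] D(2) sub by auto
    then have "measure \<mu> (U - D) < e" using n D by linarith
    then show "\<exists>C. compactin X C \<and> C \<subseteq> U \<and> measure \<mu> (U - C) < e" using D sub by blast
  qed
qed

text \<open>A closed set is exhausted by its compact pieces in the \<open>K n\<close>, and an open set is a countable
  union of compact sets, by local compactness and the Lindelof property.\<close>

lemma compact_inner_regular_locally_compact: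
  fixes \<mu> :: "'a::{t2_space, second_countable_topology} measure" and K :: "nat \<Rightarrow> 'a set"
  assumes fin: "finite_measure \<mu>" and sets: "sets \<mu> = sets borel"
    and lc: "locally_compact_space (euclidean :: 'a topology)"
    and K: "\<And>n. compact (K n)" "(\<Union>n. K n) = UNIV" "incseq K"
  shows "compact_inner_regular euclidean \<mu>"
proof -
  interpret finite_measure \<mu> by fact
  have H: "Hausdorff_space (euclidean :: 'a topology)"
    unfolding Hausdorff_space_def disjnt_def using hausdorff by (simp, blast)
  have approx: "\<exists>C. compactin euclidean C \<and> C \<subseteq> U \<and> measure \<mu> (U - C) < e"
    if "\<And>n. compact (D n)" "(\<Union>n. D n) = U" "e > 0" for e :: real and U and D :: "nat \<Rightarrow> 'a set"
  proof -
    define E where "E n = (\<Union>i\<le>n. D i)" for n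
    have E: "compact (E n)" for n unfolding E_def using that(1) by (intro compact_UN) auto
    have m: "range E \<subseteq> sets \<mu>" using E by (auto simp: sets borel_compact)
    have inc: "incseq E" by (rule incseq_SucI) (auto simp: E_def atMost_Suc)
    have U: "(\<Union>n. E n) = U" using that(2) by (auto simp: E_def)
    have "(\<lambda>n. measure \<mu> (E n)) \<longlonglongrightarrow> measure \<mu> U" using finite_Lim_measure_incseq[OF m inc] U by simp
    then have "\<forall>\<^sub>F n in sequentially. measure \<mu> (E n) > measure \<mu> U - e"
      using that(3) by (intro order_tendstoD) auto
    then obtain n where n: "measure \<mu> (E n) > measure \<mu> U - e" using eventually_happens'[OF sequentially_bot] by blast
    have "measure \<mu> (U - E n) = measure \<mu> U - measure \<mu> (E n)"
      by (rule finite_measure_Diff) (use U m in auto)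
    then show ?thesis using n U E[of n] by (intro exI[of _ "E n"]) auto
  qed
  show ?thesis
  proof (rule compact_inner_regularI[OF fin _ H])
    show "sets \<mu> = sets (borel_sigma euclidean)" by (simp add: sets sets_borel_sigma_euclidean)
    fix U :: "'a set" and e :: real assume e: "e > 0"
    {
      assume "closedin euclidean U"
      then have "compact (K n \<inter> U)" for n using K(1) by (simp add: compact_Int_closed)
      moreover have "(\<Union>n. K n \<inter> U) = U" using K(2) by blast
      ultimately show "\<exists>C. compactin euclidean C \<and> C \<subseteq> U \<and> measure \<mu> (U - C) < e" using e by (intro approx)
    }
    assume "openin euclidean U"
    then have "open U" by simp
    have nb: "neighbourhood_base_of (\<lambda>C. compactin euclidean C \<and> closedin euclidean C) (euclidean :: 'a topology)"
      using locally_compact_Hausdorff_imp_regular_space[OF lc H] lc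
      unfolding locally_compact_regular_space_neighbourhood_base[symmetric] by simp
    have "\<exists>W C. open W \<and> compact C \<and> x \<in> W \<and> W \<subseteq> C \<and> C \<subseteq> U" if "x \<in> U" for x
      using nb[unfolded neighbourhood_base_of, rule_format, of U x] \<open>open U\<close> that by auto
    then obtain W C where WC: "\<And>x. x \<in> U \<Longrightarrow> open (W x) \<and> compact (C x) \<and> x \<in> W x \<and> W x \<subseteq> C x \<and> C x \<subseteq> U" by metis
    obtain F where F: "F \<subseteq> W ` U" "countable F" "\<Union>F = \<Union>(W ` U)"
      using Lindelof[of "W ` U"] WC by blast
    obtain I where I: "I \<subseteq> U" "countable I" "F = W ` I" using F(1,2) by (meson countable_subset_image)
    have cov: "(\<Union>x\<in>I. C x) = U"
    proof (intro equalityI subsetI)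
      fix y assume "y \<in> (\<Union>x\<in>I. C x)"
      then show "y \<in> U" using WC I(1) by blast
    next
      fix y assume "y \<in> U"
      then have "y \<in> \<Union>(W ` U)" using WC by blast
      then have "y \<in> \<Union>(W ` I)" using F(3) I(3) by simp
      then show "y \<in> (\<Union>x\<in>I. C x)" using WC I(1) by blast
    qed
    show "\<exists>C. compactin euclidean C \<and> C \<subseteq> U \<and> measure \<mu> (U - C) < e"
    proof (cases "I = {}")
      case True
      then have "U = {}" using cov by simp
      then show ?thesis using e by (intro exI[of _ "{}"]) auto
    next
      case False
      show ?thesis
      proof (rule approx[OF _ _ e])
        have "from_nat_into I n \<in> U" for n using from_nat_into[OF False, of n] I(1) by auto
        then show "compact (C (from_nat_into I n))" for n using WC by blast
        show "(\<Union>n. C (from_nat_into I n)) = U"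
          using cov range_from_nat_into[OF False I(2)] by (metis image_image)
      qed
    qed
  qed
qed

text \<open>Continuity has to be tested only on a countable base of the target.  For each base set the
  part of \<open>A\<close> inside its preimage and the part outside are replaced by compact sets; on the
  intersection of the resulting unions all these preimages are relatively open.\<close>

lemma Lusin_theorem:
  assumes fin: "finite_measure \<mu>" and reg: "compact_inner_regular X \<mu>"
    and sets: "sets \<mu> = sets (borel_sigma X)" and H: "Hausdorff_space X"
    and \<psi>: "\<psi> \<in> \<mu> \<rightarrow>\<^sub>M N" and Y: "second_countable Y" "sets (borel_sigma Y) \<subseteq> sets N" "space N = topspace Y"
    and A: "A \<in> sets \<mu>" and e: "e > 0"
  shows "\<exists>C. compactin X C \<and> C \<subseteq> A \<and> measure \<mu> (A - C) < e \<and> continuous_map (subtopology X C) Y \<psi>"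
proof -
  interpret finite_measure \<mu> by fact
  from Y(1)[unfolded second_countable_def] obtain B where B: "countable B" "\<forall>V\<in>B. openin Y V"
    "\<forall>U x. openin Y U \<and> x \<in> U \<longrightarrow> (\<exists>V\<in>B. x \<in> V \<and> V \<subseteq> U)" by (elim exE conjE)
  define V where "V = from_nat_into (insert {} B)"
  have V: "range V = insert {} B" unfolding V_def by (rule range_from_nat_into) (use B in auto)
  have Vo: "openin Y (V i)" for i
  proof -
    have "V i \<in> insert {} B" using V by blast
    then show ?thesis using B(2) by auto
  qed
  have cs: "C \<in> sets \<mu>" if "compactin X C" for C
    using compactin_imp_closedin[OF H that] by (simp add: sets borel_sigma_closed)
  have sp: "space \<mu> = topspace X" using sets_eq_imp_space_eq[OF sets] by simp
  define P where "P i = \<psi> -` V i \<inter> space \<mu>" for i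
  have P: "P i \<in> sets \<mu>" for i unfolding P_def
    by (rule measurable_sets[OF \<psi>]) (use borel_sigma_open[OF Vo] Y in auto)
  have pos: "0 < e/2 * (1/2)^(i+2)" for i :: nat using e by simp
  have "\<exists>C. compactin X C \<and> C \<subseteq> A \<inter> P i \<and> measure \<mu> (A \<inter> P i - C) < e/2 * (1/2)^(i+2)" for i
    using reg sets.Int[OF A P[of i]] pos[of i] unfolding compact_inner_regular_def by blast
  then obtain C where C: "\<And>i. compactin X (C i)" "\<And>i. C i \<subseteq> A \<inter> P i" "\<And>i. measure \<mu> (A \<inter> P i - C i) < e/2 * (1/2)^(i+2)" by metis
  have "\<exists>C. compactin X C \<and> C \<subseteq> A - P i \<and> measure \<mu> (A - P i - C) < e/2 * (1/2)^(i+2)" for i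
    using reg sets.Diff[OF A P[of i]] pos[of i] unfolding compact_inner_regular_def by blast
  then obtain D where D: "\<And>i. compactin X (D i)" "\<And>i. D i \<subseteq> A - P i" "\<And>i. measure \<mu> (A - P i - D i) < e/2 * (1/2)^(i+2)" by metis
  define K where "K = (\<Inter>i. C i \<union> D i)"
  have "closedin X K" unfolding K_def
  proof (rule closedin_Inter)
    show "closedin X S" if "S \<in> range (\<lambda>i. C i \<union> D i)" for S
      using that closedin_Un[OF compactin_imp_closedin[OF H C(1)] compactin_imp_closedin[OF H D(1)]] by auto
  qed simp
  then have K: "compactin X K"
    unfolding K_def by (rule closed_compactin[OF compactin_Un[OF C(1)[of 0] D(1)[of 0]], rotated]) auto
  have KA: "K \<subseteq> A" using C(2) D(2) unfolding K_def by blast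
  have m: "A \<inter> P i - C i \<in> sets \<mu>" "A - P i - D i \<in> sets \<mu>" for i using A P C D cs by auto
  have "measure \<mu> (A - K) \<le> measure \<mu> ((\<Union>i. A \<inter> P i - C i) \<union> (\<Union>i. A - P i - D i))"

  proof (rule finite_measure_mono)
    show "A - K \<subseteq> (\<Union>i. A \<inter> P i - C i) \<union> (\<Union>i. A - P i - D i)" unfolding K_def by blast
    show "(\<Union>i. A \<inter> P i - C i) \<union> (\<Union>i. A - P i - D i) \<in> sets \<mu>" using m by blast
  qed
  also have "\<dots> \<le> measure \<mu> (\<Union>i. A \<inter> P i - C i) + measure \<mu> (\<Union>i. A - P i - D i)"
    by (rule measure_Un_le) (use m in blast)+
  also have "\<dots> < e/2 + e/2"
    using e by (intro add_strict_mono measure_Union_geometric m C(3) D(3)) auto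
  finally have "measure \<mu> (A - K) < e" by simp
  moreover have "continuous_map (subtopology X K) Y \<psi>"
    unfolding continuous_map_def
  proof (intro conjI allI impI)
    have "topspace (subtopology X K) \<subseteq> space \<mu>" using sp by auto
    then show "\<psi> \<in> topspace (subtopology X K) \<rightarrow> topspace Y" using measurable_space[OF \<psi>] Y by auto
    fix U assume U: "openin Y U"
    define J where "J = {i. V i \<subseteq> U}"
    have "U = (\<Union>i\<in>J. V i)"
    proof (intro equalityI subsetI)
      fix u assume "u \<in> U"
      then obtain W where "W \<in> B" "u \<in> W" "W \<subseteq> U" using B(3)[rule_format, of U u] U by blast
      then have "W \<in> range V" using V by simp
      then obtain i where "W = V i" by blast
      then show "u \<in> (\<Union>i\<in>J. V i)" using \<open>u \<in> W\<close> \<open>W \<subseteq> U\<close> J_def by blast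
    qed (auto simp: J_def)
    then have eq: "{x \<in> topspace (subtopology X K). \<psi> x \<in> U} = (\<Union>i\<in>J. {x \<in> topspace (subtopology X K). \<psi> x \<in> V i})" by auto
    have "openin (subtopology X K) {x \<in> topspace (subtopology X K). \<psi> x \<in> V i}" for i
    proof -
      have "{x \<in> topspace (subtopology X K). \<psi> x \<in> V i} = (topspace X - D i) \<inter> K"
        using C(2)[of i] D(2)[of i] sp compactin_subset_topspace[OF K] unfolding K_def P_def by fastforce
      then show ?thesis using compactin_imp_closedin[OF H D(1)[of i]] by (auto simp: openin_subtopology)
    qed
    then show "openin (subtopology X K) {x \<in> topspace (subtopology X K). \<psi> x \<in> U}" unfolding eq by (intro openin_Union) auto
  qed
  ultimately show ?thesis using K KA by blast
qed

section \<open>Pulling back a countable family of step functions along an injection\<close>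

text \<open>An indexed base, so that finite unions of base sets can be named by lists of indices.\<close>

definition enumerated_base :: "'a topology \<Rightarrow> (nat \<Rightarrow> 'a set) \<Rightarrow> bool" where
  "enumerated_base Y V \<longleftrightarrow> (\<forall>i. openin Y (V i)) \<and>
     (\<forall>U x. openin Y U \<and> x \<in> U \<longrightarrow> (\<exists>i. x \<in> V i \<and> V i \<subseteq> U))"

lemma enumerated_base_exists:
  assumes "second_countable Y"
  shows "\<exists>V. enumerated_base Y V"
proof -
  from assms[unfolded second_countable_def] obtain B where B: "countable B" "\<forall>V\<in>B. openin Y V"
    "\<forall>U x. openin Y U \<and> x \<in> U \<longrightarrow> (\<exists>V\<in>B. x \<in> V \<and> V \<subseteq> U)" by (elim exE conjE)
  define V where "V = from_nat_into (insert {} B)"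
  have V: "range V = insert {} B" unfolding V_def by (rule range_from_nat_into) (use B in auto)
  have "openin Y (V i)" for i
  proof -
    have "V i \<in> insert {} B" using V by blast
    then show ?thesis using B(2) by auto
  qed
  moreover have "\<exists>i. x \<in> V i \<and> V i \<subseteq> U" if Ux: "openin Y U" "x \<in> U" for U x
  proof -
    obtain W where "W \<in> B" "x \<in> W" "W \<subseteq> U" using B(3)[rule_format, of U x] Ux by blast
    moreover have "W \<in> range V" using V \<open>W \<in> B\<close> by simp
    ultimately show ?thesis by auto
  qed
  ultimately show ?thesis unfolding enumerated_base_def by blast
qed

definition base_union :: "(nat \<Rightarrow> 'a set) \<Rightarrow> nat list \<Rightarrow> 'a set" where
  "base_union V I = (\<Union>i\<in>set I. V i)"

text \<open>Step functions are coded by lists over countable types.  This makes the family countable,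
  which is what the pigeonhole arguments below need.\<close>

definition rational_step :: "(nat \<Rightarrow> 'a set) \<Rightarrow> (rat \<times> nat list) list \<Rightarrow> 'a \<Rightarrow> real" where
  "rational_step V l y = (\<Sum>(q, I)\<leftarrow>l. of_rat q * indicator (base_union V I) y)"

lemma rational_step_append: "rational_step V (l @ l') y = rational_step V l y + rational_step V l' y"
  by (simp add: rational_step_def)

lemma rational_step_Rats: "rational_step V l y \<in> \<rat>"
  by (induction l) (auto simp: rational_step_def indicator_def)

lemma rational_step_bounded: "\<exists>C. \<forall>y. \<bar>rational_step V l y\<bar> \<le> C"
proof (induction l)
  case Nil
  then show ?case by (auto simp: rational_step_def)
next
  case (Cons a l)
  obtain q I where a: "a = (q, I)" by (cases a)
  obtain C where C: "\<And>y. \<bar>rational_step V l y\<bar> \<le> C" using Cons by blast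
  have "\<bar>rational_step V (a # l) y\<bar> \<le> \<bar>of_rat q\<bar> + C" for y
  proof -
    have "rational_step V (a # l) y = of_rat q * indicator (base_union V I) y + rational_step V l y"
      by (simp add: rational_step_def a)
    moreover have "\<bar>of_rat q * indicator (base_union V I) y\<bar> \<le> \<bar>of_rat q :: real\<bar>"
      by (auto simp: indicator_def)
    ultimately show ?thesis using C[of y] by linarith
  qed
  then show ?case by blast
qed

lemma base_union_measurable:
  assumes "enumerated_base Y V" "sets (borel_sigma Y) \<subseteq> sets N"
  shows "base_union V I \<in> sets N"
  unfolding base_union_def using assms borel_sigma_open[of Y]
  by (intro sets.finite_UN) (auto simp: enumerated_base_def)

lemma rational_step_measurable:
  assumes "enumerated_base Y V" "sets (borel_sigma Y) \<subseteq> sets N"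
  shows "rational_step V l \<in> borel_measurable N"
proof (induction l)
  case (Cons a l)
  obtain q I where a: "a = (q, I)" by (cases a)
  have [measurable]: "base_union V I \<in> sets N" by (rule base_union_measurable[OF assms])
  have "rational_step V (a # l) = (\<lambda>y. of_rat q * indicator (base_union V I) y + rational_step V l y)"
    by (auto simp: rational_step_def a)
  moreover have "\<dots> \<in> borel_measurable N" using Cons by simp
  ultimately show ?case by simp
qed (simp add: rational_step_def[abs_def])

lemma compact_subset_base_union:
  assumes V: "enumerated_base Y V" and H: "Hausdorff_space Y"
    and S: "compactin Y S" and T: "compactin Y T" and disj: "S \<inter> T = {}"
  shows "\<exists>I. S \<subseteq> base_union V I \<and> base_union V I \<inter> T = {}"
proof -
  define J where "J = {i. V i \<inter> T = {}}"
  have "S \<subseteq> \<Union>(V ` J)"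
  proof
    fix y assume y: "y \<in> S"
    have "openin Y (topspace Y - T)" using compactin_imp_closedin[OF H T] by auto
    moreover have "y \<in> topspace Y - T" using y disj compactin_subset_topspace[OF S] by auto
    ultimately obtain i where "y \<in> V i" "V i \<subseteq> topspace Y - T"
      using V unfolding enumerated_base_def by meson
    then show "y \<in> \<Union>(V ` J)" unfolding J_def by blast
  qed
  moreover have "openin Y U" if "U \<in> V ` J" for U using that V unfolding enumerated_base_def by blast
  ultimately obtain F where F: "finite F" "F \<subseteq> V ` J" "S \<subseteq> \<Union>F"
    using compactinD[OF S, of "V ` J"] by blast
  obtain J' where J': "J' \<subseteq> J" "finite J'" "F = V ` J'" using F(1,2) finite_subset_image by metis
  obtain I where I: "set I = J'" using finite_list[OF J'(2)] by blast
  have "S \<subseteq> base_union V I" using F(3) J'(3) I unfolding base_union_def by simp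
  moreover have "base_union V I \<inter> T = {}" using I J'(1) unfolding base_union_def J_def by blast
  ultimately show ?thesis by blast
qed

text \<open>The crude constant 2 replaces the triangle inequality of the norm: all estimates then take
  place among extended nonnegative integrals, without square roots or integrability conditions.\<close>

lemma nn_integral_square_add:
  fixes f g :: "'a \<Rightarrow> real"
  assumes [measurable]: "f \<in> borel_measurable M" "g \<in> borel_measurable M"
  shows "(\<integral>\<^sup>+x. ennreal ((f x + g x)\<^sup>2) \<partial>M) \<le>
    2 * (\<integral>\<^sup>+x. ennreal ((f x)\<^sup>2) \<partial>M) + 2 * (\<integral>\<^sup>+x. ennreal ((g x)\<^sup>2) \<partial>M)"
proof -
  have "(\<integral>\<^sup>+x. ennreal ((f x + g x)\<^sup>2) \<partial>M) \<le> (\<integral>\<^sup>+x. 2 * ennreal ((f x)\<^sup>2) + 2 * ennreal ((g x)\<^sup>2) \<partial>M)"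
  proof (rule nn_integral_mono)
    fix x
    have "(f x + g x)\<^sup>2 \<le> 2 * (f x)\<^sup>2 + 2 * (g x)\<^sup>2"
      using zero_le_power2[of "f x - g x"] by (simp add: power2_sum power2_diff)
    then have "ennreal ((f x + g x)\<^sup>2) \<le> ennreal (2 * (f x)\<^sup>2 + 2 * (g x)\<^sup>2)" by (rule ennreal_leI)
    also have "\<dots> = 2 * ennreal ((f x)\<^sup>2) + 2 * ennreal ((g x)\<^sup>2)"
      by (simp add: ennreal_mult ennreal_plus)
    finally show "ennreal ((f x + g x)\<^sup>2) \<le> 2 * ennreal ((f x)\<^sup>2) + 2 * ennreal ((g x)\<^sup>2)" .
  qed
  also have "\<dots> = 2 * (\<integral>\<^sup>+x. ennreal ((f x)\<^sup>2) \<partial>M) + 2 * (\<integral>\<^sup>+x. ennreal ((g x)\<^sup>2) \<partial>M)"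
    by (simp add: nn_integral_add nn_integral_cmult)
  finally show ?thesis .
qed

lemma nn_integral_square_triangle:
  fixes f g h :: "'a \<Rightarrow> real"
  assumes [measurable]: "f \<in> borel_measurable M" "g \<in> borel_measurable M" "h \<in> borel_measurable M"
  shows "(\<integral>\<^sup>+x. ennreal ((f x - h x)\<^sup>2) \<partial>M) \<le>
    2 * (\<integral>\<^sup>+x. ennreal ((f x - g x)\<^sup>2) \<partial>M) + 2 * (\<integral>\<^sup>+x. ennreal ((g x - h x)\<^sup>2) \<partial>M)"
  using nn_integral_square_add[of "\<lambda>x. f x - g x" M "\<lambda>x. g x - h x"] by simp

text \<open>An injective measurable map \<open>\<psi>\<close> from a regular measure space into a second countable
  Hausdorff space.  In the application \<open>\<psi>\<close> is the map \<open>h \<mapsto> T h x\<close> for a point \<open>x\<close> with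
  trivial stabilizer.\<close>

locale injective_pullback = finite_measure \<mu> for \<mu> :: "'a measure" +
  fixes X :: "'a topology" and Y :: "'b topology" and N :: "'b measure" and V :: "nat \<Rightarrow> 'b set"
    and \<psi> :: "'a \<Rightarrow> 'b"
  assumes reg: "compact_inner_regular X \<mu>" and setsX: "sets \<mu> = sets (borel_sigma X)"
    and HX: "Hausdorff_space X" and \<psi> [measurable]: "\<psi> \<in> \<mu> \<rightarrow>\<^sub>M N" and inj: "inj_on \<psi> (space \<mu>)"
    and HY: "Hausdorff_space Y" and scY: "second_countable Y"
    and setsY: "sets (borel_sigma Y) \<subseteq> sets N" and spY: "space N = topspace Y"
    and V: "enumerated_base Y V"
begin

text \<open>This is the use of injectivity, and a substitute modulo null sets for the theorem of Lusin
  and Souslin.  Choose compact sets inside \<open>A\<close> and inside its complement on which \<open>\<psi>\<close> is continuous;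
  their images are compact and disjoint, so finitely many base sets separate them.\<close>

lemma approximate_set:
  assumes A: "A \<in> sets \<mu>" and e: "e > 0"
  shows "\<exists>I. measure \<mu> {x\<in>space \<mu>. (x \<in> A) \<noteq> (\<psi> x \<in> base_union V I)} < e"
proof -
  have spX: "space \<mu> = topspace X" using sets_eq_imp_space_eq[OF setsX] by simp
  note L = Lusin_theorem[OF finite_measure_axioms reg setsX HX \<psi> scY setsY spY]
  obtain C where C: "compactin X C" "C \<subseteq> A" "measure \<mu> (A - C) < e/2" "continuous_map (subtopology X C) Y \<psi>"
    using L[OF A, of "e/2"] e by auto
  obtain D where D: "compactin X D" "D \<subseteq> space \<mu> - A" "measure \<mu> (space \<mu> - A - D) < e/2" "continuous_map (subtopology X D) Y \<psi>"
    using L[OF sets.compl_sets[OF A], of "e/2"] e by auto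
  have "compactin Y (\<psi> ` C)" "compactin Y (\<psi> ` D)"
    using image_compactin[OF _ C(4), of C] image_compactin[OF _ D(4), of D] C(1) D(1)
    by (auto simp: compactin_subtopology)
  moreover have "\<psi> ` C \<inter> \<psi> ` D = {}"
  proof -
    have False if "c \<in> C" "d \<in> D" "\<psi> c = \<psi> d" for c d
    proof -
      have "c \<in> space \<mu>" "d \<in> space \<mu>" "c \<in> A" "d \<notin> A"
        using that C(2) D(2) sets.sets_into_space[OF A] by auto
      then show False using inj that(3) by (metis inj_onD)
    qed
    then show ?thesis by blast
  qed
  ultimately obtain I where I: "\<psi> ` C \<subseteq> base_union V I" "base_union V I \<inter> \<psi> ` D = {}"
    using compact_subset_base_union[OF V HY] by meson
  have cs: "C \<in> sets \<mu>" "D \<in> sets \<mu>"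
    using compactin_imp_closedin[OF HX C(1)] compactin_imp_closedin[OF HX D(1)]
    by (simp_all add: setsX borel_sigma_closed)
  have "measure \<mu> {x\<in>space \<mu>. (x \<in> A) \<noteq> (\<psi> x \<in> base_union V I)} \<le> measure \<mu> ((A - C) \<union> (space \<mu> - A - D))"
  proof (rule finite_measure_mono)
    show "{x\<in>space \<mu>. (x \<in> A) \<noteq> (\<psi> x \<in> base_union V I)} \<subseteq> (A - C) \<union> (space \<mu> - A - D)" using I by auto
    show "(A - C) \<union> (space \<mu> - A - D) \<in> sets \<mu>" using A cs by auto
  qed
  also have "\<dots> \<le> measure \<mu> (A - C) + measure \<mu> (space \<mu> - A - D)"
    by (rule measure_Un_le) (use A cs in auto)
  also have "\<dots> < e" using C D by simp
  finally show ?thesis by blast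
qed

definition approximable :: "('a \<Rightarrow> real) \<Rightarrow> bool" where
  "approximable u \<longleftrightarrow> u \<in> borel_measurable \<mu> \<and>
     (\<forall>e>0. \<exists>l. (\<integral>\<^sup>+x. ennreal ((rational_step V l (\<psi> x) - u x)\<^sup>2) \<partial>\<mu>) < ennreal e)"

lemma rational_step_pullback_measurable [measurable]: "(\<lambda>x. rational_step V l (\<psi> x)) \<in> borel_measurable \<mu>"
  using measurable_compose[OF \<psi> rational_step_measurable[OF V setsY]] .

text \<open>Two errors are balanced: a rational \<open>q\<close> close to \<open>c\<close>, and a base union whose preimage differs
  from \<open>A\<close> by so little that the factor \<open>q\<^sup>2\<close> does no harm.\<close>

lemma approximable_indicator:
  assumes A [measurable]: "A \<in> sets \<mu>"
  shows "approximable (\<lambda>x. c * indicator A x)"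
  unfolding approximable_def
proof (intro conjI allI impI)
  show "(\<lambda>x. c * indicator A x) \<in> borel_measurable \<mu>" by simp
  fix e :: real assume e: "e > 0"
  define m where "m = measure \<mu> (space \<mu>)"
  have m: "m \<ge> 0" unfolding m_def by simp
  \<comment> \<open>The term \<open>m + 1\<close> avoids a case distinction for the zero measure.\<close>
  define r where "r = sqrt (e / (4 * (m + 1)))"
  have r: "r > 0" "r\<^sup>2 = e / (4 * (m + 1))" unfolding r_def using e m by auto
  obtain q where q: "c < of_rat q" "of_rat q < c + r" using of_rat_dense[of c "c + r"] r by auto
  have qc: "(of_rat q - c)\<^sup>2 \<le> e / (4 * (m + 1))"
    unfolding r(2)[symmetric] by (rule power_mono) (use q in auto)
  define Q where "Q = (of_rat q :: real)"
  define e' where "e' = e / (4 * Q\<^sup>2 + 4)"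
  have p: "4 * Q\<^sup>2 + 4 > 0" by (simp add: add_nonneg_pos)
  have e': "e' > 0" unfolding e'_def using e p by simp
  obtain I where I: "measure \<mu> {x\<in>space \<mu>. (x \<in> A) \<noteq> (\<psi> x \<in> base_union V I)} < e'"
    using approximate_set[OF A e'] by blast
  define S where "S = {x\<in>space \<mu>. (x \<in> A) \<noteq> (\<psi> x \<in> base_union V I)}"
  have [measurable]: "base_union V I \<in> sets N" by (rule base_union_measurable[OF V setsY])
  have S [measurable]: "S \<in> sets \<mu>" unfolding S_def by simp
  have "(\<integral>\<^sup>+x. ennreal ((rational_step V [(q, I)] (\<psi> x) - c * indicator A x)\<^sup>2) \<partial>\<mu>)
     \<le> (\<integral>\<^sup>+x. ennreal (2 * Q\<^sup>2) * indicator S x + ennreal (2 * (Q - c)\<^sup>2) \<partial>\<mu>)"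
  proof (rule nn_integral_mono)
    fix x assume x: "x \<in> space \<mu>"
    have "(rational_step V [(q, I)] (\<psi> x) - c * indicator A x)\<^sup>2 \<le> 2 * Q\<^sup>2 * indicator S x + 2 * (Q - c)\<^sup>2"
    proof (cases "x \<in> S")
      case True
      have "c\<^sup>2 \<le> 2 * Q\<^sup>2 + 2 * (Q - c)\<^sup>2" using zero_le_power2[of "2 * Q - c"]
        by (simp add: power2_diff power_mult_distrib algebra_simps)
      then show ?thesis using True x zero_le_power2[of Q] zero_le_power2[of "Q - c"]
        by (cases "x \<in> A") (auto simp: S_def rational_step_def Q_def)
    next
      case False
      then show ?thesis using x by (cases "x \<in> A") (auto simp: S_def rational_step_def Q_def)
    qed
    then have "ennreal ((rational_step V [(q, I)] (\<psi> x) - c * indicator A x)\<^sup>2) \<le> ennreal (2 * Q\<^sup>2 * indicator S x + 2 * (Q - c)\<^sup>2)"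
      by (rule ennreal_leI)
    also have "\<dots> = ennreal (2 * Q\<^sup>2) * indicator S x + ennreal (2 * (Q - c)\<^sup>2)"
      by (auto simp: indicator_def ennreal_plus)
    finally show "ennreal ((rational_step V [(q, I)] (\<psi> x) - c * indicator A x)\<^sup>2) \<le> ennreal (2 * Q\<^sup>2) * indicator S x + ennreal (2 * (Q - c)\<^sup>2)" .
  qed
  also have "\<dots> = ennreal (2 * Q\<^sup>2) * emeasure \<mu> S + ennreal (2 * (Q - c)\<^sup>2) * emeasure \<mu> (space \<mu>)"
    by (simp add: nn_integral_add nn_integral_cmult)
  also have "\<dots> = ennreal (2 * Q\<^sup>2 * measure \<mu> S + 2 * (Q - c)\<^sup>2 * m)"
    unfolding m_def by (simp add: emeasure_eq_measure ennreal_mult ennreal_plus)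
  also have "\<dots> < ennreal e"
  proof (rule ennreal_lessI[OF e])
    have "2 * Q\<^sup>2 * measure \<mu> S \<le> 2 * Q\<^sup>2 * e'" using I unfolding S_def by (intro mult_left_mono) auto
    also have "\<dots> < e/2" unfolding e'_def using e p by (simp add: field_simps)
    finally have 1: "2 * Q\<^sup>2 * measure \<mu> S < e/2" .
    have "2 * (Q - c)\<^sup>2 * m \<le> 2 * (e / (4 * (m + 1))) * m" using qc m unfolding Q_def by (intro mult_right_mono mult_left_mono) auto
    also have "\<dots> \<le> e/2" using e m by (simp add: field_simps)
    finally show "2 * Q\<^sup>2 * measure \<mu> S + 2 * (Q - c)\<^sup>2 * m < e" using 1 by simp
  qed
  finally show "\<exists>l. (\<integral>\<^sup>+x. ennreal ((rational_step V l (\<psi> x) - c * indicator A x)\<^sup>2) \<partial>\<mu>) < ennreal e" by blast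
qed

lemma approximable_add:
  assumes u: "approximable u" and v: "approximable v"
  shows "approximable (\<lambda>x. u x + v x)"
  unfolding approximable_def
proof (intro conjI allI impI)
  have [measurable]: "u \<in> borel_measurable \<mu>" "v \<in> borel_measurable \<mu>" using u v approximable_def by auto
  show "(\<lambda>x. u x + v x) \<in> borel_measurable \<mu>" by simp
  fix e :: real assume "e > 0"
  then have e: "e/4 > 0" by simp
  obtain l where l: "(\<integral>\<^sup>+x. ennreal ((rational_step V l (\<psi> x) - u x)\<^sup>2) \<partial>\<mu>) < ennreal (e/4)"
    using u e unfolding approximable_def by meson
  obtain l' where l': "(\<integral>\<^sup>+x. ennreal ((rational_step V l' (\<psi> x) - v x)\<^sup>2) \<partial>\<mu>) < ennreal (e/4)"
    using v e unfolding approximable_def by meson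
  have "(\<integral>\<^sup>+x. ennreal ((rational_step V (l @ l') (\<psi> x) - (u x + v x))\<^sup>2) \<partial>\<mu>)
     = (\<integral>\<^sup>+x. ennreal (((rational_step V l (\<psi> x) - u x) + (rational_step V l' (\<psi> x) - v x))\<^sup>2) \<partial>\<mu>)"
    by (simp add: rational_step_append algebra_simps)
  also have "\<dots> \<le> 2 * (\<integral>\<^sup>+x. ennreal ((rational_step V l (\<psi> x) - u x)\<^sup>2) \<partial>\<mu>) + 2 * (\<integral>\<^sup>+x. ennreal ((rational_step V l' (\<psi> x) - v x)\<^sup>2) \<partial>\<mu>)"
    by (rule nn_integral_square_add) auto
  also have "\<dots> < 2 * ennreal (e/4) + 2 * ennreal (e/4)"
    using l l' by (intro add_strict_mono ennreal_mult_strict_left_mono) auto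
  also have "\<dots> = ennreal e"
  proof -
    have "2 * ennreal (e/4) = ennreal (2 * (e/4))" using e by (subst ennreal_mult) auto
    then show ?thesis using \<open>e > 0\<close> by (simp add: ennreal_plus[symmetric] del: ennreal_plus)
  qed
  finally show "\<exists>l. (\<integral>\<^sup>+x. ennreal ((rational_step V l (\<psi> x) - (u x + v x))\<^sup>2) \<partial>\<mu>) < ennreal e" by blast
qed

lemma approximable_sum:
  assumes "finite J" "\<And>j. j \<in> J \<Longrightarrow> approximable (u j)"
  shows "approximable (\<lambda>x. \<Sum>j\<in>J. u j x)"
  using assms
proof (induction J rule: finite_induct)
  case empty
  show ?case using approximable_indicator[of "{}" 0] by simp
next
  case (insert j J)
  then show ?case using approximable_add[of "u j" "\<lambda>x. \<Sum>j\<in>J. u j x"] by simp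
qed

lemma approximable_simple_function:
  assumes s: "simple_function \<mu> s"
  shows "approximable s"
proof -
  have s': "approximable (\<lambda>x. \<Sum>y\<in>s ` space \<mu>. y * indicator (s -` {y} \<inter> space \<mu>) x)"
    by (rule approximable_sum) (use s in \<open>auto intro!: approximable_indicator simp: simple_function_def\<close>)
  have eq: "s x = (\<Sum>y\<in>s ` space \<mu>. y * indicator (s -` {y} \<inter> space \<mu>) x)" if "x \<in> space \<mu>" for x
    by (rule trans[OF simple_function_indicator_representation_banach[OF s that]])
      (rule sum.cong, rule refl, simp only: real_scaleR_def mult.commute)
  have "(\<integral>\<^sup>+x. ennreal ((rational_step V l (\<psi> x) - s x)\<^sup>2) \<partial>\<mu>) =
     (\<integral>\<^sup>+x. ennreal ((rational_step V l (\<psi> x) - (\<Sum>y\<in>s ` space \<mu>. y * indicator (s -` {y} \<inter> space \<mu>) x))\<^sup>2) \<partial>\<mu>)" for l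
    by (rule nn_integral_cong) (simp only: eq)
  moreover have "s \<in> borel_measurable \<mu>" by (rule borel_measurable_simple_function[OF s])
  ultimately show ?thesis using s' unfolding approximable_def by simp
qed

text \<open>Countably many functions on the target, fixed in advance, pull back to a dense family in
  \<open>L\<^sub>2(\<mu>)\<close> along every injection \<open>\<psi>\<close>.\<close>

theorem rational_step_dense:
  assumes u [measurable]: "u \<in> borel_measurable \<mu>" and fin: "(\<integral>\<^sup>+x. ennreal ((u x)\<^sup>2) \<partial>\<mu>) < \<infinity>" and e: "e > 0"
  shows "\<exists>l. (\<integral>\<^sup>+x. ennreal ((rational_step V l (\<psi> x) - u x)\<^sup>2) \<partial>\<mu>) < ennreal e"
proof -
  from borel_measurable_implies_sequence_metric[OF u, of 0] obtain F where F':
    "\<forall>i. simple_function \<mu> (F i)" "\<forall>x\<in>space \<mu>. (\<lambda>i. F i x) \<longlonglongrightarrow> u x"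
    "\<forall>i. \<forall>x\<in>space \<mu>. dist (F i x) 0 \<le> 2 * dist (u x) 0" by (elim exE conjE)
  note F = F'(1)[rule_format] F'(2)[rule_format] F'(3)[rule_format]
  have [measurable]: "F i \<in> borel_measurable \<mu>" for i by (rule borel_measurable_simple_function[OF F(1)])
  have "(\<lambda>i. \<integral>\<^sup>+x. ennreal ((F i x - u x)\<^sup>2) \<partial>\<mu>) \<longlonglongrightarrow> (\<integral>\<^sup>+x. 0 \<partial>\<mu>)"
  proof (rule nn_integral_dominated_convergence[where w="\<lambda>x. 9 * ennreal ((u x)\<^sup>2)"])
    show "(\<integral>\<^sup>+x. 9 * ennreal ((u x)\<^sup>2) \<partial>\<mu>) < \<infinity>"
      using fin by (simp add: nn_integral_cmult ennreal_mult_less_top)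
    show "AE x in \<mu>. ennreal ((F i x - u x)\<^sup>2) \<le> 9 * ennreal ((u x)\<^sup>2)" for i
    proof (rule AE_I2)
      fix x assume x: "x \<in> space \<mu>"
      have "\<bar>F i x - u x\<bar> \<le> \<bar>3 * u x\<bar>" using F(3)[OF x, of i] by (simp add: abs_mult)
      then have "(F i x - u x)\<^sup>2 \<le> (3 * u x)\<^sup>2" unfolding abs_le_square_iff .
      then have "ennreal ((F i x - u x)\<^sup>2) \<le> ennreal (9 * (u x)\<^sup>2)" by (intro ennreal_leI) (simp add: power_mult_distrib)
      then show "ennreal ((F i x - u x)\<^sup>2) \<le> 9 * ennreal ((u x)\<^sup>2)" by (simp add: ennreal_mult)
    qed
    show "AE x in \<mu>. (\<lambda>i. ennreal ((F i x - u x)\<^sup>2)) \<longlonglongrightarrow> 0"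
    proof (rule AE_I2)
      fix x assume x: "x \<in> space \<mu>"
      have "(\<lambda>i. (F i x - u x)\<^sup>2) \<longlonglongrightarrow> (u x - u x)\<^sup>2" by (intro tendsto_intros F(2)[OF x])
      then have "(\<lambda>i. ennreal ((F i x - u x)\<^sup>2)) \<longlonglongrightarrow> ennreal 0" by (intro tendsto_ennrealI) simp
      then show "(\<lambda>i. ennreal ((F i x - u x)\<^sup>2)) \<longlonglongrightarrow> 0" by simp
    qed
  qed auto
  then have "\<forall>\<^sub>F i in sequentially. (\<integral>\<^sup>+x. ennreal ((F i x - u x)\<^sup>2) \<partial>\<mu>) < ennreal (e/4)"
    using e by (intro order_tendstoD) auto
  then obtain i where i: "(\<integral>\<^sup>+x. ennreal ((F i x - u x)\<^sup>2) \<partial>\<mu>) < ennreal (e/4)"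
    using eventually_happens'[OF sequentially_bot] by blast
  have "e/4 > 0" using e by simp
  then obtain l where l: "(\<integral>\<^sup>+x. ennreal ((rational_step V l (\<psi> x) - F i x)\<^sup>2) \<partial>\<mu>) < ennreal (e/4)"
    using approximable_simple_function[OF F(1)[of i]] unfolding approximable_def by meson
  have "(\<integral>\<^sup>+x. ennreal ((rational_step V l (\<psi> x) - u x)\<^sup>2) \<partial>\<mu>) \<le>
     2 * (\<integral>\<^sup>+x. ennreal ((rational_step V l (\<psi> x) - F i x)\<^sup>2) \<partial>\<mu>) + 2 * (\<integral>\<^sup>+x. ennreal ((F i x - u x)\<^sup>2) \<partial>\<mu>)"
    by (rule nn_integral_square_triangle) auto
  also have "\<dots> < 2 * ennreal (e/4) + 2 * ennreal (e/4)"
    using l i by (intro add_strict_mono ennreal_mult_strict_left_mono) auto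
  also have "\<dots> = ennreal e"
  proof -
    have "2 * ennreal (e/4) = ennreal (2 * (e/4))" using e by (subst ennreal_mult) auto
    then show ?thesis using e by (simp add: ennreal_plus[symmetric] del: ennreal_plus)
  qed
  finally show ?thesis by blast
qed

end

section \<open>Haar measures along a tower of compact open subgroups\<close>

lemma normalized_haar_sets: "normalized_haar K \<mu> \<Longrightarrow> sets \<mu> = sets borel"
  and normalized_haar_prob: "normalized_haar K \<mu> \<Longrightarrow> prob_space \<mu>"
  by (simp_all add: normalized_haar_def)

lemma normalized_haar_space: "normalized_haar K \<mu> \<Longrightarrow> space \<mu> = UNIV"
  using sets_eq_imp_space_eq[OF normalized_haar_sets] by fastforce

lemma measurable_translate [measurable]:
  fixes a :: "'g::{topological_group_add, t2_space, second_countable_topology}"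
  shows "(\<lambda>x. a + x) \<in> borel \<rightarrow>\<^sub>M borel" "(\<lambda>x. x + a) \<in> borel \<rightarrow>\<^sub>M borel"
  by (intro borel_measurable_continuous_onI continuous_intros)+

lemma left_translate_borel:
  fixes a :: "'g::{topological_group_add, t2_space, second_countable_topology}"
  shows "A \<in> sets borel \<Longrightarrow> {x. a + x \<in> A} \<in> sets borel"
  using measurable_sets[OF measurable_translate(1)[of a]] by (simp add: vimage_def)

lemma right_translate_borel:
  fixes a :: "'g::{topological_group_add, t2_space, second_countable_topology}"
  shows "A \<in> sets borel \<Longrightarrow> {x. x + a \<in> A} \<in> sets borel"
  using measurable_sets[OF measurable_translate(2)[of a]] by (simp add: vimage_def)

lemma measurable_uminus [measurable]:
  "uminus \<in> borel_measurable (borel :: 'g::{topological_group_add, t2_space, second_countable_topology} measure)"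
  by (intro borel_measurable_continuous_onI continuous_intros)

lemma normalized_haar_left:
  fixes K :: "'g::{topological_group_add, t2_space, second_countable_topology} set"
  assumes h: "normalized_haar K \<mu>" and k: "k \<in> K" and A: "A \<in> sets borel"
  shows "emeasure \<mu> {x. k + x \<in> A} = emeasure \<mu> A"
proof -
  have "emeasure \<mu> A = emeasure (distr \<mu> borel (\<lambda>x. k + x)) A"
    using h k unfolding normalized_haar_def by simp
  also have "\<dots> = emeasure \<mu> ((\<lambda>x. k + x) -` A \<inter> space \<mu>)"
    by (rule emeasure_distr) (use A normalized_haar_sets[OF h] measurable_cong_sets[OF normalized_haar_sets[OF h] refl] in auto)
  also have "(\<lambda>x. k + x) -` A \<inter> space \<mu> = {x. k + x \<in> A}" using normalized_haar_space[OF h] by auto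
  finally show ?thesis by simp
qed

lemma normalized_haar_AE:
  assumes h: "normalized_haar K \<mu>" and K: "K \<in> sets borel"
  shows "AE x in \<mu>. x \<in> K"
proof -
  interpret prob_space \<mu> by (rule normalized_haar_prob[OF h])
  show ?thesis
    using AE_in_set_eq_1[of K] K normalized_haar_sets[OF h] h
    by (simp add: normalized_haar_def emeasure_eq_measure)
qed

text \<open>Integrate \<open>1\<^sub>A(- y + x)\<close> over both variables.  Left invariance of \<open>\<mu>\<close> evaluates the integral
  over \<open>x\<close>, left invariance of \<open>\<nu>\<close> the one over \<open>y\<close>, and Fubini equates the results.  Uniqueness
  and right invariance are both consequences.\<close>

lemma normalized_haar_reflect:
  fixes K :: "'g::{topological_group_add, t2_space, second_countable_topology} set"
  assumes h: "normalized_haar K \<mu>" and h': "normalized_haar K \<nu>" and K: "K \<in> sets borel"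
    and sub: "add_subgroup K" and A [measurable]: "A \<in> sets borel"
  shows "emeasure \<mu> A = emeasure \<nu> {x. - x \<in> A}"
proof -
  interpret M: prob_space \<mu> by (rule normalized_haar_prob[OF h])
  interpret N: prob_space \<nu> by (rule normalized_haar_prob[OF h'])
  interpret P: pair_sigma_finite \<nu> \<mu> by unfold_locales
  note s [measurable_cong] = normalized_haar_sets[OF h] normalized_haar_sets[OF h']
  have sp: "space \<mu> = UNIV" "space \<nu> = UNIV" using normalized_haar_space h h' by auto
  have m: "(\<lambda>(y, x). indicator A (- y + x) :: ennreal) \<in> borel_measurable (\<nu> \<Otimes>\<^sub>M \<mu>)" by measurable
  have [measurable]: "{x. c + x \<in> A} \<in> sets borel" "{y. - y + c \<in> A} \<in> sets borel" "{y. - y \<in> A} \<in> sets borel" for c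
    using measurable_sets[OF measurable_translate(1)[of c] A]
      measurable_sets[OF measurable_compose[OF measurable_uminus measurable_translate(2)[of c]] A]
      measurable_sets[OF measurable_uminus A] by (auto simp: vimage_def)
  have "emeasure \<mu> A = (\<integral>\<^sup>+y. emeasure \<mu> A \<partial>\<nu>)" by (simp add: N.emeasure_space_1)
  also have "\<dots> = (\<integral>\<^sup>+y. \<integral>\<^sup>+x. indicator A (- y + x) \<partial>\<mu> \<partial>\<nu>)"
  proof (rule nn_integral_cong_AE)
    show "AE y in \<nu>. emeasure \<mu> A = (\<integral>\<^sup>+x. indicator A (- y + x) \<partial>\<mu>)"
      using normalized_haar_AE[OF h' K]
    proof eventually_elim
      case (elim y)
      have "(\<integral>\<^sup>+x. indicator A (- y + x) \<partial>\<mu>) = (\<integral>\<^sup>+x. indicator {x. - y + x \<in> A} x \<partial>\<mu>)"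
        by (intro nn_integral_cong) (auto simp: indicator_def)
      also have "\<dots> = emeasure \<mu> {x. - y + x \<in> A}" by (rule nn_integral_indicator) (simp add: s)
      also have "\<dots> = emeasure \<mu> A"
        by (rule normalized_haar_left[OF h _ A]) (use sub elim in \<open>simp add: add_subgroup_def\<close>)
      finally show ?case by simp
    qed
  qed
  also have "\<dots> = (\<integral>\<^sup>+x. \<integral>\<^sup>+y. indicator A (- y + x) \<partial>\<nu> \<partial>\<mu>)" by (rule P.Fubini'[symmetric, OF m])
  also have "\<dots> = (\<integral>\<^sup>+x. emeasure \<nu> {x. - x \<in> A} \<partial>\<mu>)"
  proof (rule nn_integral_cong_AE)
    show "AE x in \<mu>. (\<integral>\<^sup>+y. indicator A (- y + x) \<partial>\<nu>) = emeasure \<nu> {x. - x \<in> A}"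
      using normalized_haar_AE[OF h K]
    proof eventually_elim
      case (elim x)
      have "(\<integral>\<^sup>+y. indicator A (- y + x) \<partial>\<nu>) = (\<integral>\<^sup>+y. indicator {y. - y + x \<in> A} y \<partial>\<nu>)"
        by (intro nn_integral_cong) (auto simp: indicator_def)
      also have "\<dots> = emeasure \<nu> {y. - y + x \<in> A}" by (rule nn_integral_indicator) (simp add: s)
      also have "{y. - y + x \<in> A} = {y. - x + y \<in> {z. - z \<in> A}}" by (simp add: minus_add)
      also have "emeasure \<nu> {y. - x + y \<in> {z. - z \<in> A}} = emeasure \<nu> {z. - z \<in> A}"
        by (rule normalized_haar_left[OF h']) (use sub elim in \<open>simp_all add: add_subgroup_def\<close>)
      finally show ?case .
    qed
  qed
  also have "\<dots> = emeasure \<nu> {x. - x \<in> A}" by (simp add: M.emeasure_space_1)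
  finally show ?thesis .
qed

lemma normalized_haar_unique:
  fixes K :: "'g::{topological_group_add, t2_space, second_countable_topology} set"
  assumes h: "normalized_haar K \<mu>" and h': "normalized_haar K \<nu>" and K: "K \<in> sets borel"
    and sub: "add_subgroup K"
  shows "\<mu> = \<nu>"
proof (rule measure_eqI)
  show "sets \<mu> = sets \<nu>" using normalized_haar_sets h h' by blast
  fix A assume "A \<in> sets \<mu>"
  then have A: "A \<in> sets borel" using normalized_haar_sets[OF h] by simp
  show "emeasure \<mu> A = emeasure \<nu> A"
    using normalized_haar_reflect[OF h h' K sub A] normalized_haar_reflect[OF h' h' K sub A] by simp
qed

lemma normalized_haar_right:
  fixes K :: "'g::{topological_group_add, t2_space, second_countable_topology} set"
  assumes h: "normalized_haar K \<mu>" and K: "K \<in> sets borel" and sub: "add_subgroup K"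
    and k: "k \<in> K" and A [measurable]: "A \<in> sets borel"
  shows "emeasure \<mu> {x. x + k \<in> A} = emeasure \<mu> A"
proof -
  have [measurable]: "{x. x + k \<in> A} \<in> sets borel" "{y. - y \<in> A} \<in> sets borel"
    using measurable_sets[OF measurable_translate(2)[of k] A]
      measurable_sets[OF measurable_uminus A] by (auto simp: vimage_def)
  have "emeasure \<mu> {x. x + k \<in> A} = emeasure \<mu> {x. - x \<in> {x. x + k \<in> A}}"
    by (rule normalized_haar_reflect[OF h h K sub]) simp
  also have "{x. - x \<in> {x. x + k \<in> A}} = {x. - k + x \<in> {z. - z \<in> A}}" by (simp add: minus_add)
  also have "emeasure \<mu> \<dots> = emeasure \<mu> {z. - z \<in> A}"
    by (rule normalized_haar_left[OF h]) (use sub k in \<open>simp_all add: add_subgroup_def\<close>)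
  also have "\<dots> = emeasure \<mu> A" by (rule normalized_haar_reflect[OF h h K sub A, symmetric])
  finally show ?thesis .
qed

text \<open>Finitely many translates of \<open>L\<close> cover the compact group \<open>K\<close>, and they all have the
  same mass.\<close>

lemma normalized_haar_open_subgroup_pos:
  fixes K L :: "'g::{topological_group_add, t2_space, second_countable_topology} set"
  assumes h: "normalized_haar K \<mu>" and K: "compact K" and L: "open L" "0 \<in> L"
    and sub: "add_subgroup K"
  shows "emeasure \<mu> L > 0"
proof (rule ccontr)
  assume "\<not> emeasure \<mu> L > 0"
  then have 0: "emeasure \<mu> L = 0" by simp
  define W where "W x = {y. - x + y \<in> L}" for x
  have Wo: "open (W x)" for x
  proof -
    have "continuous_on UNIV (\<lambda>y. - x + y)" by (intro continuous_intros)
    from open_vimage[OF L(1) this] show ?thesis unfolding W_def vimage_def .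
  qed
  have "K \<subseteq> (\<Union>x\<in>K. W x)" using L(2) unfolding W_def by auto
  then obtain F where F: "F \<subseteq> K" "finite F" "K \<subseteq> (\<Union>x\<in>F. W x)"
    using compactE_image[OF K, of K W] Wo by metis
  have s: "W x \<in> sets \<mu>" for x using Wo normalized_haar_sets[OF h] by simp
  have Wx: "emeasure \<mu> (W x) = 0" if "x \<in> F" for x
    unfolding W_def using normalized_haar_left[OF h, of "- x" L] that F(1) sub L(1) 0
    by (auto simp: add_subgroup_def)
  have "emeasure \<mu> K \<le> emeasure \<mu> (\<Union>x\<in>F. W x)" by (rule emeasure_mono[OF F(3)]) (use s F(2) in auto)
  also have "\<dots> \<le> (\<Sum>x\<in>F. emeasure \<mu> (W x))" by (rule emeasure_subadditive_finite) (use s F(2) in auto)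
  also have "\<dots> = 0" using Wx by simp
  finally show False using h by (simp add: normalized_haar_def)
qed

text \<open>Conditioning the Haar measure of the large group on a subgroup gives a left invariant
  probability measure on that subgroup, hence its Haar measure.\<close>

lemma normalized_haar_subgroup:
  fixes K L :: "'g::{topological_group_add, t2_space, second_countable_topology} set"
  assumes h: "normalized_haar K \<mu>" and h': "normalized_haar L \<nu>" and L: "L \<in> sets borel" "L \<subseteq> K"
    and sub: "add_subgroup L" and pos: "emeasure \<mu> L > 0" and A: "A \<in> sets borel"
  shows "emeasure \<nu> A = emeasure \<mu> (L \<inter> A) / emeasure \<mu> L"
proof -
  interpret prob_space \<mu> by (rule normalized_haar_prob[OF h])
  have s: "sets \<mu> = sets borel" by (rule normalized_haar_sets[OF h])
  have Ls: "L \<in> sets \<mu>" using L s by simp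
  define \<eta> where "\<eta> = uniform_measure \<mu> L"
  have \<eta>: "emeasure \<eta> A = emeasure \<mu> (L \<inter> A) / emeasure \<mu> L" if "A \<in> sets borel" for A
    unfolding \<eta>_def using that Ls s by (intro emeasure_uniform_measure) auto
  have "normalized_haar L \<eta>"
    unfolding normalized_haar_def
  proof (intro conjI ballI)
    show se: "sets \<eta> = sets borel" unfolding \<eta>_def by (simp add: s)
    show "prob_space \<eta>" unfolding \<eta>_def using pos by (intro prob_space_uniform_measure) auto
    show "emeasure \<eta> L = 1" using \<eta>[OF L(1)] pos by (simp add: ennreal_divide_self emeasure_eq_measure)
    fix k assume k: "k \<in> L"
    show "distr \<eta> borel (\<lambda>x. k + x) = \<eta>"
    proof (rule measure_eqI)
      show "sets (distr \<eta> borel (\<lambda>x. k + x)) = sets \<eta>" by (simp add: se)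
      fix A assume "A \<in> sets (distr \<eta> borel (\<lambda>x. k + x))"
      then have A: "A \<in> sets borel" by simp
      have sp: "space \<eta> = UNIV" using sets_eq_imp_space_eq[OF se] by simp
      have A': "{x. k + x \<in> A} \<in> sets borel" by (rule left_translate_borel[OF A])
      have "emeasure (distr \<eta> borel (\<lambda>x. k + x)) A = emeasure \<eta> {x. k + x \<in> A}"
        by (subst emeasure_distr) (use A se sp measurable_cong_sets[OF se refl] in \<open>auto simp: vimage_def\<close>)
      also have "\<dots> = emeasure \<mu> (L \<inter> {x. k + x \<in> A}) / emeasure \<mu> L" by (rule \<eta>[OF A'])
      also have "L \<inter> {x. k + x \<in> A} = {x. k + x \<in> L \<inter> A}"
      proof -
        have "x \<in> L" if "k + x \<in> L" for x
        proof -
          have "- k + (k + x) \<in> L" using sub k that unfolding add_subgroup_def by blast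
          then show ?thesis by (simp add: add.assoc[symmetric])
        qed
        then show ?thesis using sub k unfolding add_subgroup_def by blast
      qed
      also have "emeasure \<mu> {x. k + x \<in> L \<inter> A} = emeasure \<mu> (L \<inter> A)"
        by (rule normalized_haar_left[OF h]) (use k L A in auto)
      also have "emeasure \<mu> (L \<inter> A) / emeasure \<mu> L = emeasure \<eta> A" by (rule \<eta>[OF A, symmetric])
      finally show "emeasure (distr \<eta> borel (\<lambda>x. k + x)) A = emeasure \<eta> A" .
    qed
  qed
  then have "\<nu> = \<eta>" using normalized_haar_unique[OF h' _ L(1) sub] by blast
  then show ?thesis using \<eta>[OF A] by simp
qed

locale compact_tower =
  fixes K :: "nat \<Rightarrow> 'g::{topological_group_add, t2_space, second_countable_topology} set"
    and p :: "nat \<Rightarrow> real" and lam :: "nat \<Rightarrow> 'g measure" and rho w :: "'g measure"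
  assumes lc: "locally_compact_space (euclidean :: 'g topology)"
    and K_subgroup: "\<And>n. add_subgroup (K n)" and K_compact: "\<And>n. compact (K n)" and K_open: "\<And>n. open (K n)"
    and K_strict: "\<And>n. K n \<subset> K (Suc n)" and K_union: "(\<Union>n. K n) = UNIV"
    and p_pos: "\<And>n. p n > 0" and p_sums: "p sums 1"
    and lam: "\<And>n. normalized_haar (K n) (lam n)"
    and rho_eq: "rho = mixture p lam"
    and w_eq: "w = mixture p (\<lambda>n. conv_power rho (Suc n))"
begin

lemma K_mono: "m \<le> n \<Longrightarrow> K m \<subseteq> K n"
  using lift_Suc_mono_le[of K] K_strict by (meson order_less_imp_le)

lemma K_borel [measurable]: "K n \<in> sets borel" using K_open by simp

lemma K_zero: "0 \<in> K n" and K_add: "x \<in> K n \<Longrightarrow> y \<in> K n \<Longrightarrow> x + y \<in> K n"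
  and K_uminus: "x \<in> K n \<Longrightarrow> - x \<in> K n"
  using K_subgroup[of n] by (auto simp: add_subgroup_def)

lemma lam_sets [measurable_cong, simp]: "sets (lam n) = sets borel" by (rule normalized_haar_sets[OF lam])
lemma lam_space [simp]: "space (lam n) = UNIV" by (rule normalized_haar_space[OF lam])
lemma lam_prob: "prob_space (lam n)" by (rule normalized_haar_prob[OF lam])

lemma lam_AE: "AE k in lam n. k \<in> K n" by (rule normalized_haar_AE[OF lam K_borel])

lemma lam_left: "k \<in> K n \<Longrightarrow> A \<in> sets borel \<Longrightarrow> emeasure (lam n) {x. k + x \<in> A} = emeasure (lam n) A"
  by (rule normalized_haar_left[OF lam])

lemma lam_right: "k \<in> K n \<Longrightarrow> A \<in> sets borel \<Longrightarrow> emeasure (lam n) {x. x + k \<in> A} = emeasure (lam n) A"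
  by (rule normalized_haar_right[OF lam K_borel K_subgroup])

lemma lam_K_pos: "emeasure (lam m) (K n) > 0"
  by (rule normalized_haar_open_subgroup_pos[OF lam K_compact K_open K_zero K_subgroup])

lemma lam_restrict: "n \<le> m \<Longrightarrow> A \<in> sets borel \<Longrightarrow>
    emeasure (lam n) A = emeasure (lam m) (K n \<inter> A) / emeasure (lam m) (K n)"
  by (rule normalized_haar_subgroup[OF lam lam K_borel K_mono K_subgroup lam_K_pos])

text \<open>The tower is strictly increasing, so an element can be picked in each difference
  \<open>K (i+1) - K i\<close> with \<open>n \<le> i < m\<close>; the corresponding cosets of \<open>K n\<close> in \<open>K m\<close> are disjoint.\<close>

lemma lam_K_small:
  assumes "n < m"
  shows "measure (lam m) (K n) \<le> 1 / real (m - n)"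
proof -
  interpret prob_space "lam m" by (rule lam_prob)
  have "\<forall>i. \<exists>g. g \<in> K (Suc i) \<and> g \<notin> K i" using K_strict by blast
  then obtain g where g: "\<And>i. g i \<in> K (Suc i)" "\<And>i. g i \<notin> K i" by metis
  define A where "A i = {y. - g i + y \<in> K n}" for i
  have As: "A i \<in> sets borel" for i
    unfolding A_def using measurable_sets[OF measurable_translate(1)[of "- g i"] K_borel[of n]] by (simp add: vimage_def)
  have Am: "measure (lam m) (A i) = measure (lam m) (K n)" if "i < m" for i
  proof -
    have "g i \<in> K m" using g(1)[of i] K_mono[of "Suc i" m] that by auto
    then show ?thesis unfolding A_def measure_def by (subst lam_left) (auto intro: K_uminus)
  qed
  have disj: "A i \<inter> A j = {}" if "n \<le> i" "i < j" for i j
  proof -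
    have False if y: "y \<in> A i" "y \<in> A j" for y
    proof -
      define a b where "a = - g i + y" and "b = - g j + y"
      have ab: "a \<in> K j" "b \<in> K j" using y K_mono[of n j] \<open>n \<le> i\<close> \<open>i < j\<close> unfolding A_def a_def b_def by auto
      have gi: "g i \<in> K j" using g(1)[of i] K_mono[of "Suc i" j] \<open>i < j\<close> by auto
      \<comment> \<open>Two cosets that meet would put \<open>g j\<close> into \<open>K j\<close>.\<close>
      have "g j = g i + (a + - b)"
        unfolding a_def b_def by (simp add: minus_add add.assoc[symmetric])
      then have "g j \<in> K j" using ab gi K_add K_uminus by metis
      then show False using g(2) by blast
    qed
    then show ?thesis by blast
  qed
  have "disjoint_family_on A {n..<m}"
    unfolding disjoint_family_on_def
  proof (intro ballI impI)
    fix i j assume "i \<in> {n..<m}" "j \<in> {n..<m}" "i \<noteq> j"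
    then show "A i \<inter> A j = {}" using disj[of i j] disj[of j i] by (cases "i < j") auto
  qed
  then have "measure (lam m) (\<Union>i\<in>{n..<m}. A i) = (\<Sum>i\<in>{n..<m}. measure (lam m) (A i))"
    by (intro finite_measure_finite_Union) (use As in auto)
  also have "\<dots> = real (m - n) * measure (lam m) (K n)" using Am by simp
  finally have "real (m - n) * measure (lam m) (K n) \<le> 1" using prob_le_1 by metis
  then show ?thesis using assms by (simp add: field_simps)
qed

lemma rho_emeasure: "A \<in> sets borel \<Longrightarrow> emeasure rho A = (\<Sum>n. ennreal (p n) * emeasure (lam n) A)"
  unfolding rho_eq by (rule emeasure_mixture) auto

lemma rho_sets [measurable_cong, simp]: "sets rho = sets borel" by (simp add: rho_eq)
lemma rho_space [simp]: "space rho = UNIV" by (simp add: rho_eq)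

lemma p_suminf: "(\<Sum>n. ennreal (p n)) = 1"
  using suminf_ennreal_eq[OF less_imp_le[OF p_pos] p_sums] by simp

lemma rho_prob: "prob_space rho"
proof (rule prob_spaceI)
  have "emeasure (lam n) UNIV = 1" for n using prob_space.emeasure_space_1[OF lam_prob[of n]] by simp
  then show "emeasure rho (space rho) = 1" using rho_emeasure[of UNIV] p_suminf by simp
qed

lemma conv_power_rho_sets [measurable_cong, simp]: "sets (conv_power rho n) = sets borel"
  by (cases n) (auto simp: conv_def)

lemma conv_power_rho_space [simp]: "space (conv_power rho n) = UNIV"
  using sets_eq_imp_space_eq[OF conv_power_rho_sets] by simp

lemma add_measurable_pair: "(\<lambda>(x, y). x + y) \<in> rho \<Otimes>\<^sub>M conv_power rho n \<rightarrow>\<^sub>M borel"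
  by measurable

lemma conv_power_rho_prob: "prob_space (conv_power rho n)"
proof (induction n)
  case 0
  show ?case by (simp add: prob_space_return)
next
  case (Suc n)
  interpret R: prob_space rho by (rule rho_prob)
  interpret C: prob_space "conv_power rho n" by (rule Suc)
  interpret P: pair_prob_space rho "conv_power rho n" by unfold_locales
  show ?case unfolding conv_power.simps conv_def by (rule P.prob_space_distr[OF add_measurable_pair])
qed

lemma conv_rho_emeasure:
  assumes A: "A \<in> sets borel"
  shows "emeasure (conv_power rho (Suc n)) A = (\<integral>\<^sup>+x. emeasure (conv_power rho n) {y. x + y \<in> A} \<partial>rho)"
proof -
  interpret C: prob_space "conv_power rho n" by (rule conv_power_rho_prob)
  have "emeasure (conv_power rho (Suc n)) A = emeasure (rho \<Otimes>\<^sub>M conv_power rho n) ((\<lambda>(x, y). x + y) -` A \<inter> space (rho \<Otimes>\<^sub>M conv_power rho n))"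
    unfolding conv_power.simps conv_def by (rule emeasure_distr[OF add_measurable_pair A])
  also have "\<dots> = (\<integral>\<^sup>+x. emeasure (conv_power rho n) (Pair x -` ((\<lambda>(x, y). x + y) -` A \<inter> space (rho \<Otimes>\<^sub>M conv_power rho n))) \<partial>rho)"
    by (rule C.emeasure_pair_measure_alt[OF measurable_sets[OF add_measurable_pair A]])
  also have "\<dots> = (\<integral>\<^sup>+x. emeasure (conv_power rho n) {y. x + y \<in> A} \<partial>rho)"
    by (intro nn_integral_cong arg_cong2[where f=emeasure]) (auto simp: space_pair_measure)
  finally show ?thesis .
qed

lemma conv_power_rho_1:
  assumes A: "A \<in> sets borel"
  shows "emeasure (conv_power rho (Suc 0)) A = emeasure rho A"
proof -
  have A': "{y. x + y \<in> A} \<in> sets borel" for x by (rule left_translate_borel[OF A])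
  have "emeasure (conv_power rho (Suc 0)) A = (\<integral>\<^sup>+x. indicator A x \<partial>rho)"
    unfolding conv_rho_emeasure[OF A] by (intro nn_integral_cong) (use A' in \<open>auto simp: indicator_def\<close>)
  also have "\<dots> = emeasure rho A" by (rule nn_integral_indicator) (simp add: A)
  finally show ?thesis .
qed

lemma w_sets [measurable_cong, simp]: "sets w = sets borel" by (simp add: w_eq)
lemma w_space [simp]: "space w = UNIV" by (simp add: w_eq)

lemma w_emeasure: "A \<in> sets borel \<Longrightarrow> emeasure w A = (\<Sum>n. ennreal (p n) * emeasure (conv_power rho (Suc n)) A)"
  unfolding w_eq by (rule emeasure_mixture) (auto simp del: conv_power.simps)

lemma w_prob: "prob_space w"
proof (rule prob_spaceI)
  have "emeasure (conv_power rho n) UNIV = 1" for n using prob_space.emeasure_space_1[OF conv_power_rho_prob[of n]] by simp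
  then show "emeasure w (space w) = 1" using w_emeasure[of UNIV] p_suminf by (simp del: conv_power.simps)
qed

lemma mixture_component_le:
  assumes "A \<in> sets borel" "\<And>n. sets (\<mu> n) = sets borel"
  shows "emeasure (\<mu> m) A \<le> ennreal (1 / p m) * emeasure (mixture p \<mu>) A"
proof -
  have "ennreal (p m) * emeasure (\<mu> m) A \<le> emeasure (mixture p \<mu>) A"
    using sum_le_suminf[of "\<lambda>n. ennreal (p n) * emeasure (\<mu> n) A" "{m}"]
    by (simp add: emeasure_mixture[OF assms(2,1)])
  then have "ennreal (1 / p m) * (ennreal (p m) * emeasure (\<mu> m) A) \<le> ennreal (1 / p m) * emeasure (mixture p \<mu>) A"
    by (rule mult_left_mono) simp
  moreover have "ennreal (1 / p m) * (ennreal (p m) * emeasure (\<mu> m) A) = emeasure (\<mu> m) A"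
    using p_pos[of m] by (simp add: mult.assoc[symmetric] ennreal_mult[symmetric] less_imp_le)
  ultimately show ?thesis by simp
qed

text \<open>The measure \<open>\<lambda>\<^sub>m\<close> is a component of \<open>\<rho>\<close>, which is the first component of \<open>w\<close>.\<close>

lemma lam_le_w: "\<exists>C>0. \<forall>A\<in>sets borel. emeasure (lam m) A \<le> ennreal C * emeasure w A"
proof (intro exI conjI ballI)
  show "1 / p m * (1 / p 0) > 0" using p_pos by simp
  fix A :: "'g set" assume A: "A \<in> sets borel"
  have "emeasure (lam m) A \<le> ennreal (1 / p m) * emeasure rho A"
    unfolding rho_eq by (rule mixture_component_le[OF A]) simp
  also have "\<dots> \<le> ennreal (1 / p m) * (ennreal (1 / p 0) * emeasure w A)"
    unfolding w_eq conv_power_rho_1[OF A, symmetric]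
    by (rule mult_left_mono[OF mixture_component_le[OF A]]) (simp_all del: conv_power.simps)
  also have "\<dots> = ennreal (1 / p m * (1 / p 0)) * emeasure w A"
  proof -
    have "ennreal (1 / p m * (1 / p 0)) = ennreal (1 / p m) * ennreal (1 / p 0)"
      using p_pos[of m] p_pos[of 0] by (intro ennreal_mult) auto
    then show ?thesis by (simp only: mult.assoc)
  qed
  finally show "emeasure (lam m) A \<le> ennreal (1 / p m * (1 / p 0)) * emeasure w A" .
qed

text \<open>Choose \<open>m\<close> with \<open>g \<in> K m\<close>.  The measures \<open>\<lambda>\<^sub>k\<close> with \<open>k \<ge> m\<close> are invariant under \<open>g\<close>; the finitely
  many remaining ones are multiples of restrictions of \<open>\<lambda>\<^sub>m\<close>.\<close>

lemma lam_translate_le: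
  "\<exists>m. \<exists>D\<ge>0. \<forall>k. \<forall>A\<in>sets borel. emeasure (lam k) {h. h + g \<in> A} \<le> emeasure (lam k) A + ennreal D * emeasure (lam m) A"
proof -
  obtain m where m: "g \<in> K m" using K_union by blast
  interpret prob_space "lam m" by (rule lam_prob)
  define D where "D = (\<Sum>k<m. 1 / measure (lam m) (K k))"
  have D: "D \<ge> 0" unfolding D_def by (intro sum_nonneg) auto
  have "emeasure (lam k) {h. h + g \<in> A} \<le> emeasure (lam k) A + ennreal D * emeasure (lam m) A"
    if A: "A \<in> sets borel" for k A
  proof (cases "m \<le> k")
    case True
    then have "g \<in> K k" using m K_mono by blast
    then show ?thesis using lam_right[OF _ A] by simp
  next
    case False
    have A': "{h. h + g \<in> A} \<in> sets borel" by (rule right_translate_borel[OF A])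
    have pos: "measure (lam m) (K k) > 0" using lam_K_pos[of m k] by (simp add: emeasure_eq_measure)
    have "1 / measure (lam m) (K k) \<le> D" unfolding D_def using False
      by (intro member_le_sum) auto
    then have "ennreal (1 / measure (lam m) (K k)) \<le> ennreal D" by (rule ennreal_leI)
    moreover have "emeasure (lam k) {h. h + g \<in> A} = ennreal (1 / measure (lam m) (K k)) * emeasure (lam m) (K k \<inter> {h. h + g \<in> A})"
      using lam_restrict[OF _ A', of k m] False pos
      by (simp add: emeasure_eq_measure divide_ennreal ennreal_mult[symmetric])
    moreover have "emeasure (lam m) (K k \<inter> {h. h + g \<in> A}) \<le> emeasure (lam m) {h. h + g \<in> A}"
      using A' by (intro emeasure_mono) auto
    moreover have "\<dots> = emeasure (lam m) A" by (rule lam_right[OF m A])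
    ultimately have "emeasure (lam k) {h. h + g \<in> A} \<le> ennreal D * emeasure (lam m) A"
      by (metis mult_mono zero_le)
    then show ?thesis by (simp add: add_increasing)
  qed
  then show ?thesis using D by blast
qed

lemma rho_translate_le: "\<exists>C>0. \<forall>A\<in>sets borel. emeasure rho {h. h + g \<in> A} \<le> ennreal C * emeasure rho A"
proof -
  obtain m D where D: "D \<ge> 0" and le: "\<And>k A. A \<in> sets borel \<Longrightarrow>
      emeasure (lam k) {h. h + g \<in> A} \<le> emeasure (lam k) A + ennreal D * emeasure (lam m) A"
    using lam_translate_le[of g] by auto
  show ?thesis
  proof (intro exI conjI ballI)
    have pm: "p m > 0" by (rule p_pos)
    show "1 + D * (1 / p m) > 0" using D pm by (simp add: add_pos_nonneg)
    fix A :: "'g set" assume A: "A \<in> sets borel"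
    have A': "{h. h + g \<in> A} \<in> sets borel" by (rule right_translate_borel[OF A])
    have "emeasure rho {h. h + g \<in> A} = (\<Sum>n. ennreal (p n) * emeasure (lam n) {h. h + g \<in> A})"
      by (rule rho_emeasure[OF A'])
    also have "\<dots> \<le> (\<Sum>n. ennreal (p n) * emeasure (lam n) A + ennreal (p n) * (ennreal D * emeasure (lam m) A))"
      by (intro suminf_le) (auto simp: distrib_left[symmetric] intro!: mult_left_mono le[OF A])
    also have "\<dots> = (\<Sum>n. ennreal (p n) * emeasure (lam n) A) + (\<Sum>n. ennreal (p n) * (ennreal D * emeasure (lam m) A))"
      by (rule suminf_add[symmetric]) auto
    also have "\<dots> = emeasure rho A + ennreal D * emeasure (lam m) A"
      by (simp add: rho_emeasure[OF A] ennreal_suminf_multc p_suminf)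
    also have "\<dots> \<le> emeasure rho A + ennreal D * (ennreal (1 / p m) * emeasure rho A)"
      unfolding rho_eq by (intro add_left_mono mult_left_mono mixture_component_le[OF A]) auto
    also have "\<dots> = ennreal (1 + D * (1 / p m)) * emeasure rho A"
    proof -
      have "ennreal (D * (1 / p m)) = ennreal D * ennreal (1 / p m)" using D pm by (intro ennreal_mult) auto
      moreover have "ennreal (1 + D * (1 / p m)) = 1 + ennreal (D * (1 / p m))" using D pm by (subst ennreal_plus) auto
      ultimately show ?thesis by (simp only: distrib_right mult.assoc mult_1_left)
    qed
    finally show "emeasure rho {h. h + g \<in> A} \<le> ennreal (1 + D * (1 / p m)) * emeasure rho A" .
  qed
qed

text \<open>The constant for \<open>\<rho>\<close> also serves every convolution power, because translation on the right
  acts on the last factor of the convolution only.  This inequality makes the operators \<open>S\<^sub>g\<close> well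
  defined and bounded.\<close>

lemma w_translate_le: "\<exists>C>0. \<forall>A\<in>sets borel. emeasure w {h. h + g \<in> A} \<le> ennreal C * emeasure w A"
proof -
  obtain C where C: "C > 0" "\<And>A. A \<in> sets borel \<Longrightarrow> emeasure rho {h. h + g \<in> A} \<le> ennreal C * emeasure rho A"
    using rho_translate_le[of g] by auto
  have pre: "{h. h + a \<in> A} \<in> sets borel" "{h. a + h \<in> A} \<in> sets borel" if "A \<in> sets borel" for a and A :: "'g set"
    using measurable_sets[OF measurable_translate(2)[of a] that] measurable_sets[OF measurable_translate(1)[of a] that]
    by (simp_all add: vimage_def)
  have cp: "emeasure (conv_power rho (Suc n)) {h. h + g \<in> A} \<le> ennreal C * emeasure (conv_power rho (Suc n)) A"
    if "A \<in> sets borel" for n A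
    using that
  proof (induction n arbitrary: A)
    case 0
    show ?case using C(2)[OF 0] by (simp only: conv_power_rho_1[OF 0] conv_power_rho_1[OF pre(1)[OF 0]])
  next
    case (Suc n)
    have "emeasure (conv_power rho (Suc (Suc n))) {h. h + g \<in> A}
       = (\<integral>\<^sup>+x. emeasure (conv_power rho (Suc n)) {y. y + g \<in> {z. x + z \<in> A}} \<partial>rho)"
      unfolding conv_rho_emeasure[OF pre(1)[OF Suc.prems]] by (simp add: add.assoc del: conv_power.simps)
    also have "\<dots> \<le> (\<integral>\<^sup>+x. ennreal C * emeasure (conv_power rho (Suc n)) {z. x + z \<in> A} \<partial>rho)"
      by (intro nn_integral_mono Suc.IH pre Suc.prems)
    also have "\<dots> = ennreal C * (\<integral>\<^sup>+x. emeasure (conv_power rho (Suc n)) {z. x + z \<in> A} \<partial>rho)"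
    proof (rule nn_integral_cmult)
      interpret Cn: prob_space "conv_power rho (Suc n)" by (rule conv_power_rho_prob)
      have "(\<lambda>x. emeasure (conv_power rho (Suc n)) (Pair x -` ((\<lambda>(x, y). x + y) -` A \<inter> space (rho \<Otimes>\<^sub>M conv_power rho (Suc n))))) \<in> borel_measurable rho"
        by (rule Cn.measurable_emeasure_Pair[OF measurable_sets[OF add_measurable_pair Suc.prems]])
      then show "(\<lambda>x. emeasure (conv_power rho (Suc n)) {z. x + z \<in> A}) \<in> borel_measurable rho"
        by (simp add: space_pair_measure vimage_def del: conv_power.simps)
    qed
    also have "\<dots> = ennreal C * emeasure (conv_power rho (Suc (Suc n))) A"
      unfolding conv_rho_emeasure[OF Suc.prems, of "Suc n"] ..
    finally show ?case .
  qed
  show ?thesis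
  proof (intro exI conjI ballI)
    show "C > 0" by (rule C)
    fix A :: "'g set" assume A: "A \<in> sets borel"
    have "emeasure w {h. h + g \<in> A} \<le> (\<Sum>n. ennreal C * (ennreal (p n) * emeasure (conv_power rho (Suc n)) A))"
      unfolding w_emeasure[OF pre(1)[OF A]]
      by (intro suminf_le) (auto simp: mult.left_commute[of "ennreal C"] simp del: conv_power.simps intro!: mult_left_mono cp[OF A])
    then show "emeasure w {h. h + g \<in> A} \<le> ennreal C * emeasure w A"
      by (simp add: w_emeasure[OF A] del: conv_power.simps)
  qed
qed

lemma w_compact_inner_regular: "compact_inner_regular euclidean w"
proof (rule compact_inner_regular_locally_compact[OF _ _ lc K_compact K_union])
  interpret prob_space w by (rule w_prob)
  show "finite_measure w" by unfold_locales
  show "incseq K" using K_mono by (simp add: incseq_def)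
qed simp

lemma w_tail: assumes "e > 0" shows "\<exists>n. measure w (- K n) < e"
proof -
  interpret prob_space w by (rule w_prob)
  have "decseq (\<lambda>n. - K n)" using K_mono by (auto simp: decseq_def)
  moreover have "(\<Inter>n. - K n) = {}" using K_union by blast
  ultimately have "(\<lambda>n. measure w (- K n)) \<longlonglongrightarrow> 0"
    using finite_Lim_measure_decseq[of "\<lambda>n. - K n"] by (simp add: image_subset_iff)
  then have "\<forall>\<^sub>F n in sequentially. measure w (- K n) < e" using assms by (intro order_tendstoD) auto
  then show ?thesis using eventually_happens'[OF sequentially_bot] by blast
qed

end

section \<open>Free actions: density along an orbit and small invariant sets\<close>

text \<open>The topology \<open>X\<close> witnesses that the probability space is standard; \<open>V\<close> enumerates a base.\<close>

locale tower_action = compact_tower K p lam rho w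
  for K :: "nat \<Rightarrow> 'g::{topological_group_add, t2_space, second_countable_topology} set"
    and p lam rho w +
  fixes M :: "'x measure" and T :: "'g \<Rightarrow> 'x \<Rightarrow> 'x" and X :: "'x topology" and V :: "nat \<Rightarrow> 'x set"
  assumes pmp: "pmp_action M T" and erg: "ergodic_action M T" and free: "free_action M T"
    and X: "completely_metrizable_space X" "second_countable X"
    and topX: "topspace X = space M" and setsM: "sets M = sets (borel_sigma X)"
    and V: "enumerated_base X V"
begin

sublocale M: prob_space M using pmp by (simp add: pmp_action_def)
sublocale w: prob_space w by (rule w_prob)
sublocale lam: prob_space "lam n" for n by (rule lam_prob)

lemma T_joint: "(\<lambda>(g, x). T g x) \<in> borel \<Otimes>\<^sub>M M \<rightarrow>\<^sub>M M" using pmp by (simp add: pmp_action_def)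

lemma T_measurable [measurable (raw)]:
  assumes "f \<in> L \<rightarrow>\<^sub>M borel" "h \<in> L \<rightarrow>\<^sub>M M"
  shows "(\<lambda>z. T (f z) (h z)) \<in> L \<rightarrow>\<^sub>M M"
  using measurable_compose[OF measurable_Pair[OF assms] T_joint] by simp

lemma T_space: "x \<in> space M \<Longrightarrow> T g x \<in> space M"
  using measurable_space[OF T_measurable[OF measurable_const measurable_ident]] by simp

lemma T_zero: "x \<in> space M \<Longrightarrow> T 0 x = x" using pmp by (simp add: pmp_action_def)
lemma T_add: "x \<in> space M \<Longrightarrow> T (g + h) x = T g (T h x)" using pmp by (simp add: pmp_action_def)

lemma T_distr: "distr M M (T g) = M" using pmp by (simp add: pmp_action_def)

lemma orbit_measurable: "x \<in> space M \<Longrightarrow> (\<lambda>h. T h x) \<in> borel \<rightarrow>\<^sub>M M"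
  by (intro T_measurable) auto

lemma hausdorff_X: "Hausdorff_space X"
  using X(1) completely_metrizable_imp_metrizable_space metrizable_imp_Hausdorff_space by blast

lemma base_union_sets [measurable]: "base_union V I \<in> sets M"
  by (rule base_union_measurable[OF V]) (simp add: setsM)

lemma rational_step_meas [measurable]: "rational_step V l \<in> borel_measurable M"
  by (rule rational_step_measurable[OF V]) (simp add: setsM)

definition free_point :: "'x \<Rightarrow> bool" where
  "free_point x \<longleftrightarrow> x \<in> space M \<and> (\<forall>g. T g x = x \<longrightarrow> g = 0)"

lemma AE_free_point: "AE x in M. free_point x"
  using free AE_space[of M] unfolding free_action_def free_point_def by eventually_elim auto

lemma free_point_inj:
  assumes x: "free_point x" and eq: "T g x = T h x"
  shows "g = h"
proof -
  have xs: "x \<in> space M" using x free_point_def by blast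
  have "T (- h + g) x = T (- h) (T h x)" using T_add[OF xs] eq by simp
  also have "\<dots> = x" using T_add[OF xs, of "- h" h] T_zero[OF xs] by simp
  finally have "- h + g = 0" using x free_point_def by blast
  then show ?thesis by (metis add.right_inverse add.assoc add_0 add_0_right)
qed

lemma orbit_pullback: assumes "free_point x" shows "injective_pullback w euclidean X M V (\<lambda>h. T h x)"
proof unfold_locales
  show "compact_inner_regular euclidean w" by (rule w_compact_inner_regular)
  show "sets w = sets (borel_sigma euclidean)" by (simp add: sets_borel_sigma_euclidean)
  show "Hausdorff_space (euclidean :: 'g topology)"
    unfolding Hausdorff_space_def disjnt_def using hausdorff by (simp, blast)
  show "(\<lambda>h. T h x) \<in> w \<rightarrow>\<^sub>M M"
    using orbit_measurable[of x] assms measurable_cong_sets[OF w_sets refl] unfolding free_point_def by auto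
  show "inj_on (\<lambda>h. T h x) (space w)" using free_point_inj[OF assms] by (auto simp: inj_on_def)
  show "sets (borel_sigma X) \<subseteq> sets M" by (simp add: setsM)
qed (use hausdorff_X X V topX in auto)

lemma orbit_dense_sets:
  assumes "free_point x" "A \<in> sets borel" "e > 0"
  shows "\<exists>I. measure w {h. (h \<in> A) \<noteq> (T h x \<in> base_union V I)} < e"
  using injective_pullback.approximate_set[OF orbit_pullback[OF assms(1)], of A e] assms by simp

lemma orbit_dense_functions:
  assumes "free_point x" "u \<in> borel_measurable borel" "(\<integral>\<^sup>+h. ennreal ((u h)\<^sup>2) \<partial>w) < \<infinity>" "e > 0"
  shows "\<exists>l. (\<integral>\<^sup>+h. ennreal ((rational_step V l (T h x) - u h)\<^sup>2) \<partial>w) < ennreal e"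
  by (rule injective_pullback.rational_step_dense[OF orbit_pullback[OF assms(1)] _ assms(3,4)])
    (use assms(2) measurable_cong_sets[OF w_sets refl] in auto)

text \<open>This takes the place of a measurable selection: if almost every point of \<open>P\<close> has a good
  candidate among countably many, then one candidate is good on a set of positive measure.\<close>

lemma countable_pigeonhole:
  fixes Q :: "'c::countable \<Rightarrow> 'x \<Rightarrow> bool"
  assumes P: "P \<in> sets M" "emeasure M P > 0" and Q: "\<And>c. {x\<in>space M. Q c x} \<in> sets M"
    and ex: "AE x in M. x \<in> P \<longrightarrow> (\<exists>c. Q c x)"
  shows "\<exists>c. emeasure M {x\<in>P. Q c x} > 0"
proof (rule ccontr)
  assume "\<not> (\<exists>c. emeasure M {x\<in>P. Q c x} > 0)"
  then have 0: "emeasure M {x\<in>P. Q c x} = 0" for c by auto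
  have eq: "{x\<in>P. Q c x} = P \<inter> {x\<in>space M. Q c x}" for c using sets.sets_into_space[OF P(1)] by auto
  have "AE x in M. \<forall>c. x \<notin> {x\<in>P. Q c x}"
    unfolding AE_all_countable
  proof
    fix c
    have "{x\<in>P. Q c x} \<in> null_sets M" using 0 P(1) Q[of c] unfolding eq by (auto simp: null_sets_def)
    then show "AE x in M. x \<notin> {x\<in>P. Q c x}" by (rule AE_not_in)
  qed
  then have "AE x in M. x \<notin> P" using ex by eventually_elim auto
  then show False using P by (simp add: AE_iff_null_sets[symmetric] null_sets_def)
qed

lemma integral_translate:
  assumes [measurable]: "f \<in> borel_measurable M"
  shows "(\<integral>\<^sup>+x. f (T g x) \<partial>M) = (\<integral>\<^sup>+x. f x \<partial>M)"
proof -
  have "(\<integral>\<^sup>+x. f x \<partial>distr M M (T g)) = (\<integral>\<^sup>+x. f (T g x) \<partial>M)"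
    by (rule nn_integral_distr) (auto intro!: T_measurable)
  then show ?thesis by (simp add: T_distr)
qed

lemma integral_orbit_average:
  assumes f [measurable]: "f \<in> borel_measurable M" and \<eta>: "prob_space \<eta>" "sets \<eta> = sets borel"
  shows "(\<integral>\<^sup>+x. \<integral>\<^sup>+h. f (T h x) \<partial>\<eta> \<partial>M) = (\<integral>\<^sup>+x. f x \<partial>M)"
proof -
  interpret \<eta>: prob_space \<eta> by fact
  interpret P: pair_sigma_finite M \<eta> by unfold_locales
  note [measurable_cong] = \<eta>(2)
  have "(\<integral>\<^sup>+x. \<integral>\<^sup>+h. f (T h x) \<partial>\<eta> \<partial>M) = (\<integral>\<^sup>+h. \<integral>\<^sup>+x. f (T h x) \<partial>M \<partial>\<eta>)"
    by (rule P.Fubini'[symmetric]) measurable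
  also have "\<dots> = (\<integral>\<^sup>+x. f x \<partial>M)" by (simp add: integral_translate \<eta>.emeasure_space_1)
  finally show ?thesis .
qed

text \<open>The proportion of the \<open>K n\<close>-orbit of \<open>x\<close> that lies in \<open>E\<close>.\<close>

definition orbit_mass :: "'x set \<Rightarrow> nat \<Rightarrow> 'x \<Rightarrow> ennreal" where
  "orbit_mass E n x = (\<integral>\<^sup>+k. indicator E (T k x) \<partial>lam n)"

lemma orbit_mass_measurable [measurable]:
  assumes [measurable]: "E \<in> sets M" shows "orbit_mass E n \<in> borel_measurable M"
  unfolding orbit_mass_def[abs_def] by measurable

lemma orbit_set_borel:
  assumes "E \<in> sets M" "x \<in> space M" shows "{k. T k x \<in> E} \<in> sets borel"
  using measurable_sets[OF orbit_measurable[OF assms(2)] assms(1)] by (simp add: vimage_def)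

lemma orbit_mass_emeasure:
  assumes "E \<in> sets M" "x \<in> space M"
  shows "orbit_mass E n x = emeasure (lam n) {k. T k x \<in> E}"
proof -
  have "orbit_mass E n x = (\<integral>\<^sup>+k. indicator {k. T k x \<in> E} k \<partial>lam n)"
    unfolding orbit_mass_def by (intro nn_integral_cong) (auto simp: indicator_def)
  also have "\<dots> = emeasure (lam n) {k. T k x \<in> E}"
    by (rule nn_integral_indicator) (simp add: orbit_set_borel[OF assms])
  finally show ?thesis .
qed

text \<open>Invariance holds at every point, so level sets of \<open>orbit_mass E n\<close> are strictly invariant under
  \<open>K n\<close>.\<close>

lemma orbit_mass_invariant:
  assumes E: "E \<in> sets M" and x: "x \<in> space M" and k: "k \<in> K n"
  shows "orbit_mass E n (T k x) = orbit_mass E n x"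
proof -
  have "{j. T j (T k x) \<in> E} = {j. j + k \<in> {j. T j x \<in> E}}" using T_add[OF x] by simp
  then show ?thesis
    unfolding orbit_mass_emeasure[OF E x] orbit_mass_emeasure[OF E T_space[OF x]]
    using lam_right[OF k orbit_set_borel[OF E x]] by simp
qed

lemma orbit_mass_average:
  assumes E [measurable]: "E \<in> sets M" and x: "x \<in> space M" and nm: "n \<le> m"
  shows "(\<integral>\<^sup>+k. orbit_mass E n (T k x) \<partial>lam m) = orbit_mass E m x"
proof -
  interpret P: pair_sigma_finite "lam m" "lam n" by unfold_locales
  have [measurable]: "(\<lambda>h. T h x) \<in> borel \<rightarrow>\<^sub>M M" by (rule orbit_measurable[OF x])
  have "(\<integral>\<^sup>+k. orbit_mass E n (T k x) \<partial>lam m) = (\<integral>\<^sup>+k. \<integral>\<^sup>+j. indicator E (T (j + k) x) \<partial>lam n \<partial>lam m)"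
    unfolding orbit_mass_def by (simp add: T_add[OF x])
  also have "\<dots> = (\<integral>\<^sup>+j. \<integral>\<^sup>+k. indicator E (T (j + k) x) \<partial>lam m \<partial>lam n)"
    by (rule P.Fubini'[symmetric]) measurable
  also have "\<dots> = (\<integral>\<^sup>+j. orbit_mass E m x \<partial>lam n)"
  proof (rule nn_integral_cong_AE)
    show "AE j in lam n. (\<integral>\<^sup>+k. indicator E (T (j + k) x) \<partial>lam m) = orbit_mass E m x"
      using lam_AE[of n]
    proof eventually_elim
      case (elim j)
      then have j: "j \<in> K m" using K_mono[OF nm] by blast
      have A: "{k. T k x \<in> E} \<in> sets borel" by (rule orbit_set_borel[OF E x])
      have A': "{k. j + k \<in> {k. T k x \<in> E}} \<in> sets borel"
        by (rule left_translate_borel[OF A])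
      have "(\<integral>\<^sup>+k. indicator E (T (j + k) x) \<partial>lam m) = (\<integral>\<^sup>+k. indicator {k. j + k \<in> {k. T k x \<in> E}} k \<partial>lam m)"
        by (intro nn_integral_cong) (auto simp: indicator_def)
      also have "\<dots> = emeasure (lam m) {k. j + k \<in> {k. T k x \<in> E}}" by (rule nn_integral_indicator) (use A' in simp)
      also have "\<dots> = orbit_mass E m x" unfolding orbit_mass_emeasure[OF E x] by (rule lam_left[OF j A])
      finally show ?case .
    qed
  qed
  also have "\<dots> = orbit_mass E m x" using lam.emeasure_space_1[of n] by simp
  finally show ?thesis .
qed

text \<open>On each \<open>K m\<close>-orbit that meets \<open>E\<close> in a proportion of at most \<open>2b\<close>, Markov's inequality bounds
  by \<open>4b\<close> the proportion of the \<open>K n\<close>-orbits that are filled by \<open>E\<close> to more than one half.  Averaging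
  over all orbits gives the bound for the measure.\<close>

lemma concentrated_set_small:
  fixes b :: real
  assumes E [measurable]: "E \<in> sets M" and nm: "n \<le> m" and b: "b \<ge> 0"
  shows "emeasure M {y\<in>space M. orbit_mass E n y > 1/2 \<and> orbit_mass E m y \<le> ennreal (2 * b)} \<le> ennreal (4 * b)"
proof -
  define B where "B = {y\<in>space M. orbit_mass E n y > 1/2 \<and> orbit_mass E m y \<le> ennreal (2 * b)}"
  have B [measurable]: "B \<in> sets M" unfolding B_def by measurable
  have le: "(\<integral>\<^sup>+k. indicator B (T k x) \<partial>lam m) \<le> ennreal (4 * b)" if x: "x \<in> space M" for x
  proof (cases "orbit_mass E m x \<le> ennreal (2 * b)")
    case True
    have [measurable]: "(\<lambda>h. T h x) \<in> borel \<rightarrow>\<^sub>M M" by (rule orbit_measurable[OF x])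
    have "(\<integral>\<^sup>+k. indicator B (T k x) \<partial>lam m) \<le> (\<integral>\<^sup>+k. 2 * orbit_mass E n (T k x) \<partial>lam m)"
    proof (rule nn_integral_mono)
      fix k
      show "indicator B (T k x) \<le> 2 * orbit_mass E n (T k x)"
      proof (cases "T k x \<in> B")
        case True
        then have "1/2 < orbit_mass E n (T k x)" unfolding B_def by simp
        then have "2 * (1/2) \<le> 2 * orbit_mass E n (T k x)" by (intro mult_left_mono) auto
        moreover have "2 * (1/2) = (1 :: ennreal)"
          by (simp add: ennreal_times_divide ennreal_divide_self)
        ultimately show ?thesis using True by simp
      qed simp
    qed
    also have "\<dots> = 2 * orbit_mass E m x"
      by (simp add: nn_integral_cmult orbit_mass_average[OF E x nm])
    also have "\<dots> \<le> 2 * ennreal (2 * b)" by (intro mult_left_mono True) auto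
    also have "\<dots> = ennreal (2 * (2 * b))" using b by (subst ennreal_mult) auto
    finally show ?thesis by simp
  next
    case False
    have "(\<integral>\<^sup>+k. indicator B (T k x) \<partial>lam m) = (\<integral>\<^sup>+k. 0 \<partial>lam m)"
    proof (rule nn_integral_cong_AE)
      show "AE k in lam m. indicator B (T k x) = (0::ennreal)"
        using lam_AE[of m]
      proof eventually_elim
        case (elim k)
        then show ?case using orbit_mass_invariant[OF E x elim] False unfolding B_def by simp
      qed
    qed
    then show ?thesis by simp
  qed
  have "emeasure M B = (\<integral>\<^sup>+x. indicator B x \<partial>M)" by simp
  also have "\<dots> = (\<integral>\<^sup>+x. \<integral>\<^sup>+k. indicator B (T k x) \<partial>lam m \<partial>M)"
    by (rule integral_orbit_average[symmetric]) (auto simp: lam_prob)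
  also have "\<dots> \<le> (\<integral>\<^sup>+x. ennreal (4 * b) \<partial>M)" by (rule nn_integral_mono) (rule le)
  also have "\<dots> = ennreal (4 * b)" by (simp add: M.emeasure_space_1)
  finally show ?thesis unfolding B_def .
qed

text \<open>For large \<open>m\<close> the subgroup \<open>K n\<close> is a tiny part of \<open>K m\<close>.  By density along free orbits some
  base union \<open>E\<close> cuts, for the points \<open>x\<close> of a subset of \<open>P\<close> of positive measure, approximately
  the set \<open>K n\<close> out of \<open>K m\<close> under \<open>h \<mapsto> T h x\<close>.  The \<open>K n\<close>-orbits that \<open>E\<close> fills to more than one half,
  taken inside the \<open>K m\<close>-orbits of which \<open>E\<close> occupies a small proportion, form a set that is
  invariant and small.  It does the work of a Rokhlin tower, without a
  transversal for the action of \<open>K m\<close>.\<close>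

lemma small_invariant_set:
  assumes P: "P \<in> sets M" "emeasure M P > 0" and d: "\<delta> > 0"
  shows "\<exists>B\<in>sets M. (\<forall>k\<in>K n. \<forall>x\<in>space M. T k x \<in> B \<longleftrightarrow> x \<in> B) \<and> emeasure M B \<le> ennreal \<delta> \<and>
    emeasure M (P \<inter> B) > 0"
proof -
  obtain j :: nat where j: "j > 0" "1 / real j < \<delta>/4" using nat_approx_posE[of "\<delta>/4"] d by (metis divide_pos_pos zero_less_Suc zero_less_numeral)
  define m where "m = n + j"
  \<comment> \<open>The reciprocal of the index of \<open>K n\<close> in \<open>K m\<close>.\<close>
  define b where "b = measure (lam m) (K n)"
  have nm: "n \<le> m" unfolding m_def by simp
  have b\<delta>: "4 * b \<le> \<delta>" using lam_K_small[of n m] j unfolding b_def m_def by simp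
  have b: "b > 0" using lam_K_pos[of m n] unfolding b_def by (simp add: lam.emeasure_eq_measure)
  obtain C where C: "C > 0" "\<And>A. A \<in> sets borel \<Longrightarrow> emeasure (lam m) A \<le> ennreal C * emeasure w A"
    using lam_le_w[of m] by auto
  have Cm: "measure (lam m) A \<le> C * measure w A" if "A \<in> sets borel" for A
    using C(2)[OF that] C(1) by (simp add: lam.emeasure_eq_measure w.emeasure_eq_measure ennreal_mult[symmetric])
  define S where "S I x = {h. (h \<in> K n) \<noteq> (T h x \<in> base_union V I)}" for I x
  have S: "S I x \<in> sets borel" if "x \<in> space M" for I x
  proof -
    have [measurable]: "(\<lambda>h. T h x) \<in> borel \<rightarrow>\<^sub>M M" by (rule orbit_measurable[OF that])
    have "{h \<in> space borel. (h \<in> K n) \<noteq> (T h x \<in> base_union V I)} \<in> sets borel" by measurable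
    then show ?thesis unfolding S_def by simp
  qed
  define s where "s I x = (\<integral>\<^sup>+h. indicator {z. (fst z \<in> K n) \<noteq> (snd z \<in> base_union V I)} (h, T h x) \<partial>lam m)" for I x
  have s: "s I x = emeasure (lam m) (S I x)" if "x \<in> space M" for I x
  proof -
    have "s I x = (\<integral>\<^sup>+h. indicator (S I x) h \<partial>lam m)"
      unfolding s_def by (intro nn_integral_cong) (auto simp: indicator_def S_def)
    also have "\<dots> = emeasure (lam m) (S I x)" by (rule nn_integral_indicator) (simp add: S[OF that])
    finally show ?thesis .
  qed
  have [measurable]: "s I \<in> borel_measurable M" for I
  proof -
    have "{z \<in> space (borel \<Otimes>\<^sub>M M). (fst z \<in> K n) \<noteq> (snd z \<in> base_union V I)} \<in> sets (borel \<Otimes>\<^sub>M M)" by measurable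
    then have [measurable]: "(\<lambda>z. indicator {z. (fst z \<in> K n) \<noteq> (snd z \<in> base_union V I)} z :: ennreal) \<in> borel_measurable (borel \<Otimes>\<^sub>M M)"
      by (intro borel_measurable_indicator') (simp add: conj_commute)
    show ?thesis unfolding s_def[abs_def] by measurable
  qed
  have "\<exists>I. emeasure M {x\<in>P. s I x < ennreal (b/2)} > 0"
  proof (rule countable_pigeonhole[OF P])
    show "{x\<in>space M. s I x < ennreal (b/2)} \<in> sets M" for I by measurable
    show "AE x in M. x \<in> P \<longrightarrow> (\<exists>I. s I x < ennreal (b/2))"
      using AE_free_point
    proof eventually_elim
      case (elim x)
      then have x: "x \<in> space M" by (simp add: free_point_def)
      obtain I where "measure w (S I x) < b/2/C"
        using orbit_dense_sets[OF elim K_borel[of n], of "b/2/C"] b C unfolding S_def by auto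
      then have "C * measure w (S I x) < b/2" using C(1) by (simp add: field_simps)
      then have "measure (lam m) (S I x) < b/2" using Cm[OF S[OF x, of I]] by simp
      then have "s I x < ennreal (b/2)" unfolding s[OF x] by (simp add: lam.emeasure_eq_measure ennreal_lessI b)
      then show ?case by blast
    qed
  qed
  then obtain I where I: "emeasure M {x\<in>P. s I x < ennreal (b/2)} > 0" by blast
  define E where "E = base_union V I"
  have E [measurable]: "E \<in> sets M" unfolding E_def by measurable
  define B where "B = {y\<in>space M. orbit_mass E n y > 1/2 \<and> orbit_mass E m y \<le> ennreal (2 * b)}"
  have B: "B \<in> sets M" unfolding B_def by measurable
  have sub: "{x\<in>P. s I x < ennreal (b/2)} \<subseteq> P \<inter> B"
  proof
    fix x assume "x \<in> {x\<in>P. s I x < ennreal (b/2)}"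
    then have xP: "x \<in> P" and sx: "s I x < ennreal (b/2)" by auto
    have x: "x \<in> space M" using xP sets.sets_into_space[OF P(1)] by blast
    have Ex: "{k. T k x \<in> E} \<in> sets borel" by (rule orbit_set_borel[OF E x])
    have mS: "measure (lam m) (S I x) < b/2" using sx b unfolding s[OF x] by (simp add: lam.emeasure_eq_measure ennreal_less_iff)
    have "measure (lam m) {k. T k x \<in> E} \<le> measure (lam m) (K n \<union> S I x)"
      by (rule lam.finite_measure_mono) (use S[OF x] in \<open>auto simp: S_def E_def\<close>)
    also have "\<dots> \<le> measure (lam m) (K n) + measure (lam m) (S I x)"
      by (rule measure_Un_le) (use S[OF x] in auto)
    also have "\<dots> \<le> 2 * b" using mS b unfolding b_def by simp
    finally have 1: "orbit_mass E m x \<le> ennreal (2 * b)"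
      unfolding orbit_mass_emeasure[OF E x] by (simp add: lam.emeasure_eq_measure ennreal_leI)
    have A: "- {k. T k x \<in> E} \<in> sets borel" by (rule borel_comp[OF Ex])
    have "measure (lam n) (- {k. T k x \<in> E}) = measure (lam m) (K n \<inter> - {k. T k x \<in> E}) / b"
      using lam_restrict[OF nm A] b unfolding b_def
      by (simp add: lam.emeasure_eq_measure divide_ennreal)
    also have "\<dots> \<le> measure (lam m) (S I x) / b"
      using S[OF x] b by (intro divide_right_mono lam.finite_measure_mono) (auto simp: S_def E_def)
    also have "\<dots> < 1/2" using mS b by (simp add: field_simps)
    finally have "measure (lam n) {k. T k x \<in> E} > 1/2"
      using lam.prob_compl[of "{k. T k x \<in> E}" n] Ex by (simp add: Compl_eq_Diff_UNIV)
    then have "ennreal (1/2) < ennreal (measure (lam n) {k. T k x \<in> E})"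
      by (intro ennreal_lessI) auto
    then have "ennreal (1/2) < orbit_mass E n x"
      unfolding orbit_mass_emeasure[OF E x] lam.emeasure_eq_measure .
    moreover have "ennreal (1/2) = 1/2" using divide_ennreal[of 1 2] by simp
    ultimately show "x \<in> P \<inter> B" using 1 x xP unfolding B_def by simp
  qed
  show ?thesis
  proof (intro bexI conjI ballI)
    show "B \<in> sets M" by (rule B)
    show "emeasure M B \<le> ennreal \<delta>"
      using concentrated_set_small[OF E nm, of b] b b\<delta> unfolding B_def by (meson ennreal_leI less_imp_le order_trans)
    have "emeasure M {x\<in>P. s I x < ennreal (b/2)} \<le> emeasure M (P \<inter> B)" by (rule emeasure_mono[OF sub]) (use P B in auto)
    then show "emeasure M (P \<inter> B) > 0" using I by (rule less_le_trans[rotated])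
    fix k x assume k: "k \<in> K n" and x: "x \<in> space M"
    have "k \<in> K m" using k K_mono[OF nm] by blast
    then show "T k x \<in> B \<longleftrightarrow> x \<in> B"
      using orbit_mass_invariant[OF E x] k x T_space[OF x] unfolding B_def by simp
  qed
qed

end

section \<open>A function whose orbit maps are dense\<close>

primrec override :: "('x \<Rightarrow> real) \<Rightarrow> (nat \<Rightarrow> 'x set) \<Rightarrow> (nat \<Rightarrow> 'x \<Rightarrow> real) \<Rightarrow> nat \<Rightarrow> 'x \<Rightarrow> real" where
  "override f0 B F 0 = f0"
| "override f0 B F (Suc r) = (\<lambda>x. if x \<in> B r then F r x else override f0 B F r x)"

text \<open>The points that are overridden infinitely often will form a null set.  The value there is a
  rational number, like every value obtained by overriding.\<close>

definition override_limit :: "('x \<Rightarrow> real) \<Rightarrow> (nat \<Rightarrow> 'x set) \<Rightarrow> (nat \<Rightarrow> 'x \<Rightarrow> real) \<Rightarrow> 'x \<Rightarrow> real" where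
  "override_limit f0 B F x = (if \<forall>n. \<exists>m\<ge>n. x \<in> B m then 0 else lim (\<lambda>m. override f0 B F m x))"

lemma override_measurable:
  assumes [measurable]: "f0 \<in> borel_measurable M" "\<And>r. B r \<in> sets M" "\<And>r. F r \<in> borel_measurable M"
  shows "override f0 B F n \<in> borel_measurable M"
proof (induction n)
  case (Suc n)
  note [measurable] = Suc
  show ?case unfolding override.simps by measurable
qed simp

lemma override_limit_measurable:
  assumes f0: "f0 \<in> borel_measurable M" and B: "\<And>r. B r \<in> sets M" and F: "\<And>r. F r \<in> borel_measurable M"
  shows "override_limit f0 B F \<in> borel_measurable M"
proof -
  note [measurable] = B
  have "(\<lambda>x. lim (\<lambda>m. override f0 B F m x)) \<in> borel_measurable M"
    by (rule borel_measurable_lim_metric) (rule override_measurable[OF f0 B F])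
  moreover have "Measurable.pred M (\<lambda>x. \<forall>n. \<exists>m\<ge>n. x \<in> B m)" by measurable
  ultimately show ?thesis unfolding override_limit_def[abs_def] by (intro measurable_If) auto
qed

lemma override_limit_eq:
  assumes "\<And>m. m \<ge> n \<Longrightarrow> x \<notin> B m"
  shows "override_limit f0 B F x = override f0 B F n x"
proof -
  have eq: "override f0 B F m x = override f0 B F n x" if "m \<ge> n" for m
    using that by (induction m rule: dec_induct) (use assms in auto)
  have "(\<lambda>m. override f0 B F m x) \<longlonglongrightarrow> override f0 B F n x"
    by (rule tendsto_eventually, rule eventually_sequentiallyI[of n], rule eq)
  then have "lim (\<lambda>m. override f0 B F m x) = override f0 B F n x" by (rule limI)
  moreover have "\<not> (\<forall>n. \<exists>m\<ge>n. x \<in> B m)" using assms by blast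
  ultimately show ?thesis unfolding override_limit_def by (simp only: if_False)
qed

lemma override_cases: "(\<exists>r<n. x \<in> B r \<and> override f0 B F n x = F r x) \<or> ((\<forall>r<n. x \<notin> B r) \<and> override f0 B F n x = f0 x)"
  by (induction n) (auto simp: less_Suc_eq)

lemma override_limit_Rats:
  assumes "x \<in> B r" "\<And>r. F r x \<in> \<rat>"
  shows "override_limit f0 B F x \<in> \<rat>"
proof (cases "\<forall>n. \<exists>m\<ge>n. x \<in> B m")
  case True
  then show ?thesis by (simp add: override_limit_def)
next
  case False
  then obtain n where n: "\<And>m. m \<ge> n \<Longrightarrow> x \<notin> B m" by blast
  then have "r < n" using assms(1) not_less by blast
  have eq: "override_limit f0 B F x = override f0 B F n x" by (rule override_limit_eq[OF n])
  consider s where "override f0 B F n x = F s x" | "\<forall>r<n. x \<notin> B r"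
    using override_cases[of n x B f0 F] by blast
  then show ?thesis
  proof cases
    case 1
    then show ?thesis using eq assms(2) by simp
  next
    case 2
    then show ?thesis using \<open>r < n\<close> assms(1) by blast
  qed
qed

lemma override_limit_outside: "(\<And>r. x \<notin> B r) \<Longrightarrow> override_limit f0 B F x = f0 x"
  using override_limit_eq[of 0 x B f0 F] by simp

text \<open>Only the last index \<open>k\<close> at which \<open>x\<close> is overridden matters, and its term alone dominates the left
  side.\<close>

lemma override_limit_distance:
  fixes C :: "nat \<Rightarrow> real"
  assumes fin: "\<not> (\<forall>n. \<exists>m\<ge>n. x \<in> B m)" and F: "\<And>r. \<bar>F r x\<bar> \<le> C r" and f0: "\<bar>f0 x\<bar> \<le> C 0" and C: "incseq C"
  shows "ennreal ((override_limit f0 B F x - override f0 B F n x)\<^sup>2)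
    \<le> (\<Sum>s. ennreal (4 * (C (n + s))\<^sup>2) * indicator (B (n + s)) x)"
proof (cases "\<forall>m\<ge>n. x \<notin> B m")
  case True
  then show ?thesis using override_limit_eq[of n x B f0 F] by simp
next
  case False
  \<comment> \<open>The least bound for the indices is the successor of the last one.\<close>
  define n0 where "n0 = (LEAST n. \<forall>m\<ge>n. x \<notin> B m)"
  have ex: "\<exists>n. \<forall>m\<ge>n. x \<notin> B m" using fin by blast
  have n0: "\<forall>m\<ge>n0. x \<notin> B m" unfolding n0_def by (rule LeastI_ex[OF ex])
  have "n < n0" using False n0 by (meson le_trans not_less)
  then obtain k where k: "n0 = Suc k" "n \<le> k" by (cases n0) auto
  have xk: "x \<in> B k"
  proof (rule ccontr)
    assume "x \<notin> B k"
    then have "\<forall>m\<ge>k. x \<notin> B m" using n0 k(1) by (metis Suc_leI le_neq_implies_less)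
    then have "n0 \<le> k" unfolding n0_def by (rule Least_le)
    then show False using k(1) by simp
  qed
  have "override_limit f0 B F x = override f0 B F (Suc k) x" using override_limit_eq[of n0 x B f0 F] n0 k(1) by simp
  then have lim: "override_limit f0 B F x = F k x" using xk by simp
  have un: "\<bar>override f0 B F n x\<bar> \<le> C k"
  proof -
    consider r where "r < n" "override f0 B F n x = F r x" | "override f0 B F n x = f0 x"
      using override_cases[of n x B f0 F] by blast
    then show ?thesis
    proof cases
      case 1
      then show ?thesis using F[of r] incseqD[OF C, of r k] k(2) by simp
    next
      case 2
      then show ?thesis using f0 incseqD[OF C, of 0 k] by simp
    qed
  qed
  have "\<bar>F k x - override f0 B F n x\<bar> \<le> 2 * C k" using un F[of k] by linarith
  then have "(F k x - override f0 B F n x)\<^sup>2 \<le> (2 * C k)\<^sup>2" using abs_le_square_iff[of "F k x - override f0 B F n x" "2 * C k"] by simp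
  then have "ennreal ((override_limit f0 B F x - override f0 B F n x)\<^sup>2) \<le> ennreal (4 * (C k)\<^sup>2) * indicator (B k) x"
    unfolding lim using xk by (simp add: power_mult_distrib ennreal_leI)
  also have "\<dots> = (\<Sum>s\<in>{k - n}. ennreal (4 * (C (n + s))\<^sup>2) * indicator (B (n + s)) x)" using k(2) by simp
  also have "\<dots> \<le> (\<Sum>s. ennreal (4 * (C (n + s))\<^sup>2) * indicator (B (n + s)) x)"
    by (rule sum_le_suminf) auto
  finally show ?thesis .
qed

lemma halving_suminf:
  fixes \<delta> :: "nat \<Rightarrow> real"
  assumes pos: "\<And>r. \<delta> r > 0" and half: "\<And>r. \<delta> (Suc r) \<le> \<delta> r / 2"
  shows "(\<Sum>s. ennreal (\<delta> (n + s))) \<le> ennreal (2 * \<delta> n)"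
proof -
  have le: "\<delta> (n + s) \<le> \<delta> n * (1/2)^s" for s
  proof (induction s)
    case (Suc s)
    have "\<delta> (n + Suc s) \<le> \<delta> (n + s) / 2" using half[of "n + s"] by simp
    also have "\<dots> \<le> \<delta> n * (1/2)^s / 2" using Suc by simp
    finally show ?case by simp
  qed simp
  have "(\<Sum>s. ennreal (\<delta> (n + s))) \<le> (\<Sum>s. ennreal (\<delta> n * (1/2)^s))"
    by (intro suminf_le ennreal_leI le) auto
  also have "\<dots> = ennreal (2 * \<delta> n)"
  proof (rule suminf_ennreal_eq)
    show "0 \<le> \<delta> n * (1/2)^s" for s :: nat using pos[of n] by simp
    show "(\<lambda>s. \<delta> n * (1/2)^s) sums (2 * \<delta> n)"
      using sums_mult[OF geometric_sums[of "1/2::real"], of "\<delta> n"] by (simp add: mult.commute)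
  qed
  finally show ?thesis .
qed

context tower_action
begin

definition orbit_dist :: "('x \<Rightarrow> real) \<Rightarrow> ('g \<Rightarrow> real) \<Rightarrow> 'x \<Rightarrow> ennreal" where
  "orbit_dist u \<xi> x = (\<integral>\<^sup>+h. ennreal ((u (T h x) - \<xi> h)\<^sup>2) \<partial>w)"

lemma orbit_dist_measurable [measurable]:
  assumes [measurable]: "u \<in> borel_measurable M" "\<xi> \<in> borel_measurable borel"
  shows "orbit_dist u \<xi> \<in> borel_measurable M"
  unfolding orbit_dist_def[abs_def] by measurable

lemma orbit_function_measurable:
  assumes u: "u \<in> borel_measurable M" and x: "x \<in> space M"
  shows "(\<lambda>h. u (T h x)) \<in> borel_measurable w"
  using measurable_compose[OF orbit_measurable[OF x] u] measurable_cong_sets[OF w_sets refl] by auto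

text \<open>Density along almost every orbit, turned by the pigeonhole principle into a single step
  function that is good on a set of positive measure.\<close>

lemma positive_approximation:
  assumes xi [measurable]: "\<xi> \<in> borel_measurable borel" and fin: "(\<integral>\<^sup>+h. ennreal ((\<xi> h)\<^sup>2) \<partial>w) < \<infinity>" and e: "e > 0"
  shows "\<exists>l. emeasure M {x\<in>space M. orbit_dist (rational_step V l) \<xi> x < ennreal e} > 0"
proof (rule countable_pigeonhole)
  show "emeasure M (space M) > 0" by (simp add: M.emeasure_space_1)
  show "{x \<in> space M. orbit_dist (rational_step V l) \<xi> x < ennreal e} \<in> sets M" for l by measurable
  show "AE x in M. x \<in> space M \<longrightarrow> (\<exists>l. orbit_dist (rational_step V l) \<xi> x < ennreal e)"
    using AE_free_point by eventually_elim (use orbit_dense_functions[OF _ xi fin e] in \<open>auto simp: orbit_dist_def\<close>)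
qed auto

text \<open>The sets \<open>B r\<close> and the bounds \<open>\<delta> r\<close> have to be chosen recursively: what happens after step \<open>r\<close> must
  be small compared with the measure of \<open>P r \<inter> B r\<close>, which is known only after step \<open>r\<close>.\<close>

lemma small_sets_sequence:
  fixes C \<epsilon> :: "nat \<Rightarrow> real" and N :: "nat \<Rightarrow> nat"
  assumes P: "\<And>r. P r \<in> sets M" "\<And>r. emeasure M (P r) > 0" and C: "\<And>r. C r \<ge> 1" and \<epsilon>: "\<And>r. \<epsilon> r > 0"
  shows "\<exists>B \<delta>. \<forall>r. B r \<in> sets M \<and> (\<forall>k\<in>K (N r). \<forall>x\<in>space M. T k x \<in> B r \<longleftrightarrow> x \<in> B r) \<and>
     \<delta> r > 0 \<and> \<delta> r \<le> 1 \<and> ennreal (4 * (C r)\<^sup>2) * emeasure M (B r) \<le> ennreal (\<delta> r) \<and> emeasure M (P r \<inter> B r) > 0 \<and>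
     \<delta> (Suc r) \<le> \<delta> r / 2 \<and> \<delta> (Suc r) \<le> \<epsilon> r * measure M (P r \<inter> B r) / 4"
proof -
  define Q where "Q r z \<longleftrightarrow> fst z \<in> sets M \<and> (\<forall>k\<in>K (N r). \<forall>x\<in>space M. T k x \<in> fst z \<longleftrightarrow> x \<in> fst z) \<and>
     snd z > 0 \<and> snd z \<le> 1 \<and> ennreal (4 * (C r)\<^sup>2) * emeasure M (fst z) \<le> ennreal (snd z) \<and> emeasure M (P r \<inter> fst z) > 0"
    for r and z :: "'x set \<times> real"
  define R where "R r z z' \<longleftrightarrow> snd z' \<le> snd z / 2 \<and> snd z' \<le> \<epsilon> r * measure M (P r \<inter> fst z) / 4"
    for r and z z' :: "'x set \<times> real"
  have ex: "\<exists>B. Q r (B, d)" if d: "d > 0" "d \<le> 1" for r d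
  proof -
    have c: "4 * (C r)\<^sup>2 > 0" using C[of r] by simp
    then have "d / (4 * (C r)\<^sup>2) > 0" using d by simp
    then obtain B where B: "B \<in> sets M" "\<forall>k\<in>K (N r). \<forall>x\<in>space M. T k x \<in> B \<longleftrightarrow> x \<in> B"
      "emeasure M B \<le> ennreal (d / (4 * (C r)\<^sup>2))" "emeasure M (P r \<inter> B) > 0"
      using small_invariant_set[OF P(1)[of r] P(2)[of r], of "d / (4 * (C r)\<^sup>2)" "N r"] by auto
    have "ennreal (4 * (C r)\<^sup>2) * emeasure M B \<le> ennreal (4 * (C r)\<^sup>2) * ennreal (d / (4 * (C r)\<^sup>2))"
      by (rule mult_left_mono[OF B(3)]) simp
    also have "\<dots> = ennreal (4 * (C r)\<^sup>2 * (d / (4 * (C r)\<^sup>2)))" using c d by (intro ennreal_mult[symmetric]) auto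
    also have "\<dots> = ennreal d" using c by simp
    finally show ?thesis unfolding Q_def using B d by auto
  qed
  have "\<exists>f. \<forall>n. Q n (f n) \<and> R n (f n) (f (Suc n))"
  proof (rule dependent_nat_choice)
    show "\<exists>z. Q 0 z" using ex[of 1 0] by auto
    fix z r assume z: "Q r z"
    have mp: "measure M (P r \<inter> fst z) > 0" using z unfolding Q_def by (simp add: M.emeasure_eq_measure)
    define d where "d = min (snd z / 2) (\<epsilon> r * measure M (P r \<inter> fst z) / 4)"
    have "d > 0" "d \<le> 1" using z mp \<epsilon>[of r] unfolding d_def Q_def by auto
    then obtain B where "Q (Suc r) (B, d)" using ex by blast
    moreover have "R r z (B, d)" unfolding R_def d_def by auto
    ultimately show "\<exists>z'. Q (Suc r) z' \<and> R r z z'" by blast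
  qed
  then obtain f where f: "\<And>n. Q n (f n)" "\<And>n. R n (f n) (f (Suc n))" by auto
  show ?thesis
    by (rule exI[of _ "\<lambda>r. fst (f r)"], rule exI[of _ "\<lambda>r. snd (f r)"])
      (use f in \<open>simp add: Q_def R_def\<close>)
qed

text \<open>On the whole \<open>K n\<close>-orbit of \<open>x\<close> the new function agrees with \<open>F r\<close>, so only the tail of \<open>w\<close>
  outside \<open>K n\<close> contributes.\<close>

lemma override_close_to_value:
  assumes x: "x \<in> space M" "x \<in> B r" and inv: "\<And>k. k \<in> K n \<Longrightarrow> T k x \<in> B r"
    and f0: "\<And>y. \<bar>f0 y\<bar> \<le> C 0" and F: "\<And>r y. \<bar>F r y\<bar> \<le> C r" and C: "incseq C"
  shows "(\<integral>\<^sup>+h. ennreal ((override f0 B F (Suc r) (T h x) - F r (T h x))\<^sup>2) \<partial>w) \<le> ennreal (4 * (C r)\<^sup>2 * measure w (- K n))"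
proof -
  have "(\<integral>\<^sup>+h. ennreal ((override f0 B F (Suc r) (T h x) - F r (T h x))\<^sup>2) \<partial>w)
    \<le> (\<integral>\<^sup>+h. ennreal (4 * (C r)\<^sup>2) * indicator (- K n) h \<partial>w)"
  proof (rule nn_integral_mono)
    fix h
    show "ennreal ((override f0 B F (Suc r) (T h x) - F r (T h x))\<^sup>2) \<le> ennreal (4 * (C r)\<^sup>2) * indicator (- K n) h"
    proof (cases "h \<in> K n")
      case True
      then show ?thesis using inv by simp
    next
      case False
      let ?y = "T h x"
      have "\<bar>override f0 B F (Suc r) ?y\<bar> \<le> C r"
      proof -
        consider s where "s < Suc r" "override f0 B F (Suc r) ?y = F s ?y" | "override f0 B F (Suc r) ?y = f0 ?y"
          using override_cases[of "Suc r" ?y B f0 F] by blast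
        then show ?thesis
        proof cases
          case 1
          then show ?thesis using F[of s ?y] incseqD[OF C, of s r] by simp
        next
          case 2
          then show ?thesis using f0[of ?y] incseqD[OF C, of 0 r] by simp
        qed
      qed
      then have "\<bar>override f0 B F (Suc r) ?y - F r ?y\<bar> \<le> 2 * C r" using F[of r ?y] by linarith
      then have "(override f0 B F (Suc r) ?y - F r ?y)\<^sup>2 \<le> (2 * C r)\<^sup>2"
        using abs_le_square_iff[of "override f0 B F (Suc r) ?y - F r ?y" "2 * C r"] by simp
      then show ?thesis using False by (simp add: power_mult_distrib ennreal_leI del: override.simps)
    qed
  qed
  also have "\<dots> = ennreal (4 * (C r)\<^sup>2 * measure w (- K n))"
    using K_borel[of n] by (simp add: nn_integral_cmult_indicator w.emeasure_eq_measure ennreal_mult borel_comp)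
  finally show ?thesis .
qed

text \<open>Step \<open>r\<close> imposes on a small invariant set \<open>B r\<close> a step function \<open>F r\<close> whose orbit functions are
  close to \<open>\<xi> r\<close> at the points of \<open>P r\<close>.  The later steps change the result so little that
  the approximation survives at a positive proportion of the points of \<open>P r \<inter> B r\<close>.  All overriding
  happens inside the set \<open>D\<close>, and with rational values only.\<close>

theorem generic_function_exists:
  fixes \<xi> :: "nat \<Rightarrow> 'g \<Rightarrow> real" and \<epsilon> :: "nat \<Rightarrow> real"
  assumes f0 [measurable]: "f0 \<in> borel_measurable M" and f0_bound: "\<And>x. \<bar>f0 x\<bar> \<le> c"
    and xi [measurable]: "\<And>r. \<xi> r \<in> borel_measurable borel"
    and xi_fin: "\<And>r. (\<integral>\<^sup>+h. ennreal ((\<xi> r h)\<^sup>2) \<partial>w) < \<infinity>" and \<epsilon>: "\<And>r. \<epsilon> r > 0"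
  shows "\<exists>f D. f \<in> borel_measurable M \<and> (\<integral>\<^sup>+x. ennreal ((f x)\<^sup>2) \<partial>M) < \<infinity> \<and>
    D \<in> sets M \<and> emeasure M D \<le> 1/2 \<and> (\<forall>x\<in>D. f x \<in> \<rat>) \<and> (\<forall>x\<in>space M - D. f x = f0 x) \<and>
    (\<forall>r. emeasure M {x\<in>space M. orbit_dist f (\<xi> r) x < ennreal (\<epsilon> r)} > 0)"
proof -
  \<comment> \<open>Three errors of size at most \<open>e r\<close> enter with total weight 10, through two uses of the
    inequality with constant 2.\<close>
  define e where "e r = \<epsilon> r / 10" for r
  have e: "e r > 0" for r using \<epsilon>[of r] by (simp add: e_def)
  have "\<forall>r. \<exists>l. emeasure M {x\<in>space M. orbit_dist (rational_step V l) (\<xi> r) x < ennreal (e r)} > 0"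
    using positive_approximation[OF xi xi_fin e] by blast
  then obtain l where l: "\<And>r. emeasure M {x\<in>space M. orbit_dist (rational_step V (l r)) (\<xi> r) x < ennreal (e r)} > 0"
    by metis
  define F where "F r = rational_step V (l r)" for r
  have F [measurable]: "F r \<in> borel_measurable M" for r unfolding F_def by measurable
  have FQ: "F r x \<in> \<rat>" for r x unfolding F_def by (rule rational_step_Rats)
  have "\<forall>r. \<exists>C. \<forall>y. \<bar>F r y\<bar> \<le> C" unfolding F_def using rational_step_bounded by blast
  then obtain cF where cF: "\<And>r y. \<bar>F r y\<bar> \<le> cF r" by metis
  define C where "C r = 1 + \<bar>c\<bar> + (\<Sum>s\<le>r. \<bar>cF s\<bar>)" for r
  have C1: "C r \<ge> 1" for r unfolding C_def by (simp add: sum_nonneg)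
  have Cinc: "incseq C" by (rule incseq_SucI) (simp add: C_def)
  have C_f0: "\<bar>f0 y\<bar> \<le> C 0" for y using f0_bound[of y] unfolding C_def by simp
  have C_F: "\<bar>F r y\<bar> \<le> C r" for r y
  proof -
    have "\<bar>cF r\<bar> \<le> (\<Sum>s\<le>r. \<bar>cF s\<bar>)" by (rule member_le_sum) auto
    then show ?thesis using cF[of r y] unfolding C_def by linarith
  qed
  have "\<forall>r. \<exists>n. measure w (- K n) < e r / (4 * (C r)\<^sup>2)"
  proof
    fix r
    have "e r / (4 * (C r)\<^sup>2) > 0" using e[of r] C1[of r] by simp
    then show "\<exists>n. measure w (- K n) < e r / (4 * (C r)\<^sup>2)" by (rule w_tail)
  qed
  then obtain N where N: "\<And>r. measure w (- K (N r)) < e r / (4 * (C r)\<^sup>2)" by metis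
  have N': "4 * (C r)\<^sup>2 * measure w (- K (N r)) \<le> e r" for r
  proof -
    have "4 * (C r)\<^sup>2 > 0" using C1[of r] by simp
    then show ?thesis using N[of r] by (simp add: field_simps)
  qed
  define P where "P r = {x\<in>space M. orbit_dist (F r) (\<xi> r) x < ennreal (e r)}" for r
  have P [measurable]: "P r \<in> sets M" for r unfolding P_def by measurable
  have Ppos: "emeasure M (P r) > 0" for r unfolding P_def F_def by (rule l)
  from small_sets_sequence[where P=P and C=C and \<epsilon>=e and N=N, OF P Ppos C1 e]
  obtain B \<delta> where B\<delta>: "\<forall>r. B r \<in> sets M \<and> (\<forall>k\<in>K (N r). \<forall>x\<in>space M. T k x \<in> B r \<longleftrightarrow> x \<in> B r) \<and>
     \<delta> r > 0 \<and> \<delta> r \<le> 1 \<and> ennreal (4 * (C r)\<^sup>2) * emeasure M (B r) \<le> ennreal (\<delta> r) \<and> emeasure M (P r \<inter> B r) > 0 \<and>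
     \<delta> (Suc r) \<le> \<delta> r / 2 \<and> \<delta> (Suc r) \<le> e r * measure M (P r \<inter> B r) / 4" by (elim exE)
  have B [measurable]: "B r \<in> sets M" and B_inv: "k \<in> K (N r) \<Longrightarrow> x \<in> space M \<Longrightarrow> T k x \<in> B r \<longleftrightarrow> x \<in> B r"
    and \<delta>: "\<delta> r > 0" "\<delta> r \<le> 1" and B_small: "ennreal (4 * (C r)\<^sup>2) * emeasure M (B r) \<le> ennreal (\<delta> r)"
    and PB: "emeasure M (P r \<inter> B r) > 0" and \<delta>_half: "\<delta> (Suc r) \<le> \<delta> r / 2"
    and \<delta>_P: "\<delta> (Suc r) \<le> e r * measure M (P r \<inter> B r) / 4" for r k x
    using B\<delta> by auto
  have B_meas: "measure M (B r) \<le> \<delta> r / 4" for r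
  proof -
    have "4 * (C r)\<^sup>2 * measure M (B r) \<le> \<delta> r"
      using B_small[of r] \<delta>(1)[of r] by (simp add: M.emeasure_eq_measure ennreal_mult[symmetric])
    moreover have "1 * measure M (B r) \<le> (C r)\<^sup>2 * measure M (B r)"
      using C1[of r] by (intro mult_right_mono) (auto simp: one_le_power)
    ultimately show ?thesis by simp
  qed
  define u where "u = override f0 B F"
  define f where "f = override_limit f0 B F"
  have u [measurable]: "u n \<in> borel_measurable M" for n unfolding u_def by (rule override_measurable[OF f0 B F])
  have f [measurable]: "f \<in> borel_measurable M" unfolding f_def by (rule override_limit_measurable[OF f0 B F])
  define D where "D = (\<Union>r. B r)"
  have D: "D \<in> sets M" unfolding D_def by measurable
  have AE_fin: "AE x in M. \<not> (\<forall>n. \<exists>m\<ge>n. x \<in> B m)"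
  proof -
    have "summable (\<lambda>r. measure M (B r))"
    proof (rule summable_comparison_test'[where N=0])
      have le: "\<delta> s \<le> (1/2)^s" for s
      proof (induction s)
        case 0
        then show ?case using \<delta>(2)[of 0] by simp
      next
        case (Suc s)
        then show ?case using \<delta>_half[of s] by simp
      qed
      show "norm (measure M (B s)) \<le> (1/2)^s" for s using B_meas[of s] le[of s] \<delta>(1)[of s] by simp
      show "summable (\<lambda>s. (1/2::real)^s)" by (rule summable_geometric) simp
    qed
    then have "AE x in M. \<forall>\<^sub>F n in sequentially. x \<in> space M - B n"
      by (intro borel_cantelli_AE1) (auto simp: M.emeasure_eq_measure)
    then show ?thesis by eventually_elim (auto simp: eventually_sequentially)
  qed
  have fu: "(\<integral>\<^sup>+x. ennreal ((f x - u n x)\<^sup>2) \<partial>M) \<le> ennreal (2 * \<delta> n)" for n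
  proof -
    have "(\<integral>\<^sup>+x. ennreal ((f x - u n x)\<^sup>2) \<partial>M) \<le> (\<integral>\<^sup>+x. (\<Sum>s. ennreal (4 * (C (n + s))\<^sup>2) * indicator (B (n + s)) x) \<partial>M)"
    proof (rule nn_integral_mono_AE)
      show "AE x in M. ennreal ((f x - u n x)\<^sup>2) \<le> (\<Sum>s. ennreal (4 * (C (n + s))\<^sup>2) * indicator (B (n + s)) x)"
        using AE_fin
      proof eventually_elim
        case (elim x)
        show ?case unfolding f_def u_def by (rule override_limit_distance[OF elim C_F C_f0 Cinc])
      qed
    qed
    also have "\<dots> = (\<Sum>s. \<integral>\<^sup>+x. ennreal (4 * (C (n + s))\<^sup>2) * indicator (B (n + s)) x \<partial>M)"
      by (rule nn_integral_suminf) measurable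
    also have "\<dots> = (\<Sum>s. ennreal (4 * (C (n + s))\<^sup>2) * emeasure M (B (n + s)))"
      by (simp add: nn_integral_cmult_indicator)
    also have "\<dots> \<le> (\<Sum>s. ennreal (\<delta> (n + s)))" by (intro suminf_le B_small) auto
    also have "\<dots> \<le> ennreal (2 * \<delta> n)" by (rule halving_suminf[where \<delta>=\<delta>, OF \<delta>(1) \<delta>_half])
    finally show ?thesis .
  qed
  have f_fin: "(\<integral>\<^sup>+x. ennreal ((f x)\<^sup>2) \<partial>M) < \<infinity>"
  proof -
    have "(\<integral>\<^sup>+x. ennreal ((f x)\<^sup>2) \<partial>M) = (\<integral>\<^sup>+x. ennreal (((f x - u 0 x) + u 0 x)\<^sup>2) \<partial>M)" by simp
    also have "\<dots> \<le> 2 * (\<integral>\<^sup>+x. ennreal ((f x - u 0 x)\<^sup>2) \<partial>M) + 2 * (\<integral>\<^sup>+x. ennreal ((u 0 x)\<^sup>2) \<partial>M)"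
      by (rule nn_integral_square_add) measurable
    also have "\<dots> < \<infinity>"
    proof -
      have "(\<integral>\<^sup>+x. ennreal ((u 0 x)\<^sup>2) \<partial>M) \<le> (\<integral>\<^sup>+x. ennreal (c\<^sup>2) \<partial>M)"
      proof (intro nn_integral_mono ennreal_leI)
        fix x
        have "\<bar>f0 x\<bar> \<le> \<bar>c\<bar>" using f0_bound[of x] by linarith
        then show "(u 0 x)\<^sup>2 \<le> c\<^sup>2" unfolding u_def by (simp add: abs_le_square_iff)
      qed
      also have "\<dots> < \<infinity>" by (simp add: M.emeasure_space_1)
      finally have 1: "(\<integral>\<^sup>+x. ennreal ((u 0 x)\<^sup>2) \<partial>M) < \<infinity>" .
      have 2: "(\<integral>\<^sup>+x. ennreal ((f x - u 0 x)\<^sup>2) \<partial>M) < \<infinity>" using fu[of 0] by (rule le_less_trans) simp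
      show ?thesis using 1 2 by (simp add: ennreal_mult_less_top)
    qed
    finally show ?thesis .
  qed
  have D_small: "emeasure M D \<le> 1/2"
  proof -
    have "emeasure M D \<le> (\<Sum>r. emeasure M (B r))" unfolding D_def by (rule emeasure_subadditive_countably) auto
    also have "\<dots> \<le> (\<Sum>r. ennreal (1/4) * ennreal (\<delta> (0 + r)))"
    proof (intro suminf_le)
      fix r
      have "emeasure M (B r) \<le> ennreal (1/4 * \<delta> r)" using B_meas[of r] by (simp add: M.emeasure_eq_measure ennreal_leI)
      also have "\<dots> = ennreal (1/4) * ennreal (\<delta> r)" using \<delta>(1)[of r] by (intro ennreal_mult) auto
      finally show "emeasure M (B r) \<le> ennreal (1/4) * ennreal (\<delta> (0 + r))" by simp
    qed auto
    also have "\<dots> = ennreal (1/4) * (\<Sum>r. ennreal (\<delta> (0 + r)))" by (rule ennreal_suminf_cmult)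
    also have "\<dots> \<le> ennreal (1/4) * ennreal (2 * \<delta> 0)" by (intro mult_left_mono halving_suminf[where \<delta>=\<delta>, OF \<delta>(1) \<delta>_half]) auto
    also have "\<dots> = ennreal (1/4 * (2 * \<delta> 0))" using \<delta>(1)[of 0] by (intro ennreal_mult[symmetric]) auto
    also have "\<dots> \<le> ennreal (1/2)" using \<delta>(2)[of 0] by (intro ennreal_leI) simp
    also have "ennreal (1/2) = 1/2" using divide_ennreal[of 1 2] by simp
    finally show ?thesis .
  qed
  have pos: "emeasure M {x\<in>space M. orbit_dist f (\<xi> r) x < ennreal (\<epsilon> r)} > 0" for r
  proof -
    define G where "G x = (\<integral>\<^sup>+h. ennreal ((f (T h x) - u (Suc r) (T h x))\<^sup>2) \<partial>w)" for x
    have G [measurable]: "G \<in> borel_measurable M" unfolding G_def[abs_def] by measurable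
    \<comment> \<open>By Markov's inequality the later changes are small on a large part of \<open>P r \<inter> B r\<close>.\<close>
    have intG: "(\<integral>\<^sup>+x. G x \<partial>M) \<le> ennreal (2 * \<delta> (Suc r))"
    proof -
      have "(\<integral>\<^sup>+x. G x \<partial>M) = (\<integral>\<^sup>+x. ennreal ((f x - u (Suc r) x)\<^sup>2) \<partial>M)"
        unfolding G_def by (rule integral_orbit_average) (auto simp: w.prob_space_axioms)
      then show ?thesis using fu by simp
    qed
    have "emeasure M {x \<in> P r \<inter> B r. G x < ennreal (e r)} > 0"
    proof (rule ccontr)
      assume "\<not> emeasure M {x \<in> P r \<inter> B r. G x < ennreal (e r)} > 0"
      then have 0: "emeasure M {x \<in> P r \<inter> B r. G x < ennreal (e r)} = 0" by simp
      have PBs: "P r \<inter> B r \<subseteq> space M" using sets.sets_into_space[OF P[of r]] by auto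
      have "{x \<in> space M. x \<in> P r \<inter> B r \<and> G x < ennreal (e r)} \<in> sets M" by measurable
      moreover have "{x \<in> space M. x \<in> P r \<inter> B r \<and> G x < ennreal (e r)} = {x \<in> P r \<inter> B r. G x < ennreal (e r)}"
        using PBs by auto
      ultimately have "{x \<in> P r \<inter> B r. G x < ennreal (e r)} \<in> null_sets M" using 0 by (simp add: null_sets_def)
      then have "AE x in M. x \<notin> {x \<in> P r \<inter> B r. G x < ennreal (e r)}" by (rule AE_not_in)
      then have AE: "AE x in M. ennreal (e r) * indicator (P r \<inter> B r) x \<le> G x"
        by eventually_elim (auto simp: indicator_def not_less)
      have "ennreal (e r * measure M (P r \<inter> B r)) = (\<integral>\<^sup>+x. ennreal (e r) * indicator (P r \<inter> B r) x \<partial>M)"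
        using e[of r] by (simp add: nn_integral_cmult_indicator M.emeasure_eq_measure ennreal_mult)
      also have "\<dots> \<le> (\<integral>\<^sup>+x. G x \<partial>M)" by (rule nn_integral_mono_AE[OF AE])
      also have "\<dots> \<le> ennreal (2 * \<delta> (Suc r))" by (rule intG)
      finally have "e r * measure M (P r \<inter> B r) \<le> 2 * \<delta> (Suc r)" using \<delta>(1)[of "Suc r"] by simp
      also have "\<dots> \<le> e r * measure M (P r \<inter> B r) / 2" using \<delta>_P[of r] by simp
      finally have "e r * measure M (P r \<inter> B r) \<le> 0" by simp
      moreover have "e r * measure M (P r \<inter> B r) > 0" using e[of r] PB[of r] by (simp add: M.emeasure_eq_measure)
      ultimately show False by simp
    qed
    moreover have "{x \<in> P r \<inter> B r. G x < ennreal (e r)} \<subseteq> {x\<in>space M. orbit_dist f (\<xi> r) x < ennreal (\<epsilon> r)}"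
    proof
      fix x assume "x \<in> {x \<in> P r \<inter> B r. G x < ennreal (e r)}"
      then have x: "x \<in> space M" "x \<in> B r" and Px: "orbit_dist (F r) (\<xi> r) x < ennreal (e r)" and Gx: "G x < ennreal (e r)"
        by (auto simp: P_def)
      note [measurable] = orbit_measurable[OF x(1)]
      have inv: "T k x \<in> B r" if "k \<in> K (N r)" for k using B_inv[OF that x(1)] x(2) by simp
      have 1: "(\<integral>\<^sup>+h. ennreal ((u (Suc r) (T h x) - F r (T h x))\<^sup>2) \<partial>w) \<le> ennreal (e r)"
        unfolding u_def
        by (rule order_trans[OF override_close_to_value[where B=B and F=F and C=C and r=r and n="N r", OF x inv C_f0 C_F Cinc]]) (simp_all add: N' ennreal_leI)
      have "orbit_dist (u (Suc r)) (\<xi> r) x \<le> 2 * (\<integral>\<^sup>+h. ennreal ((u (Suc r) (T h x) - F r (T h x))\<^sup>2) \<partial>w) + 2 * orbit_dist (F r) (\<xi> r) x"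
        unfolding orbit_dist_def by (rule nn_integral_square_triangle) measurable
      also have "\<dots> \<le> 2 * ennreal (e r) + 2 * ennreal (e r)"
        by (intro add_mono mult_left_mono 1 less_imp_le[OF Px]) auto
      finally have 2: "orbit_dist (u (Suc r)) (\<xi> r) x \<le> 2 * ennreal (e r) + 2 * ennreal (e r)" .
      have "orbit_dist f (\<xi> r) x \<le> 2 * G x + 2 * orbit_dist (u (Suc r)) (\<xi> r) x"
        unfolding orbit_dist_def G_def by (rule nn_integral_square_triangle) measurable
      also have "\<dots> \<le> 2 * G x + 2 * (2 * ennreal (e r) + 2 * ennreal (e r))"
        by (intro add_left_mono mult_left_mono 2) auto
      also have "\<dots> < 2 * ennreal (e r) + 2 * (2 * ennreal (e r) + 2 * ennreal (e r))"
      proof -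
        have a: "2 * ennreal (e r) = ennreal (2 * e r)" using e[of r] by (subst ennreal_mult) auto
        have "2 * G x < 2 * ennreal (e r)" using Gx by (intro ennreal_mult_strict_left_mono) auto
        moreover have "2 * (2 * ennreal (e r) + 2 * ennreal (e r)) \<noteq> \<infinity>"
          unfolding a by (simp add: ennreal_mult_eq_top_iff)
        ultimately show ?thesis by (simp add: ennreal_add_left_cancel_less add.commute)
      qed
      also have "\<dots> = ennreal (\<epsilon> r)"
      proof -
        have a: "2 * ennreal t = ennreal (2 * t)" if "t \<ge> 0" for t using that by (subst ennreal_mult) auto
        have b: "ennreal s + ennreal t = ennreal (s + t)" if "s \<ge> 0" "t \<ge> 0" for s t using that by simp
        have "2 * ennreal (e r) + 2 * (2 * ennreal (e r) + 2 * ennreal (e r)) = ennreal (2 * e r + 2 * (2 * e r + 2 * e r))"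
          using e[of r] by (simp only: a b less_imp_le mult_nonneg_nonneg add_nonneg_nonneg zero_le_numeral)
        also have "2 * e r + 2 * (2 * e r + 2 * e r) = \<epsilon> r" by (simp add: e_def)
        finally show ?thesis .
      qed
      finally show "x \<in> {x\<in>space M. orbit_dist f (\<xi> r) x < ennreal (\<epsilon> r)}" using x by simp
    qed
    moreover have "{x\<in>space M. orbit_dist f (\<xi> r) x < ennreal (\<epsilon> r)} \<in> sets M" by measurable
    ultimately show ?thesis using emeasure_mono less_le_trans by meson
  qed
  have "\<forall>x\<in>D. f x \<in> \<rat>"
  proof
    fix x assume "x \<in> D"
    then obtain r where "x \<in> B r" unfolding D_def by blast
    then show "f x \<in> \<rat>" unfolding f_def by (rule override_limit_Rats[where B=B and F=F, OF _ FQ])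
  qed
  moreover have "\<forall>x\<in>space M - D. f x = f0 x" unfolding f_def D_def using override_limit_outside[of _ B f0 F] by auto
  ultimately show ?thesis using f f_fin D D_small pos by blast
qed

end

section \<open>Injective real codes\<close>

text \<open>Digits 0 and 2 to base 3, as for the Cantor set: the first difference outweighs all later
  digits.\<close>

lemma ternary_code_less:
  fixes a b :: "nat \<Rightarrow> bool"
  assumes eq: "\<And>i. i < n \<Longrightarrow> a i = b i" and n: "a n" "\<not> b n"
  shows "(\<Sum>i. 2 * of_bool (b i) / 3^Suc i :: real) < (\<Sum>i. 2 * of_bool (a i) / 3^Suc i)"
proof -
  have g: "(\<lambda>i. 2 / 3^Suc (i + m) :: real) sums (1 / 3^m)" for m
    using sums_mult[OF geometric_sums[of "1/3::real"], of "2/3^Suc m"]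
    by (simp add: power_add field_simps)
  have sm: "summable (\<lambda>i. 2 * of_bool (c i) / 3^Suc i :: real)" for c :: "nat \<Rightarrow> bool"
    by (rule summable_comparison_test'[OF sums_summable[OF g[of 0]], of 0]) (auto simp: of_bool_def)
  define d :: "nat \<Rightarrow> real" where "d i = 2 * of_bool (a i) / 3^Suc i - 2 * of_bool (b i) / 3^Suc i" for i
  have sd: "summable d" unfolding d_def by (intro summable_diff sm)
  have "(\<Sum>i. 2 * of_bool (a i) / 3^Suc i :: real) - (\<Sum>i. 2 * of_bool (b i) / 3^Suc i) = suminf d"
    unfolding d_def by (rule suminf_diff[OF sm sm])
  also have "suminf d = (\<Sum>i. d (i + Suc n)) + (\<Sum>i<Suc n. d i)" by (rule suminf_split_initial_segment[OF sd])
  also have "(\<Sum>i<Suc n. d i) = 2 / 3^Suc n" using eq n by (simp add: d_def)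
  finally have *: "(\<Sum>i. 2 * of_bool (a i) / 3^Suc i :: real) - (\<Sum>i. 2 * of_bool (b i) / 3^Suc i)
    = (\<Sum>i. d (i + Suc n)) + 2 / 3^Suc n" .
  have "- (\<Sum>i. d (i + Suc n)) = (\<Sum>i. - d (i + Suc n))"
    using suminf_minus[OF summable_ignore_initial_segment[OF sd, of "Suc n"]] by simp
  also have "\<dots> \<le> (\<Sum>i. 2 / 3^Suc (i + Suc n))"
    by (intro suminf_le summable_minus summable_ignore_initial_segment[OF sd] sums_summable[OF g])
      (auto simp: d_def of_bool_def divide_right_mono)
  also have "\<dots> = 1 / 3^Suc n" using g[of "Suc n"] by (rule sums_unique[symmetric])
  finally have "(\<Sum>i. d (i + Suc n)) + 2 / 3^Suc n \<ge> 1 / 3^Suc n" by (simp add: field_simps)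
  moreover have "(1 / 3^Suc n :: real) > 0" by simp
  ultimately show ?thesis using * by linarith
qed

definition base_code :: "(nat \<Rightarrow> 'a set) \<Rightarrow> 'a \<Rightarrow> real" where
  "base_code V x = (\<Sum>i. 2 * of_bool (x \<in> V i) / 3^Suc i)"

lemma base_code_bounded: "\<bar>base_code V x\<bar> \<le> 1"
proof -
  have g: "(\<lambda>i. 2 / 3^Suc i :: real) sums 1"
    using sums_mult[OF geometric_sums[of "1/3::real"], of "2/3"] by (simp add: field_simps)
  have sm: "summable (\<lambda>i. 2 * of_bool (x \<in> V i) / 3^Suc i :: real)"
    by (rule summable_comparison_test'[OF sums_summable[OF g], of 0]) (auto simp: of_bool_def)
  have "base_code V x \<le> (\<Sum>i. 2 / 3^Suc i)" unfolding base_code_def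
    by (intro suminf_le sm sums_summable[OF g]) (auto simp: of_bool_def)
  moreover have "base_code V x \<ge> 0" unfolding base_code_def by (rule suminf_nonneg[OF sm]) simp
  ultimately show ?thesis using sums_unique[OF g] by simp
qed

lemma base_code_inj:
  assumes V: "enumerated_base X V" and H: "Hausdorff_space X"
  shows "inj_on (base_code V) (topspace X)"
proof (rule inj_onI)
  fix x y assume x: "x \<in> topspace X" and y: "y \<in> topspace X" and eq: "base_code V x = base_code V y"
  show "x = y"
  proof (rule ccontr)
    assume "x \<noteq> y"
    have "openin X (topspace X - {y})" using closedin_Hausdorff_singleton[OF H y] by auto
    then have "\<exists>i. x \<in> V i \<and> V i \<subseteq> topspace X - {y}"
      using V x \<open>x \<noteq> y\<close> unfolding enumerated_base_def by simp
    then have ex: "\<exists>i. (x \<in> V i) \<noteq> (y \<in> V i)" by blast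
    define n where "n = (LEAST i. (x \<in> V i) \<noteq> (y \<in> V i))"
    have n: "(x \<in> V n) \<noteq> (y \<in> V n)" unfolding n_def by (rule LeastI_ex[OF ex])
    have less: "(x \<in> V i) = (y \<in> V i)" if "i < n" for i using not_less_Least[of i] that unfolding n_def by blast
    show False
      using ternary_code_less[of n "\<lambda>i. x \<in> V i" "\<lambda>i. y \<in> V i"] ternary_code_less[of n "\<lambda>i. y \<in> V i" "\<lambda>i. x \<in> V i"]
        n less eq unfolding base_code_def by fastforce
  qed
qed

lemma base_code_measurable:
  assumes V: "\<And>i. V i \<in> sets M"
  shows "base_code V \<in> borel_measurable M"
proof -
  have "(\<lambda>x. 2 * of_bool (x \<in> V i) / 3^Suc i :: real) = (\<lambda>x. 2 * indicator (V i) x / 3^Suc i)" for i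
    by (auto simp: indicator_def)
  then have "(\<lambda>x. 2 * of_bool (x \<in> V i) / 3^Suc i :: real) \<in> borel_measurable M" for i using V[of i] by simp
  then show ?thesis unfolding base_code_def[abs_def] by (rule borel_measurable_suminf)
qed

lemma Rats_borel [measurable]: "(\<rat> :: real set) \<in> sets borel"
  by (rule sets.countable[OF _ countable_rat]) auto

text \<open>By Fubini with Lebesgue measure in \<open>t\<close>: for fixed \<open>x\<close> only countably many \<open>t\<close> make \<open>u x + t\<close>
  rational.\<close>

lemma (in sigma_finite_measure) AE_irrational_shift:
  assumes u [measurable]: "u \<in> borel_measurable M"
  shows "\<exists>t. AE x in M. u x + t \<notin> (\<rat>::real set)"
proof -
  interpret P: pair_sigma_finite M lborel by unfold_locales
  have null: "(\<integral>\<^sup>+t. indicator \<rat> (c + t) \<partial>lborel) = 0" for c :: real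
  proof -
    have "{t. c + t \<in> \<rat>} = (\<lambda>q. q - c) ` \<rat>" by (auto simp: image_iff algebra_simps)
    then have "countable {t. c + t \<in> \<rat>}" using countable_image[OF countable_rat, of "\<lambda>q. q - c"] by simp
    then have "{t. c + t \<in> \<rat>} \<in> null_sets lborel" by (rule countable_imp_null_set_lborel)
    moreover have "(\<integral>\<^sup>+t. indicator \<rat> (c + t) \<partial>lborel) = (\<integral>\<^sup>+t. indicator {t. c + t \<in> \<rat>} t \<partial>lborel)"
      by (intro nn_integral_cong) (auto simp: indicator_def)
    ultimately show ?thesis by (simp add: null_sets_def)
  qed
  have "(\<integral>\<^sup>+t. \<integral>\<^sup>+x. indicator \<rat> (u x + t) \<partial>M \<partial>lborel) = (\<integral>\<^sup>+x. \<integral>\<^sup>+t. indicator \<rat> (u x + t) \<partial>lborel \<partial>M)"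
    by (rule P.Fubini') measurable
  also have "\<dots> = 0" by (simp add: null)
  finally have "AE t in lborel. (\<integral>\<^sup>+x. indicator \<rat> (u x + t) \<partial>M) = 0"
    by (subst (asm) nn_integral_0_iff_AE) measurable
  then have "\<exists>t. (\<integral>\<^sup>+x. indicator \<rat> (u x + t) \<partial>M) = 0"
  proof (rule contrapos_pp)
    assume n: "\<nexists>t. (\<integral>\<^sup>+x. indicator \<rat> (u x + t) \<partial>M) = 0"
    show "\<not> (AE t in lborel. (\<integral>\<^sup>+x. indicator \<rat> (u x + t) \<partial>M) = 0)"
      using n by (simp add: eventually_False ae_filter_eq_bot_iff)
  qed
  then obtain t where "(\<integral>\<^sup>+x. indicator \<rat> (u x + t) \<partial>M) = 0" by blast
  then have "AE x in M. indicator \<rat> (u x + t) = (0::ennreal)"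
    by (subst (asm) nn_integral_0_iff_AE) measurable
  then have "AE x in M. u x + t \<notin> \<rat>" by eventually_elim (auto simp: indicator_def split: if_splits)
  then show ?thesis by blast
qed

lemma (in tower_action) irrational_code_exists:
  "\<exists>f0 c. f0 \<in> borel_measurable M \<and> (\<forall>x. \<bar>f0 x\<bar> \<le> (c::real)) \<and> inj_on f0 (space M) \<and> (AE x in M. f0 x \<notin> \<rat>)"
proof -
  have "V i \<in> sets M" for i using V borel_sigma_open[of X] unfolding enumerated_base_def setsM by blast
  then have m [measurable]: "base_code V \<in> borel_measurable M" by (rule base_code_measurable)
  obtain t where t: "AE x in M. base_code V x + t \<notin> \<rat>" using M.AE_irrational_shift[OF m] by blast
  show ?thesis
  proof (rule exI[of _ "\<lambda>x. base_code V x + t"], rule exI[of _ "1 + \<bar>t\<bar>"], intro conjI allI)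
    show "(\<lambda>x. base_code V x + t) \<in> borel_measurable M" by measurable
    show "\<bar>base_code V x + t\<bar> \<le> 1 + \<bar>t\<bar>" for x using base_code_bounded[of V x] by linarith
    show "inj_on (\<lambda>x. base_code V x + t) (space M)"
      using base_code_inj[OF V hausdorff_X] by (auto simp: inj_on_def topX)
    show "AE x in M. base_code V x + t \<notin> \<rat>" by (rule t)
  qed
qed

section \<open>Measurability into a separable metric space\<close>

locale dense_sequence = Metric_space +
  fixes s :: "nat \<Rightarrow> 'a"
  assumes s: "\<And>i. s i \<in> M" and dense: "\<And>a e. a \<in> M \<Longrightarrow> e > 0 \<Longrightarrow> \<exists>i. d (s i) a < e"
begin

lemma mball_base:
  assumes U: "openin mtopology U" and a: "a \<in> U"
  shows "\<exists>i j. a \<in> mball (s i) (1 / real (Suc j)) \<and> mball (s i) (1 / real (Suc j)) \<subseteq> U"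
proof -
  obtain r where r: "r > 0" "mball a r \<subseteq> U" using U a unfolding openin_mtopology by blast
  have aM: "a \<in> M" using U a openin_mtopology by blast
  obtain j where j: "1 / real (Suc j) < r / 2" using nat_approx_posE[of "r/2"] r(1) by auto
  have "1 / real (Suc j) > 0" by simp
  then obtain i where i: "d (s i) a < 1 / real (Suc j)" using dense[OF aM] by blast
  have "mball (s i) (1 / real (Suc j)) \<subseteq> mball a r"
  proof
    fix y assume "y \<in> mball (s i) (1 / real (Suc j))"
    then have y: "y \<in> M" "d (s i) y < 1 / real (Suc j)" by auto
    have "d a y \<le> d a (s i) + d (s i) y" by (rule triangle[OF aM s y(1)])
    also have "\<dots> < r" using i y(2) j commute[of a "s i"] by linarith
    finally show "y \<in> mball a r" using aM y(1) by simp
  qed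
  then show ?thesis using i aM s r(2) by (intro exI[of _ i] exI[of _ j]) auto
qed

lemma second_countable_mtopology: "second_countable mtopology"
  unfolding second_countable_def
proof (intro exI conjI ballI allI impI)
  let ?B = "range (\<lambda>(i, j). mball (s i) (1 / real (Suc j)))"
  show "countable ?B" by auto
  show "openin mtopology V" if "V \<in> ?B" for V using that by auto
  show "\<exists>V\<in>?B. x \<in> V \<and> V \<subseteq> U" if "openin mtopology U \<and> x \<in> U" for U x
    using mball_base[of U x] that by auto
qed

lemma measurable_dist:
  assumes i: "x \<in> M" shows "(\<lambda>a. d x a) \<in> borel_measurable (borel_sigma mtopology)"
proof (rule borel_measurable_iff_less[THEN iffD2], rule allI)
  fix r
  have "{a \<in> space (borel_sigma mtopology). d x a < r} = mball x r" using i by auto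
  then show "{a \<in> space (borel_sigma mtopology). d x a < r} \<in> sets (borel_sigma mtopology)"
    using borel_sigma_open[OF openin_mball] by simp
qed

lemma measurable_into_mtopology:
  assumes sp: "\<And>x. x \<in> space N \<Longrightarrow> \<Psi> x \<in> M" and m: "\<And>i. (\<lambda>x. d (s i) (\<Psi> x)) \<in> borel_measurable N"
  shows "\<Psi> \<in> N \<rightarrow>\<^sub>M borel_sigma mtopology"
  unfolding borel_sigma_def
proof (rule measurable_measure_of)
  show "{U. openin mtopology U} \<subseteq> Pow (topspace mtopology)"
    by (rule subsetI, simp only: mem_Collect_eq Pow_iff, rule openin_subset)
  show "\<Psi> \<in> space N \<rightarrow> topspace mtopology" using sp by simp
  fix U assume "U \<in> {U. openin mtopology U}"
  then have U: "openin mtopology U" by simp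
  define J where "J = {(i, j). mball (s i) (1 / real (Suc j)) \<subseteq> U}"
  note [measurable] = m
  have "\<Psi> -` U \<inter> space N = (\<Union>(i, j)\<in>J. {x \<in> space N. d (s i) (\<Psi> x) < 1 / real (Suc j)})"
  proof (intro equalityI subsetI)
    fix x assume "x \<in> \<Psi> -` U \<inter> space N"
    then have x: "x \<in> space N" "\<Psi> x \<in> U" by auto
    obtain i j where "\<Psi> x \<in> mball (s i) (1 / real (Suc j))" "mball (s i) (1 / real (Suc j)) \<subseteq> U"
      using mball_base[OF U x(2)] by blast
    then show "x \<in> (\<Union>(i, j)\<in>J. {x \<in> space N. d (s i) (\<Psi> x) < 1 / real (Suc j)})"
      using x(1) unfolding J_def by auto
  next
    fix x assume "x \<in> (\<Union>(i, j)\<in>J. {x \<in> space N. d (s i) (\<Psi> x) < 1 / real (Suc j)})"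
    then obtain i j where ij: "mball (s i) (1 / real (Suc j)) \<subseteq> U" and x: "x \<in> space N" "d (s i) (\<Psi> x) < 1 / real (Suc j)"
      unfolding J_def by auto
    then have "\<Psi> x \<in> mball (s i) (1 / real (Suc j))" using s sp by simp
    then show "x \<in> \<Psi> -` U \<inter> space N" using ij x(1) by blast
  qed
  also have "\<dots> \<in> sets N" by (rule sets.countable_UN'') auto
  finally show "\<Psi> -` U \<inter> space N \<in> sets N" .
qed

text \<open>A family that is measurable in \<open>g\<close> and continuous in \<open>a\<close> is jointly measurable: \<open>a\<close> is replaced
  by the first member \<open>s (k n a)\<close> of the dense sequence within \<open>1/(n+1)\<close>, and \<open>n\<close> tends to infinity.\<close>

lemma measurable_lipschitz_family:
  fixes S :: "'b \<Rightarrow> 'a \<Rightarrow> 'a" and L :: "'b \<Rightarrow> real"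
  assumes S: "\<And>g a. g \<in> space G \<Longrightarrow> a \<in> M \<Longrightarrow> S g a \<in> M"
    and lip: "\<And>g a b. g \<in> space G \<Longrightarrow> a \<in> M \<Longrightarrow> b \<in> M \<Longrightarrow> d (S g a) (S g b) \<le> L g * d a b"
    and m: "\<And>i j. (\<lambda>g. d (s i) (S g (s j))) \<in> borel_measurable G"
  shows "(\<lambda>(g, a). S g a) \<in> G \<Otimes>\<^sub>M borel_sigma mtopology \<rightarrow>\<^sub>M borel_sigma mtopology"
proof (rule measurable_into_mtopology)
  show "(case z of (g, a) \<Rightarrow> S g a) \<in> M" if "z \<in> space (G \<Otimes>\<^sub>M borel_sigma mtopology)" for z
    using that S by (auto simp: space_pair_measure)
  fix i
  define k where "k n a = (LEAST k. d (s k) a < 1 / real (Suc n))" for n a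
  have [measurable]: "k n \<in> borel_sigma mtopology \<rightarrow>\<^sub>M count_space UNIV" for n
  proof -
    note [measurable] = measurable_dist[OF s]
    show ?thesis unfolding k_def[abs_def] by measurable
  qed
  have kd: "d (s (k n a)) a < 1 / real (Suc n)" if "a \<in> M" for n a
    unfolding k_def by (rule LeastI_ex) (rule dense[OF that], simp)
  show "(\<lambda>z. d (s i) (case z of (g, a) \<Rightarrow> S g a)) \<in> borel_measurable (G \<Otimes>\<^sub>M borel_sigma mtopology)"
  proof (rule borel_measurable_LIMSEQ_real)
    fix n
    have [measurable]: "(\<lambda>z. k n (snd z)) \<in> G \<Otimes>\<^sub>M borel_sigma mtopology \<rightarrow>\<^sub>M count_space UNIV" by measurable
    show "(\<lambda>z. d (s i) (S (fst z) (s (k n (snd z))))) \<in> borel_measurable (G \<Otimes>\<^sub>M borel_sigma mtopology)"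
      by (rule measurable_compose_countable[where f="\<lambda>j z. d (s i) (S (fst z) (s j))" and g="\<lambda>z. k n (snd z)"])
        (auto intro: measurable_compose[OF measurable_fst m])
  next
    fix z assume "z \<in> space (G \<Otimes>\<^sub>M borel_sigma mtopology)"
    then obtain g a where z: "z = (g, a)" and g: "g \<in> space G" and a: "a \<in> M"
      by (auto simp: space_pair_measure)
    \<comment> \<open>The Lipschitz constant may depend on \<open>g\<close>, which is fixed in this limit.\<close>
    have lim0: "(\<lambda>n. \<bar>L g\<bar> * (1 / real (Suc n))) \<longlonglongrightarrow> \<bar>L g\<bar> * 0"
      by (intro tendsto_intros LIMSEQ_Suc[OF lim_1_over_n])
    have bound: "\<bar>d (s i) (S g (s (k n a))) - d (s i) (S g a)\<bar> \<le> \<bar>L g\<bar> * (1 / real (Suc n))" for n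
    proof -
      let ?b = "s (k n a)"
      have M: "S g ?b \<in> M" "S g a \<in> M" using S g a s by auto
      have "\<bar>d (s i) (S g ?b) - d (s i) (S g a)\<bar> \<le> d (S g ?b) (S g a)"
        using triangle[OF s[of i] M(1) M(2)] triangle[OF s[of i] M(2) M(1)] commute[of "S g ?b" "S g a"] by linarith
      also have "\<dots> \<le> L g * d ?b a" by (rule lip[OF g s a])
      also have "\<dots> \<le> \<bar>L g\<bar> * d ?b a" by (rule mult_right_mono) auto
      also have "\<dots> \<le> \<bar>L g\<bar> * (1 / real (Suc n))" by (rule mult_left_mono) (use kd[OF a, of n] in auto)
      finally show ?thesis .
    qed
    have "(\<lambda>n. d (s i) (S g (s (k n a))) - d (s i) (S g a)) \<longlonglongrightarrow> 0"
    proof (rule Lim_null_comparison)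
      show "\<forall>\<^sub>F n in sequentially. norm (d (s i) (S g (s (k n a))) - d (s i) (S g a)) \<le> \<bar>L g\<bar> * (1 / real (Suc n))"
        by (rule always_eventually, rule allI, unfold real_norm_def, rule bound)
      show "(\<lambda>n. \<bar>L g\<bar> * (1 / real (Suc n))) \<longlonglongrightarrow> 0" using lim0 by simp
    qed
    then have "(\<lambda>n. d (s i) (S g (s (k n a)))) \<longlonglongrightarrow> d (s i) (S g a)" by (simp add: LIM_zero_iff)
    then show "(\<lambda>n. d (s i) (S (fst z) (s (k n (snd z))))) \<longlonglongrightarrow> d (s i) (case z of (g, a) \<Rightarrow> S g a)"
      by (simp add: z)
  qed
qed

end

section \<open>Classes of square integrable functions\<close>

definition L2_class :: "'a measure \<Rightarrow> ('a \<Rightarrow> real) \<Rightarrow> ('a \<Rightarrow> real) set" where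
  "L2_class w u = L2_rel w `` {u}"

lemma L2_fun_iff: "u \<in> L2_fun w \<longleftrightarrow> u \<in> borel_measurable w \<and> (\<integral>\<^sup>+x. ennreal ((u x)\<^sup>2) \<partial>w) < \<infinity>"
  unfolding L2_fun_def integrable_iff_bounded by auto

lemma L2_class_in: "u \<in> L2_fun w \<Longrightarrow> L2_class w u \<in> L2 w"
  unfolding L2_class_def L2_def by (rule quotientI)

lemma L2_class_self: "u \<in> L2_fun w \<Longrightarrow> u \<in> L2_class w u"
  unfolding L2_class_def by (rule equiv_class_self[OF equiv_L2_rel])

lemma L2_cases: assumes "a \<in> L2 w" obtains u where "u \<in> L2_fun w" "a = L2_class w u"
  using assms unfolding L2_def L2_class_def by (auto elim!: quotientE)

lemma L2_class_eq_iff: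
  assumes "u \<in> L2_fun w" "v \<in> L2_fun w"
  shows "L2_class w u = L2_class w v \<longleftrightarrow> (AE x in w. u x = v x)"
  using eq_equiv_class_iff[OF equiv_L2_rel assms] assms unfolding L2_class_def by (auto simp: L2_rel_def)

lemma L2_dist_L2_class:
  assumes u: "u \<in> L2_fun w" and v: "v \<in> L2_fun w"
  shows "L2_dist w (L2_class w u) (L2_class w v) = sqrt (enn2real (\<integral>\<^sup>+x. ennreal ((u x - v x)\<^sup>2) \<partial>w))"
proof -
  have m: "u \<in> borel_measurable w" "v \<in> borel_measurable w" using u v by (auto simp: L2_fun_def)
  then show ?thesis
    unfolding L2_dist_class[OF L2_class_in[OF u] L2_class_in[OF v] L2_class_self[OF u] L2_class_self[OF v]]
    by (subst integral_eq_nn_integral) auto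
qed

lemma L2_dist_less:
  assumes u: "u \<in> L2_fun w" and v: "v \<in> L2_fun w" and e: "e > 0"
    and less: "(\<integral>\<^sup>+x. ennreal ((u x - v x)\<^sup>2) \<partial>w) < ennreal (e\<^sup>2)"
  shows "L2_dist w (L2_class w u) (L2_class w v) < e"
proof -
  have "enn2real (\<integral>\<^sup>+x. ennreal ((u x - v x)\<^sup>2) \<partial>w) < e\<^sup>2"
    using less e by (cases "\<integral>\<^sup>+x. ennreal ((u x - v x)\<^sup>2) \<partial>w") (auto simp: ennreal_less_iff)
  then show ?thesis unfolding L2_dist_L2_class[OF u v] using e by (intro real_less_lsqrt) auto
qed

context compact_tower
begin

lemma nn_integral_translate_le:
  "\<exists>C>0. \<forall>f\<in>borel_measurable borel. (\<integral>\<^sup>+h. f (h + g) \<partial>w) \<le> ennreal C * (\<integral>\<^sup>+h. f h \<partial>w)"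
proof -
  obtain C where C: "C > 0" "\<And>A. A \<in> sets borel \<Longrightarrow> emeasure w {h. h + g \<in> A} \<le> ennreal C * emeasure w A"
    using w_translate_le[of g] by auto
  have tr: "(\<lambda>h. h + g) \<in> w \<rightarrow>\<^sub>M borel" using measurable_translate(2)[of g] measurable_cong_sets[OF w_sets refl] by auto
  have "distr w borel (\<lambda>h. h + g) \<le> scale_measure (ennreal C) w"
  proof (subst le_measure)
    show "sets (distr w borel (\<lambda>h. h + g)) = sets (scale_measure (ennreal C) w)" by simp
    show "\<forall>A\<in>sets (distr w borel (\<lambda>h. h + g)). emeasure (distr w borel (\<lambda>h. h + g)) A \<le> emeasure (scale_measure (ennreal C) w) A"
      using C(2) by (auto simp: emeasure_distr[OF tr] vimage_def)
  qed
  then have "nn_integral (distr w borel (\<lambda>h. h + g)) f \<le> nn_integral (scale_measure (ennreal C) w) f" for f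
    by (intro nn_integral_mono_measure) simp
  then have "(\<integral>\<^sup>+h. f (h + g) \<partial>w) \<le> ennreal C * (\<integral>\<^sup>+h. f h \<partial>w)" if "f \<in> borel_measurable borel" for f
  proof -
    have f: "f \<in> borel_measurable w" using that measurable_cong_sets[OF w_sets refl, of borel] by simp
    have "(\<integral>\<^sup>+h. f (h + g) \<partial>w) = nn_integral (distr w borel (\<lambda>h. h + g)) f"
      by (rule nn_integral_distr[OF tr, symmetric]) (simp add: that)
    also have "\<dots> \<le> nn_integral (scale_measure (ennreal C) w) f" by fact
    also have "\<dots> = ennreal C * (\<integral>\<^sup>+h. f h \<partial>w)" by (rule nn_integral_scale_measure[OF f])
    finally show ?thesis .
  qed
  then show ?thesis using C(1) by blast
qed

lemma w_measurable_iff: "(u \<in> w \<rightarrow>\<^sub>M N) = (u \<in> borel \<rightarrow>\<^sub>M N)"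
  using measurable_cong_sets[OF w_sets refl] by auto

lemma translate_L2_fun:
  assumes u: "u \<in> L2_fun w" shows "(\<lambda>h. u (h + g)) \<in> L2_fun w"
proof -
  have [measurable]: "u \<in> borel_measurable borel" using u by (simp add: L2_fun_iff w_measurable_iff)
  obtain C where C: "C > 0" "\<And>f. f \<in> borel_measurable borel \<Longrightarrow> (\<integral>\<^sup>+h. f (h + g) \<partial>w) \<le> ennreal C * (\<integral>\<^sup>+h. f h \<partial>w)"
    using nn_integral_translate_le[of g] by auto
  have "(\<integral>\<^sup>+h. ennreal ((u (h + g))\<^sup>2) \<partial>w) \<le> ennreal C * (\<integral>\<^sup>+h. ennreal ((u h)\<^sup>2) \<partial>w)"
    by (rule C(2)[of "\<lambda>h. ennreal ((u h)\<^sup>2)"]) measurable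
  also have "\<dots> < \<infinity>" using u by (simp add: L2_fun_iff ennreal_mult_less_top)
  finally show ?thesis unfolding L2_fun_iff w_measurable_iff by (auto intro: measurable_compose[OF measurable_translate(2)])
qed

lemma translate_null_sets: "A \<in> null_sets w \<Longrightarrow> (\<lambda>h. h + g) -` A \<in> null_sets w"
proof -
  assume A: "A \<in> null_sets w"
  then have As: "A \<in> sets borel" "emeasure w A = 0" by auto
  obtain C where "emeasure w {h. h + g \<in> A} \<le> ennreal C * emeasure w A" using w_translate_le[of g] As(1) by blast
  then have "emeasure w {h. h + g \<in> A} = 0" using As(2) by simp
  moreover have "(\<lambda>h. h + g) -` A \<in> sets borel" using measurable_sets[OF measurable_translate(2)[of g] As(1)] by simp
  ultimately show ?thesis by (simp add: null_sets_def vimage_def)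
qed

lemma L2_translate_L2_class:
  assumes "u \<in> L2_fun w"
  shows "L2_translate w g (L2_class w u) = L2_class w (\<lambda>h. u (h + g))"
  unfolding L2_class_def
  by (rule L2_translate_class[OF w_sets translate_null_sets translate_L2_fun assms])

lemma L2_translate_in: "a \<in> L2 w \<Longrightarrow> L2_translate w g a \<in> L2 w"
  by (elim L2_cases) (simp add: L2_translate_L2_class L2_class_in translate_L2_fun)

lemma L2_translate_zero: "a \<in> L2 w \<Longrightarrow> L2_translate w 0 a = a"
  by (elim L2_cases) (simp add: L2_translate_L2_class)

lemma L2_translate_add: "a \<in> L2 w \<Longrightarrow> L2_translate w (g + h) a = L2_translate w g (L2_translate w h a)"
  by (elim L2_cases) (simp add: L2_translate_L2_class translate_L2_fun add.assoc)

lemma L2_translate_lipschitz: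
  "\<exists>L. \<forall>a\<in>L2 w. \<forall>b\<in>L2 w. L2_dist w (L2_translate w g a) (L2_translate w g b) \<le> L * L2_dist w a b"
proof -
  obtain C where C: "C > 0" "\<And>f. f \<in> borel_measurable borel \<Longrightarrow> (\<integral>\<^sup>+h. f (h + g) \<partial>w) \<le> ennreal C * (\<integral>\<^sup>+h. f h \<partial>w)"
    using nn_integral_translate_le[of g] by auto
  have "L2_dist w (L2_translate w g a) (L2_translate w g b) \<le> sqrt C * L2_dist w a b" if a: "a \<in> L2 w" and b: "b \<in> L2 w" for a b
  proof -
    obtain u v where u: "u \<in> L2_fun w" "a = L2_class w u" and v: "v \<in> L2_fun w" "b = L2_class w v"
      using a b by (elim L2_cases)
    have [measurable]: "u \<in> borel_measurable borel" "v \<in> borel_measurable borel"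
      using u(1) v(1) by (simp_all add: L2_fun_iff w_measurable_iff)
    let ?I = "\<integral>\<^sup>+h. ennreal ((u h - v h)\<^sup>2) \<partial>w"
    have fin: "?I < \<infinity>" using L2_fun_diff[OF u(1) v(1)] by (simp add: L2_fun_iff)
    have "(\<integral>\<^sup>+h. ennreal ((u (h + g) - v (h + g))\<^sup>2) \<partial>w) \<le> ennreal C * ?I"
      by (rule C(2)[of "\<lambda>h. ennreal ((u h - v h)\<^sup>2)"]) measurable
    then have "enn2real (\<integral>\<^sup>+h. ennreal ((u (h + g) - v (h + g))\<^sup>2) \<partial>w) \<le> enn2real (ennreal C * ?I)"
      using fin by (intro enn2real_mono) (auto simp: ennreal_mult_less_top)
    also have "\<dots> = C * enn2real ?I" using C(1) by (simp add: enn2real_mult)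
    finally show ?thesis
      unfolding u(2) v(2) L2_translate_L2_class[OF u(1)] L2_translate_L2_class[OF v(1)]
        L2_dist_L2_class[OF u(1) v(1)] L2_dist_L2_class[OF translate_L2_fun[OF u(1)] translate_L2_fun[OF v(1)]]
        real_sqrt_mult[symmetric] by simp
  qed
  then show ?thesis by blast
qed

end

section \<open>Measurable inverses of injective maps, modulo null sets\<close>

text \<open>By Lusin's theorem almost all of \<open>A\<close> is a countable union of compact sets on which \<open>\<Phi>\<close> is
  continuous.  On this union \<open>\<Phi>\<close> maps closed sets to countable unions of compact sets, and by
  injectivity taking images commutes with complements.  So the inverse is measurable.\<close>

lemma injective_image_measurable_mod_null:
  assumes fin: "finite_measure M" and reg: "compact_inner_regular X M" and setsM: "sets M = sets (borel_sigma X)"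
    and HX: "Hausdorff_space X" and \<Phi>: "\<Phi> \<in> M \<rightarrow>\<^sub>M borel_sigma Y" and Y: "second_countable Y" "Hausdorff_space Y"
    and A: "A \<in> sets M" and null: "emeasure M (space M - A) = 0" and inj: "inj_on \<Phi> A"
  shows "\<exists>X0\<in>sets M. X0 \<subseteq> A \<and> emeasure M (space M - X0) = 0 \<and>
    (\<forall>E\<in>sets M. \<Phi> ` (X0 \<inter> E) \<in> sets (borel_sigma Y))"
proof -
  interpret finite_measure M by fact
  have top: "topspace X = space M" using sets_eq_imp_space_eq[OF setsM] by simp
  have "\<forall>n. \<exists>C. compactin X C \<and> C \<subseteq> A \<and> measure M (A - C) < 1 / real (Suc n) \<and> continuous_map (subtopology X C) Y \<Phi>"
  proof
    fix n
    show "\<exists>C. compactin X C \<and> C \<subseteq> A \<and> measure M (A - C) < 1 / real (Suc n) \<and> continuous_map (subtopology X C) Y \<Phi>"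
      by (rule Lusin_theorem[OF fin reg setsM HX \<Phi> Y(1) _ _ A]) auto
  qed
  then obtain C where C: "\<And>n. compactin X (C n)" "\<And>n. C n \<subseteq> A" "\<And>n. measure M (A - C n) < 1 / real (Suc n)"
    "\<And>n. continuous_map (subtopology X (C n)) Y \<Phi>" by metis
  define X0 where "X0 = (\<Union>n. C n)"
  have Cs: "C n \<in> sets M" for n using compactin_imp_closedin[OF HX C(1)] unfolding setsM by (rule borel_sigma_closed)
  have X0: "X0 \<in> sets M" unfolding X0_def using Cs by auto
  have sub: "X0 \<subseteq> A" unfolding X0_def using C(2) by auto
  have A0: "measure M (A - X0) = 0"
  proof (rule ccontr)
    assume "measure M (A - X0) \<noteq> 0"
    then have "measure M (A - X0) > 0" by (simp add: zero_less_measure_iff)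
    then obtain n where n: "1 / real (Suc n) < measure M (A - X0)" using nat_approx_posE by metis
    have "measure M (A - X0) \<le> measure M (A - C n)"
      by (rule finite_measure_mono) (use A Cs in \<open>auto simp: X0_def\<close>)
    then show False using n C(3)[of n] by simp
  qed
  have "emeasure M (space M - X0) \<le> emeasure M ((space M - A) \<union> (A - X0))"
    by (rule emeasure_mono) (use A X0 in auto)
  also have "\<dots> \<le> emeasure M (space M - A) + emeasure M (A - X0)"
    by (rule emeasure_subadditive) (use A X0 in auto)
  also have "\<dots> = 0" using null A0 by (simp add: emeasure_eq_measure)
  finally have null0: "emeasure M (space M - X0) = 0" by simp
  have inj0: "inj_on \<Phi> X0" using inj sub by (rule inj_on_subset)
  have closed: "\<Phi> ` (X0 \<inter> F) \<in> sets (borel_sigma Y)" if F: "closedin X F" for F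
  proof -
    have "\<Phi> ` (C n \<inter> F) \<in> sets (borel_sigma Y)" for n
    proof -
      have "compactin (subtopology X (C n)) (C n \<inter> F)"
        using closed_Int_compactin[OF F C(1)[of n]] by (simp add: compactin_subtopology Int_commute)
      then have "compactin Y (\<Phi> ` (C n \<inter> F))" by (rule image_compactin[OF _ C(4)])
      then show ?thesis by (intro borel_sigma_closed compactin_imp_closedin[OF Y(2)])
    qed
    moreover have "\<Phi> ` (X0 \<inter> F) = (\<Union>n. \<Phi> ` (C n \<inter> F))" unfolding X0_def by auto
    ultimately show ?thesis by auto
  qed
  have Y0: "\<Phi> ` X0 \<in> sets (borel_sigma Y)"
  proof -
    have "X0 \<inter> topspace X = X0" using sets.sets_into_space[OF X0] top by auto
    then show ?thesis using closed[OF closedin_topspace] by simp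
  qed
  have compl: "\<Phi> ` (X0 \<inter> (topspace X - E)) = \<Phi> ` X0 - \<Phi> ` (X0 \<inter> E)" for E
  proof -
    have "X0 \<inter> (topspace X - E) = X0 - X0 \<inter> E" using sets.sets_into_space[OF X0] top by auto
    moreover have "\<Phi> ` (X0 - X0 \<inter> E) = \<Phi> ` X0 - \<Phi> ` (X0 \<inter> E)"
      by (rule inj_on_image_set_diff[OF inj0]) auto
    ultimately show ?thesis by simp
  qed
  have "\<Phi> ` (X0 \<inter> E) \<in> sets (borel_sigma Y)" if "E \<in> sigma_sets (topspace X) {U. openin X U}" for E
    using that
  proof induction
    case (Basic U)
    then have U: "openin X U" by simp
    have "topspace X - (topspace X - U) = U" using openin_subset[OF U] by auto
    moreover have "\<Phi> ` X0 - \<Phi> ` (X0 \<inter> (topspace X - U)) \<in> sets (borel_sigma Y)"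
      using Y0 closed[of "topspace X - U"] U by (intro sets.Diff) auto
    ultimately show ?case using compl[of "topspace X - U"] by simp
  next
    case Empty
    then show ?case by simp
  next
    case (Compl a)
    then show ?case unfolding compl using Y0 by (intro sets.Diff)
  next
    case (Union a)
    have "\<Phi> ` (X0 \<inter> (\<Union>i. a i)) = (\<Union>i. \<Phi> ` (X0 \<inter> a i))" by auto
    then show ?case using Union.IH by auto
  qed
  then have "\<forall>E\<in>sets M. \<Phi> ` (X0 \<inter> E) \<in> sets (borel_sigma Y)" unfolding setsM sets_borel_sigma by blast
  then show ?thesis using X0 sub null0 by blast
qed

lemma isomorphic_actions_distr:
  assumes prob: "prob_space M" and \<Phi>: "\<Phi> \<in> M \<rightarrow>\<^sub>M N" and X0: "X0 \<in> sets M"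
    and null: "emeasure M (space M - X0) = 0" and inj: "inj_on \<Phi> X0"
    and image: "\<And>E. E \<in> sets M \<Longrightarrow> \<Phi> ` (X0 \<inter> E) \<in> sets N"
    and T: "\<And>g. T g \<in> M \<rightarrow>\<^sub>M M" "\<And>g. distr M M (T g) = M"
    and equivariant: "\<And>g x. x \<in> space M \<Longrightarrow> \<Phi> (T g x) = S g (\<Phi> x)"
  shows "isomorphic_actions M T (distr M N \<Phi>) S"
proof -
  interpret prob_space M by fact
  define \<nu> where "\<nu> = distr M N \<Phi>"
  define Y0 where "Y0 = \<Phi> ` X0"
  have X0sp: "X0 \<subseteq> space M" by (rule sets.sets_into_space[OF X0])
  have sets_\<nu> [simp]: "sets \<nu> = sets N" and sp_\<nu> [simp]: "space \<nu> = space N" by (simp_all add: \<nu>_def)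
  have Y0: "Y0 \<in> sets \<nu>" using image[OF X0] unfolding Y0_def by simp
  have em: "emeasure \<nu> A = emeasure M (\<Phi> -` A \<inter> space M)" if "A \<in> sets N" for A
    unfolding \<nu>_def by (rule emeasure_distr[OF \<Phi> that])
  have nullY: "emeasure \<nu> (space \<nu> - Y0) = 0"
  proof -
    have "emeasure \<nu> (space \<nu> - Y0) = emeasure M (\<Phi> -` (space \<nu> - Y0) \<inter> space M)"
      by (rule em) (use Y0 in auto)
    also have "\<dots> \<le> emeasure M (space M - X0)"
      by (rule emeasure_mono) (use X0 in \<open>auto simp: Y0_def\<close>)
    finally show ?thesis using null by simp
  qed
  have bij: "bij_betw \<Phi> X0 Y0" unfolding Y0_def using inj by (rule inj_on_imp_bij_betw)
  have spX: "space (restrict_space M X0) = X0" using X0 by simp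
  have spY: "space (restrict_space \<nu> Y0) = Y0" using Y0 by simp
  have setsX: "A \<in> sets (restrict_space M X0) \<longleftrightarrow> A \<subseteq> X0 \<and> A \<in> sets M" for A
    by (rule sets_restrict_space_iff) (use X0 X0sp in \<open>simp add: Int_absorb2\<close>)
  have setsY: "A \<in> sets (restrict_space \<nu> Y0) \<longleftrightarrow> A \<subseteq> Y0 \<and> A \<in> sets N" for A
    using sets_restrict_space_iff[of Y0 \<nu> A] Y0 sets.sets_into_space[OF Y0] by (simp add: Int_absorb2)
  have "\<Phi> \<in> M \<rightarrow>\<^sub>M \<nu>" using \<Phi> measurable_cong_sets[OF refl sets_\<nu>] by auto
  then have "\<Phi> \<in> restrict_space M X0 \<rightarrow>\<^sub>M \<nu>" by (rule measurable_restrict_space1)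
  then have meas: "\<Phi> \<in> restrict_space M X0 \<rightarrow>\<^sub>M restrict_space \<nu> Y0"
    by (rule measurable_restrict_space2[rotated]) (auto simp: spX Y0_def)
  have inv: "the_inv_into X0 \<Phi> \<in> restrict_space \<nu> Y0 \<rightarrow>\<^sub>M restrict_space M X0"
  proof (rule measurableI)
    fix y assume "y \<in> space (restrict_space \<nu> Y0)"
    then have "y \<in> Y0" by (simp only: spY)
    then have "y \<in> \<Phi> ` X0" unfolding Y0_def .
    then show "the_inv_into X0 \<Phi> y \<in> space (restrict_space M X0)"
      unfolding spX by (rule the_inv_into_into[OF inj]) simp
  next
    fix A assume "A \<in> sets (restrict_space M X0)"
    then have A: "A \<subseteq> X0" "A \<in> sets M" by (simp_all add: setsX)
    have "the_inv_into X0 \<Phi> -` A \<inter> Y0 = \<Phi> ` A"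
    proof (intro equalityI subsetI)
      fix y assume "y \<in> the_inv_into X0 \<Phi> -` A \<inter> Y0"
      then have "the_inv_into X0 \<Phi> y \<in> A" "\<Phi> (the_inv_into X0 \<Phi> y) = y"
        using f_the_inv_into_f[OF inj, of y] by (auto simp: Y0_def)
      then show "y \<in> \<Phi> ` A" by (metis imageI)
    next
      fix y assume "y \<in> \<Phi> ` A"
      then obtain x where "x \<in> A" "y = \<Phi> x" by blast
      then show "y \<in> the_inv_into X0 \<Phi> -` A \<inter> Y0"
        using the_inv_into_f_f[OF inj, of x] A(1) by (auto simp: Y0_def)
    qed
    moreover have "\<Phi> ` A \<in> sets N" using image[OF A(2)] A(1) by (simp add: Int_absorb1)
    moreover have "\<Phi> ` A \<subseteq> Y0" using A(1) unfolding Y0_def by blast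
    ultimately show "the_inv_into X0 \<Phi> -` A \<inter> space (restrict_space \<nu> Y0) \<in> sets (restrict_space \<nu> Y0)"
      by (simp add: spY setsY)
  qed
  have AE0: "AE x in M. x \<in> X0"
  proof (rule AE_I[where N="space M - X0"])
    show "{x \<in> space M. x \<notin> X0} \<subseteq> space M - X0" by auto
  qed (use null X0 in auto)
  have "distr (restrict_space M X0) (restrict_space \<nu> Y0) \<Phi> = restrict_space \<nu> Y0"
  proof (rule measure_eqI)
    fix A assume "A \<in> sets (distr (restrict_space M X0) (restrict_space \<nu> Y0) \<Phi>)"
    then have A': "A \<in> sets (restrict_space \<nu> Y0)" by simp
    then have A: "A \<subseteq> Y0" "A \<in> sets N" by (simp_all add: setsY)
    have "emeasure (distr (restrict_space M X0) (restrict_space \<nu> Y0) \<Phi>) A = emeasure (restrict_space M X0) (\<Phi> -` A \<inter> X0)"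
      using emeasure_distr[OF meas A'] by (simp add: spX)
    also have "\<dots> = emeasure M (\<Phi> -` A \<inter> X0)"
      by (rule emeasure_restrict_space) (use X0 X0sp in \<open>auto simp: Int_absorb2\<close>)
    also have "\<dots> = emeasure M (\<Phi> -` A \<inter> space M)"
    proof (rule emeasure_eq_AE)
      show "AE x in M. (x \<in> \<Phi> -` A \<inter> X0) = (x \<in> \<Phi> -` A \<inter> space M)"
        using AE0 by eventually_elim (use X0sp in auto)
      show V: "\<Phi> -` A \<inter> space M \<in> sets M" by (rule measurable_sets[OF \<Phi> A(2)])
      have "\<Phi> -` A \<inter> X0 = (\<Phi> -` A \<inter> space M) \<inter> X0" using X0sp by auto
      then show "\<Phi> -` A \<inter> X0 \<in> sets M" using V X0 by simp
    qed
    also have "\<dots> = emeasure (restrict_space \<nu> Y0) A"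
      unfolding em[OF A(2), symmetric]
      by (rule emeasure_restrict_space[symmetric]) (use Y0 sets.sets_into_space[OF Y0] A in \<open>auto simp: Int_absorb2\<close>)
    finally show "emeasure (distr (restrict_space M X0) (restrict_space \<nu> Y0) \<Phi>) A = emeasure (restrict_space \<nu> Y0) A" .
  qed simp
  moreover have "AE x in M. x \<in> X0 \<and> T g x \<in> X0 \<and> \<Phi> (T g x) = S g (\<Phi> x)" for g
  proof -
    have "AE x in distr M M (T g). x \<in> X0" unfolding T(2) by (rule AE0)
    then have "AE x in M. T g x \<in> X0" by (subst (asm) AE_distr_iff[OF T(1)]) (use X0 in auto)
    then show ?thesis using AE0 AE_space by eventually_elim (use equivariant in auto)
  qed
  ultimately show ?thesis
    unfolding isomorphic_actions_def \<nu>_def[symmetric]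
    using X0 Y0 null nullY bij meas inv by blast
qed

section \<open>The orbit map into the Hilbert space\<close>

context tower_action
begin

text \<open>The step functions, read along one fixed free orbit, are dense in \<open>L\<^sub>2(G,w)\<close>.\<close>

lemma L2_dense_sequence_exists:
  "\<exists>\<xi>. (\<forall>n. \<xi> n \<in> L2_fun w) \<and> dense_sequence (L2 w) (L2_dist w) (\<lambda>n::nat. L2_class w (\<xi> n))"
proof -
  obtain x where x: "free_point x" using eventually_happens'[OF M.ae_filter_bot AE_free_point] by blast
  then have xs: "x \<in> space M" by (simp add: free_point_def)
  define \<xi> where "\<xi> n h = rational_step V (from_nat n) (T h x)" for n :: nat and h
  have \<xi>: "\<xi> n \<in> L2_fun w" for n
    unfolding L2_fun_iff
  proof
    show "\<xi> n \<in> borel_measurable w"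
      unfolding \<xi>_def[abs_def] by (rule orbit_function_measurable[OF rational_step_meas xs])
    obtain C where C: "\<And>y. \<bar>rational_step V (from_nat n) y\<bar> \<le> C" using rational_step_bounded by blast
    have "(\<integral>\<^sup>+h. ennreal ((\<xi> n h)\<^sup>2) \<partial>w) \<le> (\<integral>\<^sup>+h. ennreal (C\<^sup>2) \<partial>w)"
    proof (intro nn_integral_mono ennreal_leI)
      fix h
      have "\<bar>\<xi> n h\<bar> \<le> \<bar>C\<bar>" unfolding \<xi>_def using C[of "T h x"] by linarith
      then show "(\<xi> n h)\<^sup>2 \<le> C\<^sup>2" by (simp add: abs_le_square_iff)
    qed
    also have "\<dots> < \<infinity>" using w.emeasure_space_1 by simp
    finally show "(\<integral>\<^sup>+h. ennreal ((\<xi> n h)\<^sup>2) \<partial>w) < \<infinity>" .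
  qed
  interpret Metric_space "L2 w" "L2_dist w" by (rule Metric_space_L2)
  have "dense_sequence (L2 w) (L2_dist w) (\<lambda>n::nat. L2_class w (\<xi> n))"
  proof unfold_locales
    show "L2_class w (\<xi> i) \<in> L2 w" for i by (rule L2_class_in[OF \<xi>])
    fix a and e :: real assume a: "a \<in> L2 w" and e: "e > 0"
    obtain u where u: "u \<in> L2_fun w" "a = L2_class w u" using a by (rule L2_cases)
    have "\<exists>l. (\<integral>\<^sup>+h. ennreal ((rational_step V l (T h x) - u h)\<^sup>2) \<partial>w) < ennreal (e\<^sup>2)"
      by (rule orbit_dense_functions[OF x]) (use u(1) e in \<open>auto simp: L2_fun_iff w_measurable_iff\<close>)
    then obtain l where l: "(\<integral>\<^sup>+h. ennreal ((rational_step V l (T h x) - u h)\<^sup>2) \<partial>w) < ennreal (e\<^sup>2)" by blast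
    have "(\<integral>\<^sup>+h. ennreal ((\<xi> (to_nat l) h - u h)\<^sup>2) \<partial>w) < ennreal (e\<^sup>2)" using l by (simp add: \<xi>_def)
    then have "L2_dist w (L2_class w (\<xi> (to_nat l))) a < e"
      unfolding u(2) by (rule L2_dist_less[OF \<xi> u(1) e])
    then show "\<exists>i. L2_dist w (L2_class w (\<xi> i)) a < e" by blast
  qed
  then show ?thesis using \<xi> by blast
qed

definition orbit_norm :: "('x \<Rightarrow> real) \<Rightarrow> 'x \<Rightarrow> ennreal" where
  "orbit_norm f x = (\<integral>\<^sup>+h. ennreal ((f (T h x))\<^sup>2) \<partial>w)"

text \<open>The value 0 stands in when \<open>h \<mapsto> f (T h x)\<close> is not square integrable.  This case is invariant
  under the action, so that \<open>orbit_map f\<close> is equivariant at every point.\<close>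

definition orbit_function :: "('x \<Rightarrow> real) \<Rightarrow> 'x \<Rightarrow> 'g \<Rightarrow> real" where
  "orbit_function f x h = (if orbit_norm f x < \<infinity> then f (T h x) else 0)"

definition orbit_map :: "('x \<Rightarrow> real) \<Rightarrow> 'x \<Rightarrow> ('g \<Rightarrow> real) set" where
  "orbit_map f x = L2_class w (orbit_function f x)"

context
  fixes f :: "'x \<Rightarrow> real"
  assumes f [measurable]: "f \<in> borel_measurable M"
begin

lemma orbit_norm_measurable [measurable]: "orbit_norm f \<in> borel_measurable M"
  unfolding orbit_norm_def[abs_def] by measurable

lemma orbit_integral_translate:
  assumes x: "x \<in> space M" and u [measurable]: "u \<in> borel_measurable borel"
  shows "\<exists>C>0. (\<integral>\<^sup>+h. u (f (T h (T g x))) \<partial>w) \<le> ennreal C * (\<integral>\<^sup>+h. u (f (T h x)) \<partial>w)"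
proof -
  obtain C where C: "C > 0" "\<And>f. f \<in> borel_measurable borel \<Longrightarrow> (\<integral>\<^sup>+h. f (h + g) \<partial>w) \<le> ennreal C * (\<integral>\<^sup>+h. f h \<partial>w)"
    using nn_integral_translate_le[of g] by auto
  have [measurable]: "(\<lambda>h. T h x) \<in> borel \<rightarrow>\<^sub>M M" by (rule orbit_measurable[OF x])
  have "(\<integral>\<^sup>+h. u (f (T (h + g) x)) \<partial>w) \<le> ennreal C * (\<integral>\<^sup>+h. u (f (T h x)) \<partial>w)"
    by (rule C(2)[of "\<lambda>h. u (f (T h x))"]) measurable
  then show ?thesis using C(1) T_add[OF x] by auto
qed

lemma orbit_norm_translate:
  assumes x: "x \<in> space M" shows "orbit_norm f (T g x) < \<infinity> \<longleftrightarrow> orbit_norm f x < \<infinity>"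
proof -
  have le: "orbit_norm f (T g y) < \<infinity>" if y: "y \<in> space M" "orbit_norm f y < \<infinity>" for g y
  proof -
    obtain C where "orbit_norm f (T g y) \<le> ennreal C * orbit_norm f y"
      using orbit_integral_translate[OF y(1), of "\<lambda>t. ennreal (t\<^sup>2)" g] unfolding orbit_norm_def by auto
    also have "\<dots> < \<infinity>" using y(2) by (simp add: ennreal_mult_less_top)
    finally show ?thesis .
  qed
  have "T (- g) (T g x) = x" using T_add[OF x, of "- g" g] T_zero[OF x] by simp
  then show ?thesis using le[OF x, of g] le[OF T_space[OF x], of g "- g"] by auto
qed

lemma orbit_function_L2: "x \<in> space M \<Longrightarrow> orbit_function f x \<in> L2_fun w"
proof -
  assume x: "x \<in> space M"
  show ?thesis
  proof (cases "orbit_norm f x < \<infinity>")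
    case True
    then have "orbit_function f x = (\<lambda>h. f (T h x))" by (auto simp: orbit_function_def)
    then show ?thesis using True orbit_function_measurable[OF f x] by (simp add: L2_fun_iff orbit_norm_def)
  next
    case False
    then have "orbit_function f x = (\<lambda>h. 0)" by (auto simp: orbit_function_def)
    then show ?thesis by (simp add: L2_fun_iff)
  qed
qed

lemma orbit_map_in: "x \<in> space M \<Longrightarrow> orbit_map f x \<in> L2 w"
  unfolding orbit_map_def by (intro L2_class_in orbit_function_L2)

lemma orbit_map_equivariant:
  assumes x: "x \<in> space M" shows "orbit_map f (T g x) = L2_translate w g (orbit_map f x)"
proof -
  have "orbit_function f (T g x) = (\<lambda>h. orbit_function f x (h + g))"
    unfolding orbit_function_def using orbit_norm_translate[OF x, of g] T_add[OF x] by auto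
  then show ?thesis unfolding orbit_map_def using L2_translate_L2_class[OF orbit_function_L2[OF x]] by simp
qed

lemma orbit_map_measurable:
  "orbit_map f \<in> M \<rightarrow>\<^sub>M borel_sigma (L2_topology w)"
proof -
  obtain \<xi> where \<xi>: "\<And>n. \<xi> n \<in> L2_fun w" and ds: "dense_sequence (L2 w) (L2_dist w) (\<lambda>n::nat. L2_class w (\<xi> n))"
    using L2_dense_sequence_exists by auto
  have [measurable]: "\<xi> n \<in> borel_measurable borel" for n using \<xi>[of n] by (simp add: L2_fun_iff w_measurable_iff)
  interpret dense_sequence "L2 w" "L2_dist w" "\<lambda>n::nat. L2_class w (\<xi> n)" by (rule ds)
  show ?thesis
    unfolding L2_topology_def
  proof (rule measurable_into_mtopology)
    show "orbit_map f x \<in> L2 w" if "x \<in> space M" for x by (rule orbit_map_in[OF that])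
    fix i
    have eq: "L2_dist w (L2_class w (\<xi> i)) (orbit_map f x) = sqrt (enn2real (\<integral>\<^sup>+h. ennreal ((\<xi> i h - orbit_function f x h)\<^sup>2) \<partial>w))"
      if "x \<in> space M" for x
      unfolding orbit_map_def by (rule L2_dist_L2_class[OF \<xi> orbit_function_L2[OF that]])
    have "(\<lambda>x. sqrt (enn2real (\<integral>\<^sup>+h. ennreal ((\<xi> i h - orbit_function f x h)\<^sup>2) \<partial>w))) \<in> borel_measurable M"
      unfolding orbit_function_def by measurable
    then show "(\<lambda>x. L2_dist w (L2_class w (\<xi> i)) (orbit_map f x)) \<in> borel_measurable M"
      by (subst measurable_cong[OF eq])
  qed
qed

lemma AE_orbit_norm:
  assumes fin: "(\<integral>\<^sup>+x. ennreal ((f x)\<^sup>2) \<partial>M) < \<infinity>"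
  shows "AE x in M. orbit_norm f x < \<infinity>"
proof -
  have "(\<integral>\<^sup>+x. orbit_norm f x \<partial>M) = (\<integral>\<^sup>+x. ennreal ((f x)\<^sup>2) \<partial>M)"
    unfolding orbit_norm_def by (rule integral_orbit_average) (auto simp: w.prob_space_axioms)
  then have "(\<integral>\<^sup>+x. orbit_norm f x \<partial>M) \<noteq> \<infinity>" using fin by simp
  then have "AE x in M. orbit_norm f x \<noteq> \<infinity>" by (intro nn_integral_PInf_AE) auto
  then show ?thesis by eventually_elim (auto simp: less_top)
qed

text \<open>This is the use of ergodicity: whether an orbit spends positive time in a set is an
  invariant property, and it cannot fail almost everywhere if the set has positive measure.\<close>

lemma AE_orbit_visits:
  assumes A [measurable]: "A \<in> sets borel" and pos: "emeasure M {x\<in>space M. f x \<in> A} > 0"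
  shows "AE x in M. (\<integral>\<^sup>+h. indicator A (f (T h x)) \<partial>w) > 0"
proof -
  define J where "J x = (\<integral>\<^sup>+h. indicator A (f (T h x)) \<partial>w)" for x
  have J [measurable]: "J \<in> borel_measurable M" unfolding J_def[abs_def] by measurable
  define E where "E = {x\<in>space M. J x > 0}"
  have E: "E \<in> sets M" unfolding E_def by measurable
  have le: "J y > 0" if y: "y \<in> space M" "J (T g y) > 0" for g y
  proof (rule ccontr)
    assume "\<not> J y > 0"
    then have "J y = 0" by simp
    moreover obtain C where "J (T g y) \<le> ennreal C * J y"
      using orbit_integral_translate[OF y(1), of "indicator A" g] unfolding J_def by auto
    ultimately show False using y(2) by simp
  qed
  have "T g x \<in> E \<longleftrightarrow> x \<in> E" if x: "x \<in> space M" for g x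
  proof -
    have "T (- g) (T g x) = x" using T_add[OF x, of "- g" g] T_zero[OF x] by simp
    then show ?thesis using le[OF x, of g] le[OF T_space[OF x], of "- g" g] x T_space[OF x] unfolding E_def by auto
  qed
  then have "\<forall>g. AE x in M. T g x \<in> E \<longleftrightarrow> x \<in> E" by (auto intro: AE_I2)
  then have "measure M E = 0 \<or> measure M E = 1" using erg E unfolding ergodic_action_def by blast
  moreover have "measure M E \<noteq> 0"
  proof
    assume "measure M E = 0"
    then have "E \<in> null_sets M" using E by (simp add: null_sets_def M.emeasure_eq_measure)
    then have "AE x in M. x \<notin> E" by (rule AE_not_in)
    then have "AE x in M. J x = 0" using AE_space by eventually_elim (auto simp: E_def)
    then have "(\<integral>\<^sup>+x. J x \<partial>M) = 0" by (simp add: nn_integral_0_iff_AE)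
    moreover have "(\<integral>\<^sup>+x. J x \<partial>M) = (\<integral>\<^sup>+x. indicator A (f x) \<partial>M)"
      unfolding J_def by (rule integral_orbit_average) (auto simp: w.prob_space_axioms)
    moreover have "(\<integral>\<^sup>+x. indicator A (f x) \<partial>M) = (\<integral>\<^sup>+x. indicator {x\<in>space M. f x \<in> A} x \<partial>M)"
      by (intro nn_integral_cong) (auto simp: indicator_def)
    ultimately show False using pos by simp
  qed
  ultimately have "AE x in M. x \<in> E" using E M.AE_in_set_eq_1[of E] by simp
  then show ?thesis by eventually_elim (simp add: E_def J_def)
qed

text \<open>Equal classes give equal values of \<open>f\<close> at \<open>T h x\<close> and \<open>T h y\<close> for almost every \<open>h\<close>.  A single
  such \<open>h\<close> for which the value lies in \<open>A\<close> identifies \<open>T h x\<close> with \<open>T h y\<close>, hence \<open>x\<close> with \<open>y\<close>.\<close>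

lemma orbit_map_inj:
  assumes A: "A \<in> sets borel" and inj: "inj_on f {x\<in>space M. f x \<in> A}"
    and x: "x \<in> space M" "orbit_norm f x < \<infinity>" "(\<integral>\<^sup>+h. indicator A (f (T h x)) \<partial>w) > 0"
    and y: "y \<in> space M" "orbit_norm f y < \<infinity>"
    and eq: "orbit_map f x = orbit_map f y"
  shows "x = y"
proof -
  have "AE h in w. orbit_function f x h = orbit_function f y h"
    using eq L2_class_eq_iff[OF orbit_function_L2[OF x(1)] orbit_function_L2[OF y(1)]] unfolding orbit_map_def by simp
  then have AE: "AE h in w. f (T h x) = f (T h y)" using x(2) y(2) by (simp add: orbit_function_def)
  have "\<exists>h. f (T h x) \<in> A \<and> f (T h x) = f (T h y)"
  proof (rule ccontr)
    assume n: "\<nexists>h. f (T h x) \<in> A \<and> f (T h x) = f (T h y)"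
    have "AE h in w. indicator A (f (T h x)) = (0::ennreal)"
      using AE
    proof eventually_elim
      case (elim h)
      then have "f (T h x) \<notin> A" using n by blast
      then show ?case by simp
    qed
    then have "(\<integral>\<^sup>+h. indicator A (f (T h x)) \<partial>w) = (\<integral>\<^sup>+h. 0 \<partial>w)" by (rule nn_integral_cong_AE)
    then show False using x(3) by simp
  qed
  then obtain h where h: "f (T h x) \<in> A" "f (T h x) = f (T h y)" by blast
  have "T h x = T h y" by (rule inj_onD[OF inj h(2)]) (use h T_space x y in auto)
  then have "T (- h) (T h x) = T (- h) (T h y)" by simp
  then show "x = y" using T_add[OF x(1), of "- h" h] T_add[OF y(1), of "- h" h] T_zero[OF x(1)] T_zero[OF y(1)] by simp
qed

end

lemma L2_translate_jointly_measurable: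
  "(\<lambda>(g, a). L2_translate w g a) \<in> borel \<Otimes>\<^sub>M borel_sigma (L2_topology w) \<rightarrow>\<^sub>M borel_sigma (L2_topology w)"
proof -
  obtain \<xi> where \<xi>: "\<And>n. \<xi> n \<in> L2_fun w" and ds: "dense_sequence (L2 w) (L2_dist w) (\<lambda>n::nat. L2_class w (\<xi> n))"
    using L2_dense_sequence_exists by auto
  have [measurable]: "\<xi> n \<in> borel_measurable borel" for n using \<xi>[of n] by (simp add: L2_fun_iff w_measurable_iff)
  interpret dense_sequence "L2 w" "L2_dist w" "\<lambda>n::nat. L2_class w (\<xi> n)" by (rule ds)
  have "\<forall>g. \<exists>L. \<forall>a\<in>L2 w. \<forall>b\<in>L2 w. L2_dist w (L2_translate w g a) (L2_translate w g b) \<le> L * L2_dist w a b"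
    using L2_translate_lipschitz by blast
  then obtain L where L: "\<And>g a b. a \<in> L2 w \<Longrightarrow> b \<in> L2 w \<Longrightarrow>
      L2_dist w (L2_translate w g a) (L2_translate w g b) \<le> L g * L2_dist w a b" by metis
  show ?thesis
    unfolding L2_topology_def
  proof (rule measurable_lipschitz_family[where L=L])
    show "L2_translate w g a \<in> L2 w" if "a \<in> L2 w" for g a by (rule L2_translate_in[OF that])
    show "L2_dist w (L2_translate w g a) (L2_translate w g b) \<le> L g * L2_dist w a b" if "a \<in> L2 w" "b \<in> L2 w" for g a b
      by (rule L[OF that])
    fix i j
    have eq: "L2_dist w (L2_class w (\<xi> i)) (L2_translate w g (L2_class w (\<xi> j))) = sqrt (enn2real (\<integral>\<^sup>+h. ennreal ((\<xi> i h - \<xi> j (h + g))\<^sup>2) \<partial>w))" for g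
      unfolding L2_translate_L2_class[OF \<xi>] by (rule L2_dist_L2_class[OF \<xi> translate_L2_fun[OF \<xi>]])
    show "(\<lambda>g. L2_dist w (L2_class w (\<xi> i)) (L2_translate w g (L2_class w (\<xi> j)))) \<in> borel_measurable borel"
      unfolding eq by measurable
  qed
qed

lemma orbit_map_distr_action:
  assumes f: "f \<in> borel_measurable M"
  shows "pmp_action (distr M (borel_sigma (L2_topology w)) (orbit_map f)) (L2_translate w)"
proof -
  let ?N = "borel_sigma (L2_topology w)"
  define \<nu> where "\<nu> = distr M ?N (orbit_map f)"
  note \<Phi> = orbit_map_measurable[OF f]
  have s [measurable_cong]: "sets \<nu> = sets ?N" unfolding \<nu>_def by simp
  have sp: "space \<nu> = L2 w" unfolding \<nu>_def by (simp add: topspace_L2_topology)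
  have S: "L2_translate w g \<in> ?N \<rightarrow>\<^sub>M ?N" for g
    using measurable_compose[OF measurable_Pair1'[of g borel ?N] L2_translate_jointly_measurable] by simp
  have "prob_space \<nu>" unfolding \<nu>_def by (rule M.prob_space_distr[OF \<Phi>])
  moreover have "(\<lambda>(g, a). L2_translate w g a) \<in> borel \<Otimes>\<^sub>M \<nu> \<rightarrow>\<^sub>M \<nu>"
    using L2_translate_jointly_measurable measurable_cong_sets[OF sets_pair_measure_cong[OF refl s] s] by blast
  moreover have "distr \<nu> \<nu> (L2_translate w g) = \<nu>" for g
  proof -
    have Tm: "T g \<in> M \<rightarrow>\<^sub>M M" by (intro T_measurable) auto
    have "distr \<nu> \<nu> (L2_translate w g) = distr \<nu> ?N (L2_translate w g)" by (rule distr_cong) (auto simp: s)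
    also have "\<dots> = distr M ?N (L2_translate w g \<circ> orbit_map f)" unfolding \<nu>_def by (rule distr_distr[OF S \<Phi>])
    also have "\<dots> = distr M ?N (orbit_map f \<circ> T g)"
      by (rule distr_cong) (auto simp: orbit_map_equivariant[OF f])
    also have "\<dots> = distr (distr M M (T g)) ?N (orbit_map f)" by (rule distr_distr[OF \<Phi> Tm, symmetric])
    also have "\<dots> = \<nu>" unfolding T_distr \<nu>_def ..
    finally show ?thesis .
  qed
  ultimately show ?thesis
    unfolding pmp_action_def \<nu>_def[symmetric] using L2_translate_zero L2_translate_add sp by simp
qed

text \<open>The function \<open>f\<close> is rational on \<open>D\<close> and an injective irrational code off \<open>D\<close>.  The irrational values
  give injectivity of the orbit map, the approximation property gives full support.\<close>

theorem linear_model_exists: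
  "\<exists>\<nu>. sets \<nu> = sets (borel_sigma (L2_topology w)) \<and>
     pmp_action \<nu> (L2_translate w) \<and>
     (\<forall>U. openin (L2_topology w) U \<and> U \<noteq> {} \<longrightarrow> emeasure \<nu> U > 0) \<and>
     isomorphic_actions M T \<nu> (L2_translate w)"
proof -
  let ?N = "borel_sigma (L2_topology w)"
  obtain \<xi> where \<xi>: "\<And>n. \<xi> n \<in> L2_fun w" and ds: "dense_sequence (L2 w) (L2_dist w) (\<lambda>n::nat. L2_class w (\<xi> n))"
    using L2_dense_sequence_exists by auto
  have \<xi>m [measurable]: "\<xi> n \<in> borel_measurable borel" for n using \<xi>[of n] by (simp add: L2_fun_iff w_measurable_iff)
  interpret dense_sequence "L2 w" "L2_dist w" "\<lambda>n::nat. L2_class w (\<xi> n)" by (rule ds)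
  from irrational_code_exists obtain f0 :: "'x \<Rightarrow> real" and c where f0 [measurable]: "f0 \<in> borel_measurable M"
    and c: "\<forall>x. \<bar>f0 x\<bar> \<le> c" and f0_inj: "inj_on f0 (space M)" and f0_irr: "AE x in M. f0 x \<notin> \<rat>"
    by (elim exE conjE)
  \<comment> \<open>One requirement for each centre and each radius \<open>1/(j+1)\<close>; the integral to be
    bounded is the square of the distance.\<close>
  define \<epsilon> where "\<epsilon> r = (1 / real (Suc (snd (prod_decode r))))\<^sup>2" for r
  have "\<exists>f D. f \<in> borel_measurable M \<and> (\<integral>\<^sup>+x. ennreal ((f x)\<^sup>2) \<partial>M) < \<infinity> \<and>
    D \<in> sets M \<and> emeasure M D \<le> 1/2 \<and> (\<forall>x\<in>D. f x \<in> \<rat>) \<and> (\<forall>x\<in>space M - D. f x = f0 x) \<and>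
    (\<forall>r. emeasure M {x\<in>space M. orbit_dist f (\<xi> (fst (prod_decode r))) x < ennreal (\<epsilon> r)} > 0)"
    by (rule generic_function_exists[OF f0 c[rule_format]]) (use \<xi> in \<open>auto simp: L2_fun_iff \<epsilon>_def\<close>)
  then obtain f D where f [measurable]: "f \<in> borel_measurable M" and fin: "(\<integral>\<^sup>+x. ennreal ((f x)\<^sup>2) \<partial>M) < \<infinity>"
    and D [measurable]: "D \<in> sets M" and D_small: "emeasure M D \<le> 1/2" and fD: "\<And>x. x \<in> D \<Longrightarrow> f x \<in> \<rat>"
    and f_out: "\<And>x. x \<in> space M - D \<Longrightarrow> f x = f0 x"
    and dense_f: "\<And>r. emeasure M {x\<in>space M. orbit_dist f (\<xi> (fst (prod_decode r))) x < ennreal (\<epsilon> r)} > 0"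
    by auto
  define \<Phi> where "\<Phi> = orbit_map f"
  have \<Phi>: "\<Phi> \<in> M \<rightarrow>\<^sub>M ?N" unfolding \<Phi>_def by (rule orbit_map_measurable[OF f])
  have AE_fin: "AE x in M. orbit_norm f x < \<infinity>" by (rule AE_orbit_norm[OF f fin])
  have support: "emeasure (distr M ?N \<Phi>) U > 0" if U: "openin (L2_topology w) U" "U \<noteq> {}" for U
  proof -
    obtain a where a: "a \<in> U" using U(2) by blast
    obtain i j where ij: "mball (L2_class w (\<xi> i)) (1 / real (Suc j)) \<subseteq> U"
      using mball_base[of U a] U(1) a unfolding L2_topology_def by blast
    define W where "W = {x\<in>space M. orbit_dist f (\<xi> i) x < ennreal ((1 / real (Suc j))\<^sup>2)}"
    have W: "emeasure M W > 0" using dense_f[of "prod_encode (i, j)"] unfolding W_def \<epsilon>_def by simp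
    have Us: "U \<in> sets ?N" using U(1) by (rule borel_sigma_open)
    have "emeasure M W \<le> emeasure M (\<Phi> -` U \<inter> space M)"
    proof (rule emeasure_mono_AE)
      show "AE x in M. x \<in> W \<longrightarrow> x \<in> \<Phi> -` U \<inter> space M"
        using AE_fin
      proof eventually_elim
        case (elim x)
        show ?case
        proof
          assume xW: "x \<in> W"
          then have x: "x \<in> space M" unfolding W_def by simp
          have eq: "orbit_function f x = (\<lambda>h. f (T h x))" using elim by (auto simp: orbit_function_def)
          have "(\<integral>\<^sup>+h. ennreal ((\<xi> i h - f (T h x))\<^sup>2) \<partial>w) < ennreal ((1 / real (Suc j))\<^sup>2)"
            using xW unfolding W_def orbit_dist_def by (simp add: power2_commute[of "\<xi> i _"])
          then have "L2_dist w (L2_class w (\<xi> i)) (\<Phi> x) < 1 / real (Suc j)"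
            unfolding \<Phi>_def orbit_map_def eq
            by (intro L2_dist_less[OF \<xi>]) (use orbit_function_L2[OF f x] in \<open>auto simp: eq\<close>)
          moreover have "\<Phi> x \<in> L2 w" unfolding \<Phi>_def by (rule orbit_map_in[OF f x])
          ultimately have "\<Phi> x \<in> mball (L2_class w (\<xi> i)) (1 / real (Suc j))" using L2_class_in[OF \<xi>] by simp
          then show "x \<in> \<Phi> -` U \<inter> space M" using ij x by blast
        qed
      qed
      show "\<Phi> -` U \<inter> space M \<in> sets M" by (rule measurable_sets[OF \<Phi> Us])
    qed
    also have "\<dots> = emeasure (distr M ?N \<Phi>) U" by (rule emeasure_distr[OF \<Phi> Us, symmetric])
    finally show ?thesis using W by simp
  qed
  \<comment> \<open>Off the rationals, \<open>f\<close> coincides with the injective code.\<close>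
  define A where "A = - (\<rat> :: real set)"
  have A [measurable]: "A \<in> sets borel" unfolding A_def by (intro borel_comp Rats_borel)
  have notD: "x \<in> space M - D \<and> f0 x = f x" if "x \<in> space M" "f x \<in> A" for x
  proof -
    have "x \<notin> D" using that fD[of x] unfolding A_def by blast
    then show ?thesis using that f_out[of x] by simp
  qed
  have A_inj: "inj_on f {x\<in>space M. f x \<in> A}"
  proof (rule inj_onI)
    fix x y assume x: "x \<in> {x\<in>space M. f x \<in> A}" and y: "y \<in> {x\<in>space M. f x \<in> A}" and eq: "f x = f y"
    have "f0 x = f0 y" using notD[of x] notD[of y] x y eq by simp
    then show "x = y" using f0_inj x y by (simp add: inj_on_def)
  qed
  have A_pos: "emeasure M {x\<in>space M. f x \<in> A} > 0"
  proof (rule ccontr)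
    assume n: "\<not> emeasure M {x\<in>space M. f x \<in> A} > 0"
    have s: "{x\<in>space M. f x \<in> A} \<in> sets M" by measurable
    have "AE x in M. x \<notin> {x\<in>space M. f x \<in> A}" by (rule AE_not_in) (use n s in \<open>auto simp: null_sets_def\<close>)
    then have "AE x in M. x \<in> D" using f0_irr AE_space
    proof eventually_elim
      case (elim x)
      then show ?case using f_out[of x] by (cases "x \<in> D") (auto simp: A_def)
    qed
    then have "measure M D = 1" using M.AE_in_set_eq_1[OF D] by simp
    then have "1 \<le> (1/2 :: ennreal)" using D_small by (simp add: M.emeasure_eq_measure)
    moreover have "(1/2 :: ennreal) = ennreal (1/2)" using divide_ennreal[of 1 2] by simp
    ultimately have "ennreal 1 \<le> ennreal (1/2)" by simp
    then show False by (subst (asm) ennreal_le_iff) auto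
  qed
  define X1 where "X1 = {x\<in>space M. orbit_norm f x < \<infinity> \<and> (\<integral>\<^sup>+h. indicator A (f (T h x)) \<partial>w) > 0}"
  have X1: "X1 \<in> sets M"
  proof -
    note [measurable] = orbit_norm_measurable[OF f]
    show ?thesis unfolding X1_def by measurable
  qed
  have "AE x in M. x \<in> X1"
    using AE_fin AE_orbit_visits[OF f A A_pos] AE_space by eventually_elim (auto simp: X1_def)
  then have X1_null: "emeasure M (space M - X1) = 0"
    using M.AE_in_set_eq_1[OF X1] M.prob_compl[OF X1] by (simp add: M.emeasure_eq_measure)
  have X1_inj: "inj_on \<Phi> X1"
    unfolding \<Phi>_def by (rule inj_onI) (rule orbit_map_inj[OF f A A_inj], auto simp: X1_def)
  have reg: "compact_inner_regular X M"
    by (rule compact_inner_regular_Polish[OF M.finite_measure_axioms setsM X])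
  obtain X0 where X0: "X0 \<in> sets M" "X0 \<subseteq> X1" "emeasure M (space M - X0) = 0"
    "\<And>E. E \<in> sets M \<Longrightarrow> \<Phi> ` (X0 \<inter> E) \<in> sets ?N"
    using injective_image_measurable_mod_null[OF M.finite_measure_axioms reg setsM hausdorff_X \<Phi> _ _ X1 X1_null X1_inj]
      second_countable_mtopology Hausdorff_space_mtopology unfolding L2_topology_def by auto
  have "isomorphic_actions M T (distr M ?N \<Phi>) (L2_translate w)"
  proof (rule isomorphic_actions_distr[OF M.prob_space_axioms \<Phi> X0(1,3) _ X0(4) _ T_distr])
    show "inj_on \<Phi> X0" using X1_inj X0(2) by (rule inj_on_subset)
    show "T g \<in> M \<rightarrow>\<^sub>M M" for g by (intro T_measurable) auto
    show "\<Phi> (T g x) = L2_translate w g (\<Phi> x)" if "x \<in> space M" for g x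
      unfolding \<Phi>_def by (rule orbit_map_equivariant[OF f that])
  qed
  then show ?thesis
    using orbit_map_distr_action[OF f] support unfolding \<Phi>_def[symmetric]
    by (intro exI[of _ "distr M ?N \<Phi>"]) auto
qed

end

theorem theorem5p1:
  fixes K :: "nat \<Rightarrow> 'g::{topological_group_add, t2_space, second_countable_topology} set"
    and p :: "nat \<Rightarrow> real"
    and lam :: "nat \<Rightarrow> 'g measure"
    and rho w :: "'g measure"
    and M :: "'x measure"
    and T :: "'g \<Rightarrow> 'x \<Rightarrow> 'x"
  assumes "locally_compact_space (euclidean :: 'g topology)"
    and "\<And>n. add_subgroup (K n)" and "\<And>n. compact (K n)" and "\<And>n. open (K n)"
    and "\<And>n. K n \<subset> K (Suc n)"
    and "(\<Union>n. K n) = UNIV"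
    and "\<And>n. p n > 0" and "p sums 1"
    and "\<exists>C>0. \<forall>n. p n / p (Suc n) \<le> C"
    and "\<And>n. normalized_haar (K n) (lam n)"
    and "rho = mixture p lam"
    and "w = mixture p (\<lambda>n. conv_power rho (Suc n))"
    and "standard_prob_space M"
    and "pmp_action M T" and "ergodic_action M T" and "free_action M T"
  shows "\<exists>\<nu>. sets \<nu> = sets (borel_sigma (L2_topology w)) \<and>
             pmp_action \<nu> (L2_translate w) \<and>
             (\<forall>U. openin (L2_topology w) U \<and> U \<noteq> {} \<longrightarrow> emeasure \<nu> U > 0) \<and>
             isomorphic_actions M T \<nu> (L2_translate w)"
proof -
  obtain X where X: "completely_metrizable_space X" "second_countable X" "topspace X = space M"
    "sets M = sets (borel_sigma X)"
    using assms(13) unfolding standard_prob_space_def by blast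
  obtain V where V: "enumerated_base X V" using enumerated_base_exists[OF X(2)] by blast
  interpret tower_action K p lam rho w M T X V
    by unfold_locales (use assms X V in auto)
  show ?thesis by (rule linear_model_exists)
qed

end
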